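(* Let $\Gamma\subset \mathrm{PSL}(2,\mathbb{R})$ be a discrete and cocompact subgroup. Let $\epsilon=\dim_{\mathbb{C}} I/(I\cap\widetilde{I}^2)$ and let $A_1,\dots,A_\epsilon$ be homogeneous elements of $I$, of weights $w_1,\dots,w_\epsilon\in 2\mathbb{Z}$, which are linearly independent modulo $\widetilde{I}^2$. Then for every even integer $k\ge 0$, $$(\widetilde{I}/\widetilde{I}^2)_k=\bigoplus_{1\le i\le\epsilon,\ w_i\le k}\mathbb{C}\,D^{(k-w_i)/2}(A_i),$$ i.e. the classes modulo $\widetilde I^2$ of the forms $D^{(k-w_i)/2}(A_i)$ with $w_i\le k$ form a basis of the weight-$k$ part $(\widetilde{I}/\widetilde{I}^2)_k$.
   Context: $\mathcal H$ is the upper half plane. A modular form of weight $k$ over $\Gamma$ is a holomorphic $f:\mathcal H\to\mathbb C$ of moderate growth (the usual polynomial growth condition, $|f(z)|=O(((1+|z|^2)/\operatorname{Im} z)^N)$ for some $N$) with $(cz+d)^{-k}f(\frac{az+b}{cz+d})=f(z)$ for all $\begin{pmatrix}a&b\\c&d\end{pmatrix}\in\Gamma$. A quasimodular form of weight $k$ and depth $\le p$ over $\Gamma$ is a holomorphic $f:\mathcal H\to\mathbb C$ of moderate growth for which there are functions $f_0,\dots,f_p:\mathcal H\to\mathbb C$ with $(cz+d)^{-k}f(\frac{az+b}{cz+d})=\sum_{j=0}^p f_j(z)\left(\frac{c}{cz+d}\right)^j$ for all $z\in\mathcal H$ and all $\begin{pmatrix}a&b\\c&d\end{pmatrix}\in\Gamma$.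 $M_*=\bigoplus_{k\ge0}M_k$ and $\widetilde M_*=\bigoplus_{k\ge0}\widetilde M_k$ are the graded rings of modular and quasimodular forms over $\Gamma$ (weights are even, since $\Gamma\subset\mathrm{PSL}(2,\mathbb R)$). $D=d/dz$, which maps $\widetilde M_k$ to $\widetilde M_{k+2}$. $I=\bigoplus_{k>0}M_k\subset M_*$ and $\widetilde I=\bigoplus_{k>0}\widetilde M_k\subset\widetilde M_*$ are the ideals of elements of positive weight; $\widetilde I^2$ is the graded ideal with $\widetilde I^2_k=\sum_{0<j<k}\widetilde M_j\widetilde M_{k-j}$. *)

theory Defs
  imports
    "HOL-Complex_Analysis.Complex_Analysis"
    "HOL-Algebra.Coset"
    "HOL-Library.Function_Algebras"
begin

section \<open>Quotients of vector spaces\<close>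

locale vector_space_quotient = vector_space
begin

text \<open>
  For subspaces \<open>W \<subseteq> V\<close>, the quotient \<open>V/W\<close> is treated through representatives: a linear
  combination of classes vanishes in \<open>V/W\<close> iff the same combination of representatives lies in
  \<open>W\<close>. Families indexed by \<open>J\<close> (rather than sets of vectors) are used so that repeated or
  congruent members count as dependent.
\<close>

definition independent_mod :: "'b set \<Rightarrow> 'i set \<Rightarrow> ('i \<Rightarrow> 'b) \<Rightarrow> bool" where
  "independent_mod W J v \<longleftrightarrow>
     (\<forall>F c. finite F \<longrightarrow> F \<subseteq> J \<longrightarrow> (\<Sum>i\<in>F. scale (c i) (v i)) \<in> W \<longrightarrow> (\<forall>i\<in>F. c i = 0))"

definition basis_mod :: "'b set \<Rightarrow> 'b set \<Rightarrow> 'i set \<Rightarrow> ('i \<Rightarrow> 'b) \<Rightarrow> bool" where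
  "basis_mod V W J v \<longleftrightarrow>
     v ` J \<subseteq> V \<and> independent_mod W J v \<and> (\<forall>x\<in>V. \<exists>y\<in>span (v ` J). x - y \<in> W)"

text \<open>
  The dimension of \<open>V/W\<close>, with the same convention as \<^const>\<open>dim\<close>: it is \<open>0\<close> for an
  infinite-dimensional quotient.
\<close>

definition quot_dim :: "'b set \<Rightarrow> 'b set \<Rightarrow> nat" where
  "quot_dim V W =
     (if \<exists>B. basis_mod V W B (\<lambda>x. x) then card (SOME B. basis_mod V W B (\<lambda>x. x)) else 0)"

end


section \<open>Discrete cocompact subgroups of PSL(2,R)\<close>

definition SL2R :: "(real^2^2) monoid" where
  "SL2R = \<lparr>carrier = {A. det A = 1}, mult = (**), one = mat 1\<rparr>"

text \<open>Elements of \<open>PSL2R\<close> are the cosets \<open>{A, -A}\<close>.\<close>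

definition PSL2R :: "(real^2^2) set monoid" where
  "PSL2R = SL2R Mod {mat 1, - mat 1}"

lemma group_SL2R: "group SL2R"
proof (rule groupI)
  fix A assume "A \<in> carrier SL2R"
  then have d: "det A = 1" by (simp add: SL2R_def)
  then have "invertible A" by (simp add: invertible_det_nz)
  then obtain B where B: "B ** A = mat 1"
    unfolding invertible_def by blast
  have "det B = det (B ** A)" using d by (simp add: det_mul)
  then have "det B = 1" using B by simp
  then show "\<exists>B\<in>carrier SL2R. B \<otimes>\<^bsub>SL2R\<^esub> A = \<one>\<^bsub>SL2R\<^esub>"
    using B by (intro bexI[of _ B]) (simp_all add: SL2R_def)
qed (simp_all add: SL2R_def det_mul matrix_mul_assoc[symmetric])

lemma matrix_mul_minus: "- A ** B = - (A ** B)" "A ** - B = - (A ** B)" for A B :: "real^2^2"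
  by (simp_all add: matrix_matrix_mult_def vec_eq_iff sum_negf)

lemma normal_center_SL2R: "{mat 1, - mat 1} \<lhd> SL2R"
proof -
  interpret group SL2R by (rule group_SL2R)
  let ?Z = "{mat 1, - mat 1 :: real^2^2}"
  have d: "det (- mat 1 :: real^2^2) = 1" by (simp add: det_2 mat_def)
  have Z: "?Z \<subseteq> carrier SL2R" using d by (simp add: SL2R_def)
  have m: "x \<otimes>\<^bsub>SL2R\<^esub> y = x ** y" for x y by (simp add: SL2R_def)
  have o: "\<one>\<^bsub>SL2R\<^esub> = mat 1" by (simp add: SL2R_def)
  have sq: "x \<otimes>\<^bsub>SL2R\<^esub> x = \<one>\<^bsub>SL2R\<^esub>" if "x \<in> ?Z" for x
    using that unfolding m o by (elim insertE emptyE) (simp_all only: matrix_mul_minus matrix_mul_lid minus_minus)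
  have inv: "inv\<^bsub>SL2R\<^esub> x = x" if "x \<in> ?Z" for x
    using inv_equality[OF sq[OF that]] that Z by blast
  have mult: "x \<otimes>\<^bsub>SL2R\<^esub> y \<in> ?Z" if "x \<in> ?Z" "y \<in> ?Z" for x y
    using that unfolding m
    by (elim insertE emptyE) (simp_all only: matrix_mul_minus matrix_mul_lid minus_minus insert_iff simp_thms)
  have "subgroup ?Z SL2R"
    using Z by (intro subgroupI) (simp_all only: inv mult insert_not_empty not_False_eq_True)
  moreover have "?Z #>\<^bsub>SL2R\<^esub> x = x <#\<^bsub>SL2R\<^esub> ?Z" for x
    by (simp add: r_coset_def l_coset_def m matrix_mul_minus)
  ultimately show ?thesis by (intro normalI ballI)
qed

lemma group_PSL2R: "group PSL2R"
  unfolding PSL2R_def by (rule normal.factorgroup_is_group[OF normal_center_SL2R])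

text \<open>The quotient topology on a partition \<open>P\<close> of the space \<open>X\<close>.\<close>

definition partition_topology :: "'a topology \<Rightarrow> 'a set set \<Rightarrow> 'a set topology" where
  "partition_topology X P = topology (\<lambda>U. U \<subseteq> P \<and> openin X (\<Union>U))"

lemma istopology_partition:
  assumes "disjoint P"
  shows "istopology (\<lambda>U. U \<subseteq> P \<and> openin X (\<Union>U))"
proof -
  have *: "\<Union>(S \<inter> T) = \<Union>S \<inter> \<Union>T" if "S \<subseteq> P" "T \<subseteq> P" for S T
  proof (intro equalityI subsetI)
      fix x assume "x \<in> \<Union>S \<inter> \<Union>T"
      then obtain s t where st: "s \<in> S" "t \<in> T" "x \<in> s" "x \<in> t" by blast
      have "s \<in> P" "t \<in> P" using that st by blast+
      then have "s = t" using st disjointD[OF assms, of s t] by blast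
      then show "x \<in> \<Union>(S \<inter> T)" using st by blast
    qed blast
  have 1: "S \<inter> T \<subseteq> P \<and> openin X (\<Union>(S \<inter> T))"
    if "S \<subseteq> P \<and> openin X (\<Union>S)" "T \<subseteq> P \<and> openin X (\<Union>T)" for S T
    using *[of S T] openin_Int[of X "\<Union>S" "\<Union>T"] that by (metis inf.coboundedI1)
  have 2: "\<Union>K \<subseteq> P \<and> openin X (\<Union>(\<Union>K))"
    if "\<forall>U\<in>K. U \<subseteq> P \<and> openin X (\<Union>U)" for K
  proof -
    have "\<Union>(\<Union>K) = \<Union>(Union ` K)" by blast
    moreover have "openin X (\<Union>(Union ` K))" by (rule openin_Union) (use that in blast)
    ultimately show ?thesis using that by (metis Union_least)
  qed
  show ?thesis unfolding istopology_def using 1 2 by (intro conjI allI impI) blast+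
qed

lemma openin_partition_topology:
  assumes "disjoint P"
  shows "openin (partition_topology X P) U \<longleftrightarrow> U \<subseteq> P \<and> openin X (\<Union>U)"
  unfolding partition_topology_def topology_inverse'[OF istopology_partition[OF assms]] ..

definition PSL2R_topology :: "(real^2^2) set topology" where
  "PSL2R_topology = partition_topology (top_of_set (carrier SL2R)) (carrier PSL2R)"

definition discrete_subgroup :: "(real^2^2) set set \<Rightarrow> bool" where
  "discrete_subgroup \<Gamma> \<longleftrightarrow>
     subgroup \<Gamma> PSL2R \<and> subtopology PSL2R_topology \<Gamma> = discrete_topology \<Gamma>"

text \<open>\<open>\<Gamma>\<close> is cocompact if the space of cosets \<open>\<Gamma>g\<close> is compact.\<close>

definition cocompact_subgroup :: "(real^2^2) set set \<Rightarrow> bool" where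
  "cocompact_subgroup \<Gamma> \<longleftrightarrow>
     subgroup \<Gamma> PSL2R \<and> compact_space (partition_topology PSL2R_topology (rcosets\<^bsub>PSL2R\<^esub> \<Gamma>))"


section \<open>Modular and quasimodular forms\<close>

definition upper_half_plane :: "complex set"  (\<open>\<H>\<close>) where
  "\<H> = {z. Im z > 0}"

definition automorphy :: "real^2^2 \<Rightarrow> complex \<Rightarrow> complex" where
  "automorphy A z = of_real (A$2$1) * z + of_real (A$2$2)"

definition moebius :: "real^2^2 \<Rightarrow> complex \<Rightarrow> complex" where
  "moebius A z = (of_real (A$1$1) * z + of_real (A$1$2)) / automorphy A z"

definition moderate_growth :: "(complex \<Rightarrow> complex) \<Rightarrow> bool" where
  "moderate_growth f \<longleftrightarrow>
     (\<exists>(N::nat) C. \<forall>z\<in>\<H>. norm (f z) \<le> C * ((1 + (norm z)\<^sup>2) / Im z) ^ N)"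

text \<open>
  A function on \<open>\<H>\<close> is represented by its extension by \<open>0\<close> to all of \<^typ>\<open>complex\<close>, so that
  equality of representatives is equality on \<open>\<H>\<close>. The union \<open>\<Union>\<Gamma>\<close> consists of all matrices
  representing elements of \<open>\<Gamma>\<close>; since it contains \<open>A\<close> along with \<open>-A\<close>, only the zero
  form has odd weight.
\<close>

definition modular_forms :: "(real^2^2) set set \<Rightarrow> int \<Rightarrow> (complex \<Rightarrow> complex) set" where
  "modular_forms \<Gamma> k = {f.
     (\<forall>z. z \<notin> \<H> \<longrightarrow> f z = 0) \<and> f holomorphic_on \<H> \<and> moderate_growth f \<and>
     (\<forall>A\<in>\<Union>\<Gamma>. \<forall>z\<in>\<H>. automorphy A z powi (- k) * f (moebius A z) = f z)}"

definition quasimodular_forms_depth ::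
    "(real^2^2) set set \<Rightarrow> int \<Rightarrow> nat \<Rightarrow> (complex \<Rightarrow> complex) set" where
  "quasimodular_forms_depth \<Gamma> k p = {f.
     (\<forall>z. z \<notin> \<H> \<longrightarrow> f z = 0) \<and> f holomorphic_on \<H> \<and> moderate_growth f \<and>
     (\<exists>\<phi> :: nat \<Rightarrow> complex \<Rightarrow> complex. \<forall>A\<in>\<Union>\<Gamma>. \<forall>z\<in>\<H>.
        automorphy A z powi (- k) * f (moebius A z) =
        (\<Sum>j\<le>p. \<phi> j z * (of_real (A$2$1) / automorphy A z) ^ j))}"

definition quasimodular_forms :: "(real^2^2) set set \<Rightarrow> int \<Rightarrow> (complex \<Rightarrow> complex) set" where
  "quasimodular_forms \<Gamma> k = (\<Union>p. quasimodular_forms_depth \<Gamma> k p)"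

definition D :: "(complex \<Rightarrow> complex) \<Rightarrow> complex \<Rightarrow> complex" where
  "D f = (\<lambda>z. if z \<in> \<H> then deriv f z else 0)"


section \<open>The graded ideals\<close>

text \<open>
  \<open>form\<close> is the complex vector space of functions. An element of a graded space is the
  sequence of its homogeneous components, and \<open>graded\<close> is the vector space of all such sequences.
\<close>

global_interpretation form: vector_space_quotient "\<lambda>(c::complex) (f :: complex \<Rightarrow> complex) z. c * f z"
  by unfold_locales (simp_all only: fun_eq_iff plus_fun_apply distrib_left distrib_right mult.assoc mult_1_left simp_thms)

global_interpretation graded: vector_space_quotient
    "\<lambda>(c::complex) (F :: nat \<Rightarrow> complex \<Rightarrow> complex) k z. c * F k z"
  by unfold_locales (simp_all only: fun_eq_iff plus_fun_apply distrib_left distrib_right mult.assoc mult_1_left simp_thms)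

definition graded_sum :: "(nat \<Rightarrow> (complex \<Rightarrow> complex) set) \<Rightarrow> (nat \<Rightarrow> complex \<Rightarrow> complex) set" where
  "graded_sum V = {F. (\<forall>k. F k \<in> V k) \<and> finite {k. F k \<noteq> 0}}"

definition homogeneous :: "nat \<Rightarrow> (complex \<Rightarrow> complex) \<Rightarrow> nat \<Rightarrow> complex \<Rightarrow> complex" where
  "homogeneous k f = (\<lambda>j. if j = k then f else 0)"

definition I_part :: "(real^2^2) set set \<Rightarrow> nat \<Rightarrow> (complex \<Rightarrow> complex) set" where
  "I_part \<Gamma> k = (if k > 0 then modular_forms \<Gamma> (int k) else {0})"

definition I_tilde_part :: "(real^2^2) set set \<Rightarrow> nat \<Rightarrow> (complex \<Rightarrow> complex) set" where
  "I_tilde_part \<Gamma> k = (if k > 0 then quasimodular_forms \<Gamma> (int k) else {0})"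

definition I_tilde_sq_part :: "(real^2^2) set set \<Rightarrow> nat \<Rightarrow> (complex \<Rightarrow> complex) set" where
  "I_tilde_sq_part \<Gamma> k = form.span {f * g | f g j.
     0 < j \<and> j < k \<and> f \<in> quasimodular_forms \<Gamma> (int j) \<and> g \<in> quasimodular_forms \<Gamma> (int (k - j))}"

definition I_ideal :: "(real^2^2) set set \<Rightarrow> (nat \<Rightarrow> complex \<Rightarrow> complex) set" where
  "I_ideal \<Gamma> = graded_sum (I_part \<Gamma>)"

definition I_tilde_sq :: "(real^2^2) set set \<Rightarrow> (nat \<Rightarrow> complex \<Rightarrow> complex) set" where
  "I_tilde_sq \<Gamma> = graded_sum (I_tilde_sq_part \<Gamma>)"

end

theory Submission imports Defs
begin

text \<open>
  A quasimodular form \<open>f\<close> of weight \<open>k\<close> transforms by polynomials \<open>Q z\<close> evaluated at the cocycle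
  \<open>c / (c z + d)\<close>. The cocycle takes infinitely many values at each \<open>z\<close>, so \<open>Q\<close> is determined by \<open>f\<close>, and
  its linear coefficient defines a lowering operator of weight \<open>-2\<close>. This operator is a derivation,
  it acts on \<open>Q\<close> as differentiation, its kernel consists of the modular forms, and its commutator
  with \<open>D\<close> is multiplication by the weight. Lowering \<open>D^j B\<close> exactly \<open>j\<close> times, for a modular form \<open>B\<close> of
  positive weight, returns a nonzero multiple of \<open>B\<close>. The argument rests on three further facts.

  First, a cocompact group has no form of weight two and depth exactly one (\<open>no_weight_2_quasi\<close>). The
  primitive of such a form, suitably normalised, would give a real function \<open>u = Re F + ln Im\<close> that changes by an
  additive constant under each group element. Averaging \<open>u\<close> over hyperbolic discs lowers it by a
  positive constant that does not depend on the centre, since \<open>ln Im\<close> is strictly superharmonic for the invariant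
  Laplacian. On the compact quotient the total change under a symmetric averaging is zero, which is
  a contradiction (\<open>no_additive_potential\<close>). Two consequences follow: the values of the cocycle are infinite in
  number, and every quasimodular form is a sum of derivatives of modular forms
  (\<open>QF_subset_span_DM\<close>), because a top coefficient of weight zero is excluded.

  Secondly, the positive-weight modular forms are finite-dimensional modulo decomposable quasimodular
  forms (\<open>card_independent_bound\<close>). If \<open>f\<close> vanishes to order \<open>n\<close> at \<open>z\<close>, then its Rankin-Cohen bracket with itself of
  degree \<open>2 n\<close> does not vanish at \<open>z\<close>. Hence there are two forms \<open>F\<close> and \<open>g\<close> of the same weight without common
  zero. A combination of modular forms is divisible by \<open>F\<close> as soon as finitely many linear conditions hold, their
  number being independent of the weight, and multiplication by powers of \<open>g\<close> allows different
  weights to be compared. So only boundedly many forms are independent modulo \<open>F M + g M\<close>, and these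
  multiples are decomposable above the weight of \<open>F\<close>.

  Thirdly, the decomposable quasimodular forms are stable under \<open>D\<close> and under lowering, the latter because
  forms of weight at most two are modular and are therefore annihilated by lowering. If a sum of the
  \<open>D^j (B j)\<close> is decomposable, lowering it as often as the highest \<open>j\<close> that occurs shows that this \<open>B j\<close> is decomposable,
  and induction treats the others (\<open>Isq_components\<close>). This yields independence. For spanning, finiteness of the
  dimension makes the \<open>A i\<close> a basis of the modular forms modulo decomposables, and derivatives of
  modular forms span everything.
\<close>


section \<open>Moebius transformations and the hyperbolic distance\<close>

no_notation fps_nth (infixl "$" 75)

text \<open>
  This is \<open>4 sinh\<^sup>2(d/2)\<close> for the hyperbolic distance \<open>d\<close>: a rational substitute for \<open>d\<close>, invariant under
  Moebius transformations.
\<close>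

definition sig :: "complex \<Rightarrow> complex \<Rightarrow> real" where
  "sig z w = (cmod (z - w))\<^sup>2 / (Im z * Im w)"

definition adjugate2 :: "real^2^2 \<Rightarrow> real^2^2" where
  "adjugate2 A = (\<chi> i j. if i = j then A $ (if i = 1 then 2 else 1) $ (if i = 1 then 2 else 1) else - (A $ i $ j))"

lemma adjugate2_simps [simp]:
  "adjugate2 A $ 1 $ 1 = A $ 2 $ 2" "adjugate2 A $ 1 $ 2 = - (A $ 1 $ 2)"
  "adjugate2 A $ 2 $ 1 = - (A $ 2 $ 1)" "adjugate2 A $ 2 $ 2 = A $ 1 $ 1"
  by (simp_all add: adjugate2_def)

lemma matrix_mult_2: "(A ** B) $ i $ j = A $ i $ 1 * B $ 1 $ j + A $ i $ 2 * B $ 2 $ j"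
  for A B :: "real^2^2"
  by (simp add: matrix_matrix_mult_def sum_2)

lemma mat_eq_2_iff: "A = B \<longleftrightarrow> A $ 1 $ 1 = B $ 1 $ 1 \<and> A $ 1 $ 2 = B $ 1 $ 2 \<and> A $ 2 $ 1 = B $ 2 $ 1 \<and> A $ 2 $ 2 = B $ 2 $ 2"
  for A B :: "real^2^2"
  unfolding vec_eq_iff forall_2 by blast

lemma mat_1_2 [simp]: "(mat 1 :: real^2^2) $ 1 $ 1 = 1" "(mat 1 :: real^2^2) $ 1 $ 2 = 0"
   "(mat 1 :: real^2^2) $ 2 $ 1 = 0" "(mat 1 :: real^2^2) $ 2 $ 2 = 1"
  by (simp_all add: mat_def)

lemma det_adjugate2 [simp]: "det (adjugate2 A) = det A"
  by (simp add: det_2)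

lemma adjugate2_mult: "det A = 1 \<Longrightarrow> adjugate2 A ** A = mat 1"  "det A = 1 \<Longrightarrow> A ** adjugate2 A = mat 1"
  by (simp_all add: mat_eq_2_iff matrix_mult_2 det_2 algebra_simps)

lemma adjugate2_adjugate2 [simp]: "adjugate2 (adjugate2 A) = A"
  by (simp add: mat_eq_2_iff)

lemma norm_mat_2: "(norm A)\<^sup>2 = (A$1$1)\<^sup>2 + (A$1$2)\<^sup>2 + (A$2$1)\<^sup>2 + (A$2$2)\<^sup>2" for A :: "real^2^2"
  by (simp add: norm_vec_def L2_set_def sum_2)

lemma norm_adjugate2 [simp]: "norm (adjugate2 A) = norm A"
proof -
  have "(norm (adjugate2 A))\<^sup>2 = (norm A)\<^sup>2"
    by (simp add: norm_mat_2)
  then show ?thesis by simp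
qed

lemma norm_matrix_mult_2: "norm (A ** B) \<le> norm A * norm B" for A B :: "real^2^2"
proof (rule power2_le_imp_le)
  have cs: "(a * b + c * d)\<^sup>2 \<le> (a\<^sup>2 + c\<^sup>2) * (b\<^sup>2 + d\<^sup>2)" for a b c d :: real
    using sum_squares_ge_zero[of "a * d - b * c" 0] by (simp add: power2_eq_square algebra_simps)
  have "(norm (A ** B))\<^sup>2 \<le> ((A$1$1)\<^sup>2 + (A$1$2)\<^sup>2) * ((B$1$1)\<^sup>2 + (B$2$1)\<^sup>2)
      + ((A$1$1)\<^sup>2 + (A$1$2)\<^sup>2) * ((B$1$2)\<^sup>2 + (B$2$2)\<^sup>2)
      + ((A$2$1)\<^sup>2 + (A$2$2)\<^sup>2) * ((B$1$1)\<^sup>2 + (B$2$1)\<^sup>2)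
      + ((A$2$1)\<^sup>2 + (A$2$2)\<^sup>2) * ((B$1$2)\<^sup>2 + (B$2$2)\<^sup>2)"
    unfolding norm_mat_2 matrix_mult_2 by (intro add_mono cs)
  also have "\<dots> = (norm A)\<^sup>2 * (norm B)\<^sup>2"
    unfolding norm_mat_2 by (simp add: algebra_simps)
  finally show "(norm (A ** B))\<^sup>2 \<le> (norm A * norm B)\<^sup>2"
    by (simp add: power_mult_distrib)
qed simp

lemma upper_half_plane_iff: "z \<in> \<H> \<longleftrightarrow> Im z > 0"
  by (simp add: upper_half_plane_def)

lemma automorphy_nonzero:
  assumes "det A = 1" "z \<in> \<H>"
  shows "automorphy A z \<noteq> 0"
proof
  assume "automorphy A z = 0"
  then have "Im (automorphy A z) = 0" "Re (automorphy A z) = 0" by simp_all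
  then have "A$2$1 * Im z = 0" "A$2$1 * Re z + A$2$2 = 0" by (simp_all add: automorphy_def)
  then have "A$2$1 = 0" "A$2$2 = 0" using assms(2) by (auto simp: upper_half_plane_iff)
  then show False using assms(1) by (simp add: det_2)
qed

lemma Im_moebius:
  assumes "det A = 1" "z \<in> \<H>"
  shows "Im (moebius A z) = Im z / (cmod (automorphy A z))\<^sup>2"
proof -
  have d: "A$1$1 * A$2$2 - A$1$2 * A$2$1 = 1" using assms(1) by (simp add: det_2)
  have "Im (moebius A z) = (A$1$1 * A$2$2 - A$1$2 * A$2$1) * Im z / (cmod (automorphy A z))\<^sup>2"
    unfolding moebius_def Im_divide
    by (simp add: cmod_power2 automorphy_def algebra_simps diff_divide_distrib add_divide_distrib)
  then show ?thesis by (simp add: d)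
qed

lemma moebius_in_H: "det A = 1 \<Longrightarrow> z \<in> \<H> \<Longrightarrow> moebius A z \<in> \<H>"
  using automorphy_nonzero[of A z] by (simp add: upper_half_plane_iff Im_moebius)

lemma automorphy_mult:
  assumes "det B = 1" "z \<in> \<H>"
  shows "automorphy (A ** B) z = automorphy A (moebius B z) * automorphy B z"
proof -
  have m: "moebius B z * automorphy B z = of_real (B$1$1) * z + of_real (B$1$2)"
    using automorphy_nonzero[OF assms] by (simp add: moebius_def)
  show ?thesis
    unfolding automorphy_def[of A] distrib_right mult.assoc m
    by (simp add: automorphy_def matrix_mult_2 algebra_simps)
qed

lemma moebius_mult:
  assumes "det A = 1" "det B = 1" "z \<in> \<H>"
  shows "moebius (A ** B) z = moebius A (moebius B z)"
proof -
  have n: "automorphy B z \<noteq> 0" by (rule automorphy_nonzero[OF assms(2,3)])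
  have num: "of_real ((A ** B)$1$1) * z + of_real ((A ** B)$1$2) =
      (of_real (A$1$1) * moebius B z + of_real (A$1$2)) * automorphy B z"
  proof -
    have m: "moebius B z * automorphy B z = of_real (B$1$1) * z + of_real (B$1$2)"
      using n by (simp add: moebius_def)
    show ?thesis
      unfolding distrib_right mult.assoc m by (simp add: automorphy_def matrix_mult_2 algebra_simps)
  qed
  show ?thesis
    unfolding moebius_def[of "A ** B"] automorphy_mult[OF assms(2,3)] num moebius_def[of A "moebius B z"]
    using n by simp
qed

lemma moebius_mat_1 [simp]: "moebius (mat 1) z = z" "automorphy (mat 1) z = 1"
  by (simp_all add: moebius_def automorphy_def)

lemma moebius_diff:
  assumes "det A = 1" "z \<in> \<H>" "w \<in> \<H>"
  shows "moebius A z - moebius A w = (z - w) / (automorphy A z * automorphy A w)"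
proof -
  have d: "of_real (A$1$1) * of_real (A$2$2) - of_real (A$1$2) * of_real (A$2$1) = (1::complex)"
    using assms(1) unfolding det_2 by (metis of_real_1 of_real_diff of_real_mult)
  have n: "automorphy A z \<noteq> 0" "automorphy A w \<noteq> 0"
    using automorphy_nonzero assms by auto
  have m: "moebius A v * automorphy A v = of_real (A$1$1) * v + of_real (A$1$2)" if "automorphy A v \<noteq> 0" for v
    using that by (simp add: moebius_def)
  have "(moebius A z - moebius A w) * (automorphy A z * automorphy A w) =
     (moebius A z * automorphy A z) * automorphy A w - (moebius A w * automorphy A w) * automorphy A z"
    by (simp add: algebra_simps)
  also have "\<dots> = (of_real (A$1$1) * z + of_real (A$1$2)) * automorphy A w - (of_real (A$1$1) * w + of_real (A$1$2)) * automorphy A z"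
    unfolding m[OF n(1)] m[OF n(2)] ..
  also have "\<dots> = (of_real (A$1$1) * of_real (A$2$2) - of_real (A$1$2) * of_real (A$2$1)) * (z - w)"
    by (simp add: automorphy_def algebra_simps)
  also have "\<dots> = z - w" unfolding d by simp
  finally show ?thesis using n by (simp only: nonzero_eq_divide_eq mult_eq_0_iff de_Morgan_disj simp_thms)
qed

lemma sig_moebius:
  assumes "det A = 1" "z \<in> \<H>" "w \<in> \<H>"
  shows "sig (moebius A z) (moebius A w) = sig z w"
  using automorphy_nonzero[OF assms(1,2)] automorphy_nonzero[OF assms(1,3)]
  unfolding sig_def moebius_diff[OF assms] Im_moebius[OF assms(1,2)] Im_moebius[OF assms(1,3)]
  by (simp add: norm_divide norm_mult power_divide power_mult_distrib)

lemma sig_commute: "sig z w = sig w z"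
  by (simp add: sig_def norm_minus_commute mult.commute)

lemma sig_nonneg: "z \<in> \<H> \<Longrightarrow> w \<in> \<H> \<Longrightarrow> sig z w \<ge> 0"
  by (simp add: sig_def upper_half_plane_iff)

text \<open>
  The Frobenius norm of a matrix measures how far it moves \<open>\<i>\<close>. This converts discreteness of a group of
  matrices into proper discontinuity of its action.
\<close>

lemma sig_i_moebius_i:
  assumes "det A = 1"
  shows "sig \<i> (moebius A \<i>) + 2 = (norm A)\<^sup>2"
proof -
  have i: "\<i> \<in> \<H>" by (simp add: upper_half_plane_iff)
  define a b c d where "a = A$1$1" and "b = A$1$2" and "c = A$2$1" and "d = A$2$2"
  have D: "a * d - b * c = 1" using assms by (simp add: det_2 a_def b_def c_def d_def)
  have n: "automorphy A \<i> \<noteq> 0" by (rule automorphy_nonzero[OF assms i])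
  have nn: "(cmod (automorphy A \<i>))\<^sup>2 = c\<^sup>2 + d\<^sup>2"
    by (simp add: automorphy_def cmod_power2 c_def d_def)
  have "\<i> - moebius A \<i> = (\<i> * automorphy A \<i> - (of_real a * \<i> + of_real b)) / automorphy A \<i>"
    using n by (simp add: moebius_def a_def b_def diff_divide_distrib)
  also have "\<i> * automorphy A \<i> = of_real d * \<i> - of_real c"
    by (simp add: automorphy_def c_def d_def complex_eq_iff)
  also have "\<dots> - (of_real a * \<i> + of_real b) = Complex (- c - b) (d - a)"
    by (simp add: complex_eq_iff)
  finally have "(cmod (\<i> - moebius A \<i>))\<^sup>2 = (cmod (Complex (- c - b) (d - a)))\<^sup>2 / (c\<^sup>2 + d\<^sup>2)"
    by (simp add: norm_divide power_divide nn)
  then have "(cmod (\<i> - moebius A \<i>))\<^sup>2 = ((d - a)\<^sup>2 + (c + b)\<^sup>2) / (c\<^sup>2 + d\<^sup>2)"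
    unfolding cmod_power2 by (simp add: power2_eq_square algebra_simps)
  moreover have "Im (moebius A \<i>) = 1 / (c\<^sup>2 + d\<^sup>2)"
    unfolding Im_moebius[OF assms i] nn by simp
  moreover have "c\<^sup>2 + d\<^sup>2 \<noteq> 0" using n nn by (metis norm_eq_zero power2_eq_iff_nonneg zero_eq_power2)
  ultimately have "sig \<i> (moebius A \<i>) = (d - a)\<^sup>2 + (c + b)\<^sup>2"
    by (simp add: sig_def)
  then show ?thesis using D
    unfolding norm_mat_2 a_def[symmetric] b_def[symmetric] c_def[symmetric] d_def[symmetric]
    by (simp add: power2_eq_square algebra_simps)
qed

text \<open>The action on \<open>\<H>\<close> is transitive.\<close>

lemma moebius_transitive:
  assumes "z \<in> \<H>"
  obtains B where "det B = 1" "moebius B \<i> = z"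
proof
  define s where "s = sqrt (Im z)"
  have s: "s > 0" "s * s = Im z" using assms by (simp_all add: s_def upper_half_plane_iff)
  define B :: "real^2^2" where "B = (\<chi> i j. if i = 1 then (if j = 1 then s else Re z / s) else (if j = 1 then 0 else 1 / s))"
  show "det B = 1" using s by (simp add: det_2 B_def)
  have "of_real s * (of_real s * \<i> + of_real (Re z) / of_real s) = z" 
    using s by (simp add: complex_eq_iff)
  then show "moebius B \<i> = z"
    using s by (simp add: moebius_def automorphy_def B_def mult.commute)
qed

section \<open>Cocompact Fuchsian groups\<close>

text \<open>
  The group is taken as a set of matrices closed under sign change. Its two geometric properties are that
  every orbit meets a fixed hyperbolic disc, and that only finitely many elements move a point of a given disc into that disc.
\<close>

locale cocompact_fuchsian =
  fixes G :: "(real^2^2) set"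
  assumes det_G: "A \<in> G \<Longrightarrow> det A = 1"
    and one_G: "mat 1 \<in> G"
    and mult_G: "A \<in> G \<Longrightarrow> B \<in> G \<Longrightarrow> A ** B \<in> G"
    and inverse_G: "A \<in> G \<Longrightarrow> adjugate2 A \<in> G"
    and uminus_G: "A \<in> G \<Longrightarrow> - A \<in> G"
    and cocompact_G: "\<exists>M. \<forall>z\<in>\<H>. \<exists>A\<in>G. sig \<i> (moebius A z) \<le> M"
    and proper_G: "finite {A\<in>G. \<exists>z\<in>\<H>. sig \<i> z \<le> M \<and> sig \<i> (moebius A z) \<le> M}"

lemma SL2R_simps [simp]: "carrier SL2R = {A. det A = 1}" "x \<otimes>\<^bsub>SL2R\<^esub> y = x ** y" "\<one>\<^bsub>SL2R\<^esub> = mat 1"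
  by (simp_all add: SL2R_def)

lemma carrier_PSL2R: "carrier PSL2R = (\<lambda>A. {A, - A}) ` {A. det A = 1}"
proof -
  have "{mat 1, - mat 1} #>\<^bsub>SL2R\<^esub> A = {A, - A}" for A :: "real^2^2"
    by (simp add: r_coset_def matrix_mul_minus insert_commute)
  then show ?thesis
    by (auto simp: PSL2R_def FactGroup_def RCOSETS_def)
qed

lemma mult_PSL2R: "X \<otimes>\<^bsub>PSL2R\<^esub> Y = {A ** B | A B. A \<in> X \<and> B \<in> Y}"
  by (auto simp: PSL2R_def FactGroup_def set_mult_def)

lemma one_PSL2R: "\<one>\<^bsub>PSL2R\<^esub> = {mat 1, - mat 1}"
  by (auto simp: PSL2R_def FactGroup_def)

lemma PSL2R_class_eq: "X \<in> carrier PSL2R \<Longrightarrow> A \<in> X \<Longrightarrow> X = {A, - A}"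
  by (auto simp: carrier_PSL2R)

lemma disjoint_PSL2R: "disjoint (carrier PSL2R)"
  unfolding disjoint_def by (metis PSL2R_class_eq disjoint_iff)

lemma openin_PSL2R_topology:
  "openin PSL2R_topology U \<longleftrightarrow> U \<subseteq> carrier PSL2R \<and> openin (top_of_set {A. det A = 1}) (\<Union>U)"
  unfolding PSL2R_topology_def openin_partition_topology[OF disjoint_PSL2R] by simp

lemma det_uminus_2 [simp]: "det (- A) = det A" for A :: "real^2^2"
  by (simp add: det_2)

text \<open>
  The cosets that contain a matrix of norm less than \<open>n\<close> form an increasing open cover of the compact quotient as
  \<open>n\<close> grows, so one \<open>n\<close> suffices, and it bounds the disc that meets every orbit. Elements
  that move a point of a disc into the same disc have bounded norm, so they lie in a compact set, in which a discrete group has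
  finitely many members.
\<close>

lemma cocompact_fuchsian_Union:
  assumes "discrete_subgroup \<Gamma>" "cocompact_subgroup \<Gamma>"
  shows "cocompact_fuchsian (\<Union>\<Gamma>)"
proof -
  define G where "G = \<Union>\<Gamma>"
  have GI: "A \<in> G" if "X \<in> \<Gamma>" "A \<in> X" for A X unfolding G_def using that by blast
  have GE: "\<exists>X\<in>\<Gamma>. A \<in> X" if "A \<in> G" for A using that unfolding G_def by blast
  interpret P: group PSL2R by (rule group_PSL2R)
  have sg: "subgroup \<Gamma> PSL2R" using assms(1) by (simp add: discrete_subgroup_def)
  interpret subgroup \<Gamma> PSL2R by (rule sg)
  have \<Gamma>: "\<Gamma> \<subseteq> carrier PSL2R" by (rule subset)
  have cls: "X = {A, - A}" if "X \<in> \<Gamma>" "A \<in> X" for X A using that \<Gamma> PSL2R_class_eq by blast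
  have det: "det A = 1" if A: "A \<in> G" for A
  proof -
    obtain X where "X \<in> \<Gamma>" "A \<in> X" using GE[OF A] by blast
    then obtain B where "det B = 1" "A = B \<or> A = - B" using \<Gamma> unfolding carrier_PSL2R by blast
    then show ?thesis by auto
  qed
  have one: "mat 1 \<in> G" using one_closed unfolding one_PSL2R by (rule GI) simp
  have mult: "A ** B \<in> G" if A: "A \<in> G" and B: "B \<in> G" for A B
  proof -
    obtain X Y where XY: "X \<in> \<Gamma>" "Y \<in> \<Gamma>" "A \<in> X" "B \<in> Y" using GE[OF A] GE[OF B] by blast
    have "A ** B \<in> X \<otimes>\<^bsub>PSL2R\<^esub> Y" unfolding mult_PSL2R using XY(3,4) by blast
    with m_closed[OF XY(1,2)] show ?thesis by (rule GI)
  qed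
  have neg: "- A \<in> G" if "A \<in> G" for A
    using GE[OF that] cls GI by blast
  have inv: "adjugate2 A \<in> G" if A: "A \<in> G" for A
  proof -
    obtain X where X: "X \<in> \<Gamma>" "A \<in> X" using GE[OF A] by blast
    let ?Y = "inv\<^bsub>PSL2R\<^esub> X"
    have Y: "?Y \<in> \<Gamma>" by (rule m_inv_closed[OF X(1)])
    then have "?Y \<in> carrier PSL2R" using \<Gamma> by (rule subsetD[rotated])
    then obtain B where B: "B \<in> ?Y" unfolding carrier_PSL2R by blast
    have "B ** A \<in> ?Y \<otimes>\<^bsub>PSL2R\<^esub> X" unfolding mult_PSL2R using B X(2) by blast
    also have "?Y \<otimes>\<^bsub>PSL2R\<^esub> X = \<one>\<^bsub>PSL2R\<^esub>" by (rule P.l_inv[OF subsetD[OF \<Gamma> X(1)]])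
    finally have "B ** A = mat 1 \<or> B ** A = - mat 1" unfolding one_PSL2R by blast
    then have "(B ** A) ** adjugate2 A = adjugate2 A \<or> (B ** A) ** adjugate2 A = - adjugate2 A"
      by (auto simp: matrix_mul_minus)
    then have "B = adjugate2 A \<or> B = - adjugate2 A"
      using adjugate2_mult(2)[OF det[OF A]] by (simp add: matrix_mul_assoc[symmetric])
    moreover have "B \<in> G" using Y B by (rule GI)
    moreover have "- B \<in> G" by (rule neg) fact
    ultimately show ?thesis by (metis minus_minus)
  qed
  have cover: "\<exists>N. \<forall>B. det B = 1 \<longrightarrow> (\<exists>A\<in>G. norm (A ** B) < real N)"
  proof -
    let ?R = "rcosets\<^bsub>PSL2R\<^esub> \<Gamma>"
    have dR: "disjoint ?R"
      unfolding disjoint_def using P.rcos_disjoint[OF sg] by (auto simp: pairwise_def disjnt_def)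
    have R_sub: "\<Union>?R = carrier PSL2R" by (rule P.rcosets_part_G[OF sg])
    define V where "V n = {B. det B = 1 \<and> (\<exists>A\<in>G. norm (A ** B) < real n)}" for n :: nat
    define C where "C n = {X\<in>?R. \<Union>X \<inter> V n \<noteq> {}}" for n
    have UX: "B' \<in> V n" if XR: "X \<in> ?R" and BX: "B \<in> \<Union>X" and BV: "B \<in> V n" and BX': "B' \<in> \<Union>X" for X B B' n
    proof -
      obtain g where g: "g \<in> carrier PSL2R" "X = \<Gamma> #>\<^bsub>PSL2R\<^esub> g"
        using XR unfolding RCOSETS_def by blast
      obtain B0 where B0: "det B0 = 1" "g = {B0, - B0}" using g(1) unfolding carrier_PSL2R by blast
      have *: "\<exists>A\<in>G. C' = A ** B0" if C': "C' \<in> \<Union>X" for C'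
      proof -
        obtain h where h: "h \<in> \<Gamma>" "C' \<in> h \<otimes>\<^bsub>PSL2R\<^esub> g" using C' unfolding g(2) r_coset_def by blast
        then obtain A where A: "A \<in> h" "C' = A ** B0 \<or> C' = A ** (- B0)" unfolding mult_PSL2R B0 by blast
        have "A \<in> G" using h(1) A(1) by (rule GI)
        moreover have "A ** (- B0) = (- A) ** B0" by (simp add: matrix_mul_minus)
        ultimately show ?thesis using neg[of A] A(2) by metis
      qed
      obtain A1 where A1: "A1 \<in> G" "B = A1 ** B0" using *[OF BX] by blast
      obtain A2 where A2: "A2 \<in> G" "B' = A2 ** B0" using *[OF BX'] by blast
      obtain A where A: "A \<in> G" "norm (A ** B) < real n" using BV by (auto simp: V_def simp del: Union_iff)
      have "(A ** A1 ** adjugate2 A2) ** B' = A ** A1 ** (adjugate2 A2 ** A2) ** B0"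
        by (simp add: A2 matrix_mul_assoc)
      also have "\<dots> = A ** B" by (simp add: adjugate2_mult det A2 A1 matrix_mul_assoc)
      finally have "norm ((A ** A1 ** adjugate2 A2) ** B') < real n" using A by simp
      moreover have "A ** A1 ** adjugate2 A2 \<in> G" by (intro mult inv A A1 A2)
      moreover have "det B' = 1" by (simp add: A2 det_mul det B0)
      ultimately show ?thesis unfolding V_def by blast
    qed
    have UC: "\<Union>(\<Union>(C n)) = V n" for n
    proof (intro equalityI subsetI)
      fix B assume "B \<in> \<Union>(\<Union>(C n))"
      then show "B \<in> V n" using UX unfolding C_def by blast
    next
      fix B assume B: "B \<in> V n"
      then have "{B, - B} \<in> \<Union>?R" unfolding R_sub by (auto simp: V_def carrier_PSL2R)
      then obtain X where "X \<in> ?R" "{B, - B} \<in> X" by blast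
      then show "B \<in> \<Union>(\<Union>(C n))" using B unfolding C_def by blast
    qed
    have oV: "openin (top_of_set {A. det A = 1}) (V n)" for n
    proof -
      have "continuous_on UNIV (\<lambda>B. norm (A ** B))" for A :: "real^2^2"
        unfolding matrix_matrix_mult_def by (intro continuous_intros)
      then have "open {B. norm (A ** B) < real n}" for A :: "real^2^2"
        by (intro open_Collect_less) (auto intro: continuous_intros)
      then have "open (\<Union>A\<in>G. {B. norm (A ** B) < real n})" by blast
      moreover have "V n = {A. det A = 1} \<inter> (\<Union>A\<in>G. {B. norm (A ** B) < real n})"
        by (auto simp: V_def)
      ultimately show ?thesis by (auto simp: openin_open)
    qed
    have oC: "openin (partition_topology PSL2R_topology ?R) (C n)" for n
      unfolding openin_partition_topology[OF dR] openin_PSL2R_topology UC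
      using oV R_sub by (auto simp: C_def)
    have top: "?R \<subseteq> \<Union>(range C)"
    proof
      fix X assume X: "X \<in> ?R"
      then obtain g where g: "g \<in> carrier PSL2R" "X = \<Gamma> #>\<^bsub>PSL2R\<^esub> g"
        unfolding RCOSETS_def by blast
      have "g \<in> X" using P.rcos_self[OF g(1) sg] g(2) by simp
      moreover obtain B where "det B = 1" "B \<in> g" using g(1) unfolding carrier_PSL2R by blast
      moreover obtain n :: nat where "norm (mat 1 ** B) < real n" using reals_Archimedean2 by blast
      ultimately have "X \<in> C n" using X one unfolding C_def V_def by blast
      then show "X \<in> \<Union>(range C)" by blast
    qed
    have topR: "topspace (partition_topology PSL2R_topology ?R) \<subseteq> ?R"
      unfolding topspace_def using openin_partition_topology[OF dR] by blast
    have "compact_space (partition_topology PSL2R_topology ?R)"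
      using assms(2) by (simp add: cocompact_subgroup_def)
    then obtain \<F> where \<F>: "finite \<F>" "\<F> \<subseteq> range C" "topspace (partition_topology PSL2R_topology ?R) \<subseteq> \<Union>\<F>"
      using topR top oC unfolding compact_space_alt by (metis (no_types, lifting) imageE subset_trans)
    have "?R \<subseteq> topspace (partition_topology PSL2R_topology ?R)"
      using top oC openin_subset by blast
    then have "?R \<subseteq> \<Union>\<F>" using \<F>(3) by blast
    moreover obtain I where I: "finite I" "\<F> = C ` I" using finite_subset_image[OF \<F>(1,2)] by blast
    moreover have "C m \<subseteq> C n" if "m \<le> n" for m n
      using that unfolding C_def V_def by (fastforce intro: less_le_trans)
    ultimately have RC: "?R \<subseteq> C (Max (insert 0 I))"
      by (smt (verit) Max_ge UN_E finite_insert insertCI subset_eq)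
    have "\<exists>A\<in>G. norm (A ** B) < real (Max (insert 0 I))" if "det B = 1" for B
    proof -
      have "{B, - B} \<in> \<Union>?R" unfolding R_sub using that by (auto simp: carrier_PSL2R)
      then have "B \<in> \<Union>(\<Union>(C (Max (insert 0 I))))" using RC by blast
      then show ?thesis unfolding UC by (auto simp: V_def)
    qed
    then show ?thesis by blast
  qed
  have fin: "finite {A\<in>G. norm A \<le> r}" for r
  proof -
    have "openin (subtopology PSL2R_topology \<Gamma>) {\<one>\<^bsub>PSL2R\<^esub>}"
      using assms(1) one_closed by (simp add: discrete_subgroup_def)
    then obtain U where U: "openin PSL2R_topology U" "U \<inter> \<Gamma> = {\<one>\<^bsub>PSL2R\<^esub>}"
      by (auto simp: openin_subtopology)
    have m1: "mat 1 \<in> \<Union>U" using U(2) by (auto simp: one_PSL2R)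
    have oU: "openin (top_of_set {A. det A = 1}) (\<Union>U)" and Us: "U \<subseteq> carrier PSL2R"
      using U(1) by (simp_all add: openin_PSL2R_topology)
    have "\<exists>e>0. \<forall>B\<in>{A. det A = 1}. dist B (mat 1) < e \<longrightarrow> B \<in> \<Union>U"
      using oU m1 unfolding openin_euclidean_subtopology_iff by blast
    then obtain e where e: "e > 0" "\<And>B. det B = 1 \<Longrightarrow> dist B (mat 1) < e \<Longrightarrow> B \<in> \<Union>U"
      by blast
    have iso: "B = mat 1 \<or> B = - mat 1" if B: "B \<in> G" "dist B (mat 1) < e" for B
    proof -
      obtain X where X: "X \<in> \<Gamma>" "B \<in> X" using GE[OF B(1)] by blast
      obtain Y where Y: "Y \<in> U" "B \<in> Y" using e(2)[OF det[OF B(1)] B(2)] by (elim UnionE)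
      have "X = {B, - B}" using X by (rule cls)
      moreover have "Y = {B, - B}" by (rule PSL2R_class_eq[OF subsetD[OF Us Y(1)] Y(2)])
      ultimately have "X \<in> U \<inter> \<Gamma>" using X(1) Y(1) by simp
      then have "X = \<one>\<^bsub>PSL2R\<^esub>" unfolding U(2) by simp
      then show ?thesis using X(2) unfolding one_PSL2R by blast
    qed
    define S where "S = {A\<in>G. norm A \<le> r}"
    define d where "d = min 1 (e / (\<bar>r\<bar> + 1))"
    have d: "d > 0" using e by (simp add: d_def)
    have n1: "norm A \<ge> 1" if "det A = 1" for A :: "real^2^2"
    proof -
      have "2 * 1 \<le> (norm A)\<^sup>2"
        using that sum_squares_ge_zero[of "A$1$1 - A$2$2" "A$1$2 + A$2$1"]
        unfolding norm_mat_2 det_2 by (simp add: power2_eq_square algebra_simps)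
      then have "1\<^sup>2 \<le> (norm A)\<^sup>2" by simp
      then show ?thesis by (rule power2_le_imp_le) simp
    qed
    have "dist A B \<ge> d" if AB: "A \<in> S" "B \<in> S" "A \<noteq> B" for A B
    proof (rule ccontr)
      assume "\<not> dist A B \<ge> d"
      then have lt: "norm (B - A) < d" by (simp add: dist_norm norm_minus_commute)
      have AB': "A \<in> G" "B \<in> G" "norm A \<le> r" using AB by (auto simp: S_def)
      have "adjugate2 A ** B - mat 1 = adjugate2 A ** (B - A)"
        unfolding adjugate2_mult(1)[OF det[OF AB'(1)], symmetric]
        by (simp add: mat_eq_2_iff matrix_mult_2 algebra_simps)
      then have "norm (adjugate2 A ** B - mat 1) \<le> norm A * norm (B - A)"
        by (metis norm_adjugate2 norm_matrix_mult_2)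
      also have "\<dots> \<le> \<bar>r\<bar> * norm (B - A)" using AB' by (intro mult_right_mono) auto
      also have "\<dots> < (\<bar>r\<bar> + 1) * (e / (\<bar>r\<bar> + 1))" 
      proof (rule mult_strict_mono')
        show "norm (B - A) < e / (\<bar>r\<bar> + 1)" using lt by (simp add: d_def)
      qed auto
      also have "\<dots> = e" by simp
      finally have "dist (adjugate2 A ** B) (mat 1) < e" by (simp add: dist_norm)
      then have "adjugate2 A ** B = mat 1 \<or> adjugate2 A ** B = - mat 1"
        using iso mult inv AB' by blast
      then have "A ** (adjugate2 A ** B) = A \<or> A ** (adjugate2 A ** B) = - A"
        by (auto simp: matrix_mul_minus)
      then have "B = - A" using AB(3) adjugate2_mult(2)[OF det[OF AB'(1)]] by (auto simp: matrix_mul_assoc)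
      then have "B - A = (- 2) *\<^sub>R A" by (simp add: mat_eq_2_iff)
      then have "norm (B - A) = 2 * norm A" by simp
      then show False using lt n1[OF det[OF AB'(1)]] by (simp add: d_def)
    qed
    then have "uniform_discrete S"
      unfolding uniform_discrete_def using d by (metis not_le)
    moreover have "bounded S" unfolding S_def bounded_iff by blast
    ultimately have "finite S" using uniform_discrete_finite_iff by blast
    then show ?thesis by (simp add: S_def)
  qed
  show ?thesis
    unfolding G_def[symmetric]
  proof
    obtain N where N: "\<And>B. det B = 1 \<Longrightarrow> \<exists>A\<in>G. norm (A ** B) < real N" using cover by blast
    have "\<exists>A\<in>G. sig \<i> (moebius A z) \<le> (real N)\<^sup>2" if z: "z \<in> \<H>" for z
    proof -
      obtain B where B: "det B = 1" "moebius B \<i> = z" using moebius_transitive[OF z] .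
      obtain A where A: "A \<in> G" "norm (A ** B) < real N" using N[OF B(1)] by blast
      have "sig \<i> (moebius A z) + 2 = (norm (A ** B))\<^sup>2"
        using sig_i_moebius_i[of "A ** B"] det[OF A(1)] B
        by (simp add: det_mul moebius_mult upper_half_plane_iff)
      also have "\<dots> \<le> (real N)\<^sup>2" using A(2) by (intro power_mono) auto
      finally show ?thesis using A(1) by (intro bexI[of _ A]) simp_all
    qed
    then show "\<exists>M. \<forall>z\<in>\<H>. \<exists>A\<in>G. sig \<i> (moebius A z) \<le> M" by blast
  next
    fix M
    have "{A\<in>G. \<exists>z\<in>\<H>. sig \<i> z \<le> M \<and> sig \<i> (moebius A z) \<le> M} \<subseteq> {A\<in>G. norm A \<le> \<bar>M\<bar> + 2}"
    proof safe
      fix A z assume A: "A \<in> G" and z: "z \<in> \<H>" "sig \<i> z \<le> M" "sig \<i> (moebius A z) \<le> M"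
      have dA: "det A = 1" using A det by blast
      obtain B where B: "det B = 1" "moebius B \<i> = z" using moebius_transitive[OF z(1)] .
      have s: "norm C \<le> sqrt (\<bar>M\<bar> + 2)" if "det C = 1" "sig \<i> (moebius C \<i>) \<le> M" for C
        by (rule real_le_rsqrt) (use sig_i_moebius_i[OF that(1)] that(2) in simp)
      have "A = (A ** B) ** adjugate2 B" using adjugate2_mult(2)[OF B(1)] by (simp add: matrix_mul_assoc[symmetric])
      then have "norm A \<le> norm (A ** B) * norm B" by (metis norm_matrix_mult_2 norm_adjugate2)
      also have "\<dots> \<le> sqrt (\<bar>M\<bar> + 2) * sqrt (\<bar>M\<bar> + 2)"
        using z dA B by (intro mult_mono s) (auto simp: det_mul moebius_mult upper_half_plane_iff)
      finally show "norm A \<le> \<bar>M\<bar> + 2" by simp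
    qed
    then show "finite {A\<in>G. \<exists>z\<in>\<H>. sig \<i> z \<le> M \<and> sig \<i> (moebius A z) \<le> M}"
      using fin finite_subset by blast
  qed (use det one mult neg inv in auto)
qed

section \<open>The invariant measure\<close>

definition of_vec2 :: "real^2 \<Rightarrow> complex" where
  "of_vec2 x = Complex (x $ 1) (x $ 2)"

definition to_vec2 :: "complex \<Rightarrow> real^2" where
  "to_vec2 z = (\<chi> i. if i = 1 then Re z else Im z)"

lemma to_vec2_simps [simp]: "to_vec2 z $ 1 = Re z" "to_vec2 z $ 2 = Im z"
  "of_vec2 (to_vec2 z) = z" "to_vec2 (of_vec2 x) = x"
  "Re (of_vec2 x) = x $ 1" "Im (of_vec2 x) = x $ 2"
  by (simp_all add: to_vec2_def of_vec2_def vec_eq_iff forall_2)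

lemma bounded_linear_of_vec2: "bounded_linear of_vec2"
proof -
  have "linear of_vec2"
    by (rule linearI) (simp_all add: complex_eq_iff)
  then show ?thesis by (simp add: linear_conv_bounded_linear)
qed

lemma bounded_linear_to_vec2: "bounded_linear to_vec2"
proof -
  have "linear to_vec2"
    by (rule linearI) (simp_all add: vec_eq_iff forall_2)
  then show ?thesis by (simp add: linear_conv_bounded_linear)
qed

lemma continuous_of_vec2: "continuous_on S of_vec2"
  using bounded_linear_of_vec2 by (rule linear_continuous_on)

lemma measurable_of_vec2 [measurable]: "of_vec2 \<in> borel_measurable borel"
  by (intro borel_measurable_continuous_onI continuous_of_vec2)

lemma measurable_automorphy [measurable]: "automorphy A \<in> borel_measurable borel"
  unfolding automorphy_def by measurable

lemma measurable_moebius [measurable]: "moebius A \<in> borel_measurable borel"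
  unfolding moebius_def by measurable

definition hyp_weight :: "real^2 \<Rightarrow> real" where
  "hyp_weight x = (if x $ 2 > 0 then 1 / (x $ 2)\<^sup>2 else 0)"

lemma measurable_hyp_weight [measurable]: "hyp_weight \<in> borel_measurable borel"
  unfolding hyp_weight_def by measurable

lemma hyp_weight_nonneg [simp]: "hyp_weight x \<ge> 0"
  by (simp add: hyp_weight_def)

definition hyp_measure :: "complex measure" where
  "hyp_measure = distr (density lborel (\<lambda>x. ennreal (hyp_weight x))) borel of_vec2"

lemma sets_hyp_measure [simp, measurable_cong]: "sets hyp_measure = sets borel"
  by (simp add: hyp_measure_def)

lemma space_hyp_measure [simp]: "space hyp_measure = UNIV"
  by (simp add: hyp_measure_def)

lemma hyp_integral_eq:
  fixes f :: "complex \<Rightarrow> real"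
  assumes [measurable]: "f \<in> borel_measurable borel"
  shows "integrable hyp_measure f \<longleftrightarrow> integrable lborel (\<lambda>x. hyp_weight x * f (of_vec2 x))"
    and "integral\<^sup>L hyp_measure f = (LINT x|lborel. hyp_weight x * f (of_vec2 x))"
  unfolding hyp_measure_def
  by (simp_all add: integrable_distr_eq integral_distr integrable_density integral_density)

definition half_plane_vec2 :: "(real^2) set" where
  "half_plane_vec2 = {x. x $ 2 > 0}"

lemma half_plane_vec2_iff: "x \<in> half_plane_vec2 \<longleftrightarrow> of_vec2 x \<in> \<H>"
  by (simp add: half_plane_vec2_def upper_half_plane_iff)

lemma measurable_half_plane_vec2 [measurable]: "half_plane_vec2 \<in> sets borel"
proof -
  have "open half_plane_vec2" unfolding half_plane_vec2_def
    by (intro open_Collect_less continuous_intros)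
  then show ?thesis by simp
qed

lemma hyp_integral_eq_HK:
  fixes f :: "complex \<Rightarrow> real"
  assumes [measurable]: "f \<in> borel_measurable borel"
  defines "h \<equiv> (\<lambda>x. f (of_vec2 x) / (x $ 2)\<^sup>2)"
  shows "integrable hyp_measure f \<longleftrightarrow> h absolutely_integrable_on half_plane_vec2"
    and "integrable hyp_measure f \<Longrightarrow> integral\<^sup>L hyp_measure f = integral half_plane_vec2 h"
proof -
  have [measurable]: "h \<in> borel_measurable borel" unfolding h_def by measurable
  have eq: "(\<lambda>x. hyp_weight x * f (of_vec2 x)) = (\<lambda>x. indicator half_plane_vec2 x *\<^sub>R h x)"
    by (auto simp: fun_eq_iff hyp_weight_def h_def half_plane_vec2_def)
  have m: "(\<lambda>x. indicator half_plane_vec2 x *\<^sub>R h x) \<in> borel_measurable lborel"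
    by measurable
  show i: "integrable hyp_measure f \<longleftrightarrow> h absolutely_integrable_on half_plane_vec2"
    unfolding hyp_integral_eq[OF assms(1)] eq set_integrable_def
    using integrable_completion[OF m] by simp
  assume "integrable hyp_measure f"
  then have a: "h absolutely_integrable_on half_plane_vec2" using i by simp
  have "integral\<^sup>L hyp_measure f = (LINT x:half_plane_vec2|lebesgue. h x)"
    unfolding hyp_integral_eq[OF assms(1)] eq set_lebesgue_integral_def
    using integral_completion[OF m] by simp
  also have "\<dots> = integral half_plane_vec2 h"
    by (rule set_lebesgue_integral_eq_integral(2)[OF a])
  finally show "integral\<^sup>L hyp_measure f = integral half_plane_vec2 h" .
qed

lemma moebius_has_field_derivative:
  assumes "det A = 1" "z \<in> \<H>"
  shows "(moebius A has_field_derivative 1 / (automorphy A z)\<^sup>2) (at z)"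
proof -
  have n: "automorphy A z \<noteq> 0" by (rule automorphy_nonzero[OF assms])
  have d: "of_real (A$1$1) * of_real (A$2$2) - of_real (A$1$2) * of_real (A$2$1) = (1::complex)"
    using assms(1) unfolding det_2 by (metis of_real_1 of_real_diff of_real_mult)
  have "((\<lambda>z. (of_real (A$1$1) * z + of_real (A$1$2)) / (of_real (A$2$1) * z + of_real (A$2$2))) has_field_derivative
       (of_real (A$1$1) * (of_real (A$2$1) * z + of_real (A$2$2)) - (of_real (A$1$1) * z + of_real (A$1$2)) * of_real (A$2$1))
         / ((of_real (A$2$1) * z + of_real (A$2$2)) * (of_real (A$2$1) * z + of_real (A$2$2)))) (at z)"
    using n unfolding automorphy_def by (auto intro!: derivative_eq_intros)
  moreover have "of_real (A$1$1) * (of_real (A$2$1) * z + of_real (A$2$2)) - (of_real (A$1$1) * z + of_real (A$1$2)) * of_real (A$2$1) = (1::complex)"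
    using d by (simp add: algebra_simps)
  ultimately show ?thesis
    unfolding moebius_def[abs_def] automorphy_def[abs_def] power2_eq_square by simp
qed

lemma moebius_inverse:
  assumes "det A = 1" "z \<in> \<H>"
  shows "moebius (adjugate2 A) (moebius A z) = z" "moebius A (moebius (adjugate2 A) z) = z"
  using moebius_mult[of "adjugate2 A" A z] moebius_mult[of A "adjugate2 A" z] assms
  by (simp_all add: adjugate2_mult)

lemma det_matrix_complex_mult:
  "det (matrix (\<lambda>h. to_vec2 (m * of_vec2 h))) = (cmod m)\<^sup>2"
  unfolding det_2 matrix_def cmod_power2 by (simp add: axis_def power2_eq_square)

text \<open>
  The real Jacobian of a Moebius transformation is \<open>|c z + d|^-4\<close>, and the density \<open>(Im z)^-2\<close> changes by the
  inverse factor.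
\<close>

lemma hyp_measure_moebius_invariant:
  fixes f :: "complex \<Rightarrow> real"
  assumes f [measurable]: "f \<in> borel_measurable borel" and A: "det A = 1"
  shows "integrable hyp_measure (\<lambda>z. f (moebius A z)) \<longleftrightarrow> integrable hyp_measure f"
    and "(LINT z|hyp_measure. f (moebius A z)) = integral\<^sup>L hyp_measure f"
proof -
  let ?S = half_plane_vec2
  define g where "g x = to_vec2 (moebius A (of_vec2 x))" for x
  define g' where "g' x = (\<lambda>h. to_vec2 (1 / (automorphy A (of_vec2 x))\<^sup>2 * of_vec2 h))" for x
  let ?h = "\<lambda>x. f (of_vec2 x) / (x $ 2)\<^sup>2"
  let ?k = "\<lambda>x. f (moebius A (of_vec2 x)) / (x $ 2)\<^sup>2"
  have der: "(g has_derivative g' x) (at x within ?S)" if "x \<in> ?S" for x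
  proof -
    have "(moebius A has_derivative (\<lambda>h. 1 / (automorphy A (of_vec2 x))\<^sup>2 * h)) (at (of_vec2 x))"
      by (rule moebius_has_field_derivative[OF A, unfolded has_field_derivative_def])
         (use that in \<open>simp add: half_plane_vec2_iff\<close>)
    then have "((\<lambda>x. moebius A (of_vec2 x)) has_derivative (\<lambda>h. 1 / (automorphy A (of_vec2 x))\<^sup>2 * of_vec2 h)) (at x within ?S)"
      using bounded_linear.has_derivative[OF bounded_linear_of_vec2 has_derivative_ident]
      by (rule has_derivative_compose[rotated])
    then show ?thesis unfolding g_def g'_def
      by (rule bounded_linear.has_derivative[OF bounded_linear_to_vec2])
  qed
  have gS: "g x \<in> ?S" if "x \<in> ?S" for x
    using that moebius_in_H[OF A] by (simp add: half_plane_vec2_iff g_def)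
  have inj: "inj_on g ?S"
  proof (rule inj_onI)
    fix x y assume "x \<in> ?S" "y \<in> ?S" "g x = g y"
    then have "moebius (adjugate2 A) (moebius A (of_vec2 x)) = moebius (adjugate2 A) (moebius A (of_vec2 y))"
      unfolding g_def by (metis to_vec2_simps(3))
    then have "of_vec2 x = of_vec2 y"
      using moebius_inverse(1)[OF A] \<open>x \<in> ?S\<close> \<open>y \<in> ?S\<close> by (simp add: half_plane_vec2_iff)
    then show "x = y" by (metis to_vec2_simps(4))
  qed
  have surj: "g ` ?S = ?S"
  proof
    show "?S \<subseteq> g ` ?S"
    proof
      fix x assume x: "x \<in> ?S"
      let ?y = "to_vec2 (moebius (adjugate2 A) (of_vec2 x))"
      have "g ?y = x" unfolding g_def using moebius_inverse(2)[OF A] x by (simp add: half_plane_vec2_iff)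
      moreover have "?y \<in> ?S" using moebius_in_H[of "adjugate2 A"] A x by (simp add: half_plane_vec2_iff)
      ultimately show "x \<in> g ` ?S" by (metis imageI)
    qed
  qed (use gS in blast)
  have eq: "\<bar>det (matrix (g' x))\<bar> * ?h (g x) = ?k x" if x: "x \<in> ?S" for x
  proof -
    have n: "automorphy A (of_vec2 x) \<noteq> 0" using automorphy_nonzero[OF A] x by (simp add: half_plane_vec2_iff)
    have "g x $ 2 = x $ 2 / (cmod (automorphy A (of_vec2 x)))\<^sup>2"
      using Im_moebius[OF A] x by (simp add: g_def half_plane_vec2_iff)
    moreover have "\<bar>det (matrix (g' x))\<bar> = 1 / (cmod (automorphy A (of_vec2 x)))^4"
      unfolding g'_def det_matrix_complex_mult by (simp add: norm_divide norm_power power_divide power_mult[symmetric])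
    ultimately show ?thesis using n
      by (simp add: g_def power_divide power_mult[symmetric])
  qed
  have S: "?S \<in> sets lebesgue" by (simp add: measurable_half_plane_vec2)
  have cong: "(\<lambda>x. \<bar>det (matrix (g' x))\<bar> *\<^sub>R (vec (?h (g x)) :: real^1)) absolutely_integrable_on ?S
     \<longleftrightarrow> (\<lambda>x. vec (?k x) :: real^1) absolutely_integrable_on ?S"
    by (rule set_integrable_cong[OF refl refl]) (simp add: eq[symmetric] vec_eq_iff)
  have cong2: "integral ?S (\<lambda>x. \<bar>det (matrix (g' x))\<bar> *\<^sub>R (vec (?h (g x)) :: real^1))
     = integral ?S (\<lambda>x. vec (?k x) :: real^1)"
    by (rule integral_cong) (simp add: eq[symmetric] vec_eq_iff)
  have main: "?k absolutely_integrable_on ?S \<and> integral ?S ?k = b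
      \<longleftrightarrow> ?h absolutely_integrable_on ?S \<and> integral ?S ?h = b" for b
    using has_absolute_integral_change_of_variables[OF S der inj, of "\<lambda>x. vec (?h x) :: real^1" "vec b"]
    unfolding surj cong cong2
    by (simp add: absolutely_integrable_on_1_iff integral_on_1_eq)
  have m: "(\<lambda>z. f (moebius A z)) \<in> borel_measurable borel" by measurable
  show i: "integrable hyp_measure (\<lambda>z. f (moebius A z)) \<longleftrightarrow> integrable hyp_measure f"
    unfolding hyp_integral_eq_HK(1)[OF m] hyp_integral_eq_HK(1)[OF f] using main by blast
  show "(LINT z|hyp_measure. f (moebius A z)) = integral\<^sup>L hyp_measure f"
  proof (cases "integrable hyp_measure f")
    case True
    then have "?h absolutely_integrable_on ?S" unfolding hyp_integral_eq_HK(1)[OF f] .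
    then have "integral ?S ?k = integral ?S ?h" using main[of "integral ?S ?h"] by blast
    moreover have "integrable hyp_measure (\<lambda>z. f (moebius A z))" using True i by simp
    ultimately show ?thesis
      unfolding hyp_integral_eq_HK(2)[OF f True] by (simp only: hyp_integral_eq_HK(2)[OF m])
  next
    case False
    then show ?thesis using i by (simp add: not_integrable_integral_eq)
  qed
qed

lemma AE_hyp_measure: "AE z in hyp_measure. z \<in> \<H>"
proof -
  have "{z. z \<in> \<H>} \<in> sets borel"
    unfolding upper_half_plane_iff by measurable
  then show ?thesis unfolding hyp_measure_def
    by (subst AE_distr_iff) (auto simp: AE_density hyp_weight_def upper_half_plane_iff)
qed

definition hyp_disc :: "real \<Rightarrow> complex set" where
  "hyp_disc M = {z\<in>\<H>. sig \<i> z \<le> M}"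

lemma hyp_disc_bounds:
  assumes "z \<in> hyp_disc M"
  shows "Im z > 0" "Im z \<le> M + 2" "1 \<le> (M + 2) * Im z" "(cmod z)\<^sup>2 \<le> (M + 2) * (M + 2)"
proof -
  have z: "Im z > 0" "sig \<i> z \<le> M" using assms by (auto simp: hyp_disc_def upper_half_plane_iff)
  then have "(cmod (\<i> - z))\<^sup>2 \<le> M * Im z" by (simp add: sig_def divide_le_eq)
  then have *: "(cmod z)\<^sup>2 + 1 \<le> (M + 2) * Im z" unfolding cmod_power2 by (simp add: power2_eq_square algebra_simps)
  show "Im z > 0" by fact
  show **: "1 \<le> (M + 2) * Im z" using * zero_le_power2[of "cmod z"] by linarith
  have "Im z * Im z \<le> (cmod z)\<^sup>2" unfolding cmod_power2 by (simp add: power2_eq_square)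
  then have "Im z * Im z \<le> (M + 2) * Im z" using * by linarith
  then show ***: "Im z \<le> M + 2" using z(1) by simp
  have "(M + 2) * Im z \<le> (M + 2) * (M + 2)" using *** z(1) by (intro mult_left_mono) auto
  then show "(cmod z)\<^sup>2 \<le> (M + 2) * (M + 2)" using * by linarith
qed

lemma hyp_disc_subset: "hyp_disc M \<subseteq> \<H>"
  by (auto simp: hyp_disc_def)

lemma compact_hyp_disc: "compact (hyp_disc M)"
proof -
  have eq: "hyp_disc M = {z. (cmod (\<i> - z))\<^sup>2 \<le> M * Im z} \<inter> {z. 1 \<le> (M + 2) * Im z} \<inter> {z. 0 \<le> Im z}"
  proof (intro equalityI subsetI)
    fix z assume z: "z \<in> hyp_disc M"
    then show "z \<in> {z. (cmod (\<i> - z))\<^sup>2 \<le> M * Im z} \<inter> {z. 1 \<le> (M + 2) * Im z} \<inter> {z. 0 \<le> Im z}"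
      using hyp_disc_bounds[OF z] by (auto simp: hyp_disc_def sig_def divide_le_eq)
  next
    fix z assume z: "z \<in> {z. (cmod (\<i> - z))\<^sup>2 \<le> M * Im z} \<inter> {z. 1 \<le> (M + 2) * Im z} \<inter> {z. 0 \<le> Im z}"
    then have "Im z \<noteq> 0" by auto
    then have "Im z > 0" using z by auto
    then show "z \<in> hyp_disc M" using z by (auto simp: hyp_disc_def sig_def divide_le_eq upper_half_plane_iff)
  qed
  have "closed (hyp_disc M)"
    unfolding eq by (intro closed_Int closed_Collect_le continuous_intros)
  moreover have "bounded (hyp_disc M)"
  proof (rule boundedI)
    fix z assume z: "z \<in> hyp_disc M"
    have "M + 2 \<ge> 0" using hyp_disc_bounds[OF z] by linarith
    moreover have "(cmod z)\<^sup>2 \<le> (M + 2)\<^sup>2" using hyp_disc_bounds(4)[OF z] by (simp add: power2_eq_square)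
    ultimately show "cmod z \<le> M + 2" by (rule power2_le_imp_le[rotated])
  qed
  ultimately show ?thesis by (simp add: compact_eq_bounded_closed)
qed

lemma emeasure_hyp_disc: "emeasure hyp_measure (hyp_disc M) < \<infinity>"
proof -
  have [measurable]: "hyp_disc M \<in> sets borel" using compact_hyp_disc by (simp add: compact_imp_closed borel_closed)
  let ?B = "of_vec2 -` hyp_disc M"
  have B [measurable]: "?B \<in> sets borel" 
    using measurable_sets[OF measurable_of_vec2, of "hyp_disc M"] by simp
  have "emeasure hyp_measure (hyp_disc M) = (\<integral>\<^sup>+x. ennreal (hyp_weight x) * indicator ?B x \<partial>lborel)"
    unfolding hyp_measure_def by (simp add: emeasure_distr emeasure_density)
  also have "\<dots> \<le> (\<integral>\<^sup>+x. ennreal ((M + 2)\<^sup>2) * indicator ?B x \<partial>lborel)"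
  proof (rule nn_integral_mono)
    fix x
    show "ennreal (hyp_weight x) * indicator ?B x \<le> ennreal ((M + 2)\<^sup>2) * indicator ?B x"
    proof (cases "x \<in> ?B")
      case True
      then have z: "of_vec2 x \<in> hyp_disc M" by simp
      have "1 \<le> (M + 2) * x $ 2" "x $ 2 > 0" using hyp_disc_bounds[OF z] by simp_all
      then have "1 / x $ 2 \<le> M + 2" by (simp add: divide_le_eq)
      then have "(1 / x $ 2)\<^sup>2 \<le> (M + 2)\<^sup>2" using \<open>x $ 2 > 0\<close> by (intro power_mono) auto
      then show ?thesis using True by (simp add: hyp_weight_def power_divide ennreal_leI)
    qed simp
  qed
  also have "\<dots> = ennreal ((M + 2)\<^sup>2) * emeasure lborel ?B"
    by (simp add: nn_integral_cmult_indicator)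
  also have "emeasure lborel ?B < \<infinity>"
  proof (rule emeasure_bounded_finite)
    have "?B = to_vec2 ` hyp_disc M"
      by (force intro: image_eqI[of _ to_vec2 "of_vec2 _"])
    then show "bounded ?B"
      using bounded_linear_image[OF compact_imp_bounded[OF compact_hyp_disc] bounded_linear_to_vec2] by simp
  qed
  then have "ennreal ((M + 2)\<^sup>2) * emeasure lborel ?B < \<infinity>"
    by (simp add: ennreal_mult_less_top)
  finally show ?thesis .
qed

lemma hyp_measure_open_pos:
  assumes "open U" "U \<subseteq> \<H>" "U \<noteq> {}"
  shows "U \<notin> null_sets hyp_measure"
proof
  assume U: "U \<in> null_sets hyp_measure"
  have oB: "open (of_vec2 -` U)" using assms(1) continuous_of_vec2 by (intro open_vimage) auto
  have [measurable]: "U \<in> sets borel" "of_vec2 -` U \<in> sets borel" using assms(1) oB by auto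
  have "(\<integral>\<^sup>+x. ennreal (hyp_weight x) * indicator (of_vec2 -` U) x \<partial>lborel) = 0"
    using U unfolding hyp_measure_def by (simp add: null_sets_def emeasure_distr emeasure_density)
  then have "AE x in lborel. ennreal (hyp_weight x) * indicator (of_vec2 -` U) x = 0"
    by (subst (asm) nn_integral_0_iff_AE) auto
  note ae = this
  have pos: "hyp_weight x > 0" if "of_vec2 x \<in> U" for x
  proof -
    have "of_vec2 x \<in> \<H>" using that assms(2) by blast
    then show ?thesis by (simp add: hyp_weight_def upper_half_plane_iff)
  qed
  have *: "\<not> hyp_weight x \<le> 0" if "of_vec2 x \<in> U" for x using pos[OF that] by simp
  have "AE x in lborel. x \<notin> of_vec2 -` U"
    using ae
  proof (rule eventually_mono)
    fix x assume "ennreal (hyp_weight x) * indicator (of_vec2 -` U) x = 0"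
    then show "x \<notin> of_vec2 -` U" using *[of x] by (cases "x \<in> of_vec2 -` U") (auto simp: ennreal_eq_0_iff)
  qed
  then have "of_vec2 -` U \<in> null_sets lborel"
    by (simp add: AE_iff_null_sets)
  then have "negligible (of_vec2 -` U)"
    unfolding negligible_iff_null_sets by (rule null_sets_completionI)
  moreover obtain z where "z \<in> U" using assms(3) by blast
  then have "of_vec2 -` U \<noteq> {}" by (metis empty_iff to_vec2_simps(3) vimageI)
  ultimately show False using open_not_negligible[OF oB] by blast
qed

lemma hyp_integral_pos:
  fixes f :: "complex \<Rightarrow> real"
  assumes "integrable hyp_measure f" "\<And>z. f z \<ge> 0" "open U" "U \<subseteq> \<H>" "U \<noteq> {}" "\<And>z. z \<in> U \<Longrightarrow> f z > 0"
  shows "integral\<^sup>L hyp_measure f > 0"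
proof (rule ccontr)
  assume "\<not> integral\<^sup>L hyp_measure f > 0"
  moreover have "integral\<^sup>L hyp_measure f \<ge> 0" using assms(2) by (intro integral_nonneg_AE) auto
  ultimately have "integral\<^sup>L hyp_measure f = 0" by linarith
  then have "AE z in hyp_measure. f z = 0"
    using integral_nonneg_eq_0_iff_AE[OF assms(1)] assms(2) by auto
  then have "AE z in hyp_measure. z \<notin> U" by (elim AE_mp) (use assms(6) in \<open>fastforce intro!: AE_I2\<close>)
  then have "U \<in> null_sets hyp_measure"
    using assms(3) by (simp add: AE_iff_null_sets)
  then show False using hyp_measure_open_pos[OF assms(3-5)] by blast
qed

section \<open>Integration lemmas\<close>

lemma integrable_on_compact:
  fixes f :: "'a::{second_countable_topology, t2_space} \<Rightarrow> real"
  assumes [measurable_cong]: "sets M = sets borel" and K: "compact K" and fin: "emeasure M K < \<infinity>"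
    and f: "continuous_on K f"
  shows "set_integrable M K f"
proof -
  have Kb: "K \<in> sets borel" using K by (simp add: compact_imp_closed borel_closed)
  have [measurable]: "K \<in> sets M" using Kb assms(1) by simp
  have [measurable]: "(\<lambda>x. indicator K x *\<^sub>R f x) \<in> borel_measurable borel"
    by (rule borel_measurable_continuous_on_indicator[OF Kb f])
  have m: "(\<lambda>x. indicator K x *\<^sub>R f x) \<in> borel_measurable M" by measurable
  have "bounded (f ` K)" using compact_continuous_image[OF f K] by (rule compact_imp_bounded)
  then obtain B where B: "\<And>x. x \<in> K \<Longrightarrow> \<bar>f x\<bar> \<le> B" by (auto simp: bounded_iff)
  have i: "integrable M (\<lambda>x. indicator K x *\<^sub>R B)"
    using fin by (intro integrable_scaleR_left integrable_real_indicator) auto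
  have "norm (indicator K x *\<^sub>R f x) \<le> norm (indicator K x *\<^sub>R B)" for x
    using B[of x] by (cases "x \<in> K") auto
  then show ?thesis unfolding set_integrable_def
    by (intro Bochner_Integration.integrable_bound[OF i m] AE_I2)
qed

lemma Fubini_on_compact:
  fixes f :: "'a::{second_countable_topology, t2_space} \<Rightarrow> 'b::{second_countable_topology, t2_space} \<Rightarrow> real"
  assumes [measurable_cong]: "sets M = sets borel" "sets N = sets borel"
    and K: "compact K" "emeasure M K < \<infinity>" and L: "compact L" "emeasure N L < \<infinity>"
    and f: "continuous_on (K \<times> L) (\<lambda>(x, y). f x y)"
  shows "(LINT x:K|M. (LINT y:L|N. f x y)) = (LINT y:L|N. (LINT x:K|M. f x y))"
proof -
  have Kb [measurable]: "K \<in> sets borel" "L \<in> sets borel" using K L by (simp_all add: compact_imp_closed borel_closed)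
  define MK where "MK = density M (indicator K)"
  define NL where "NL = density N (indicator L)"
  have [measurable_cong]: "sets MK = sets borel" "sets NL = sets borel" 
    by (simp_all add: MK_def NL_def assms)
  have sp: "space M = UNIV" "space N = UNIV" using sets_eq_imp_space_eq[OF assms(1)] sets_eq_imp_space_eq[OF assms(2)] by simp_all
  interpret MK: finite_measure MK
    by standard (use K Kb assms sp in \<open>simp add: MK_def emeasure_density\<close>)
  interpret NL: finite_measure NL
    by standard (use L Kb assms sp in \<open>simp add: NL_def emeasure_density\<close>)
  interpret P: pair_sigma_finite MK NL ..
  interpret PP: finite_measure "MK \<Otimes>\<^sub>M NL"
    by (rule finite_measure_pair_measure) unfold_locales
  let ?g = "\<lambda>p. indicator (K \<times> L) p *\<^sub>R (case p of (x, y) \<Rightarrow> f x y)"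
  have "?g \<in> borel_measurable borel"
    by (rule borel_measurable_continuous_on_indicator[OF _ f])
       (use K L in \<open>simp add: compact_imp_closed borel_closed compact_Times\<close>)
  then have gm: "?g \<in> borel_measurable (MK \<Otimes>\<^sub>M NL)"
    by (subst measurable_cong_sets[of _ "borel \<Otimes>\<^sub>M borel" _ borel])
       (auto simp: borel_prod intro!: sets_pair_measure_cong \<open>sets MK = sets borel\<close> \<open>sets NL = sets borel\<close>)
  have "bounded ((\<lambda>(x, y). f x y) ` (K \<times> L))"
    using compact_continuous_image[OF f] K L by (intro compact_imp_bounded) (auto intro: compact_Times)
  then obtain B where B: "\<And>x y. x \<in> K \<Longrightarrow> y \<in> L \<Longrightarrow> \<bar>f x y\<bar> \<le> B" by (force simp: bounded_iff)
  have gi: "integrable (MK \<Otimes>\<^sub>M NL) ?g"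
  proof (rule PP.integrable_const_bound[OF _ gm])
    show "AE p in MK \<Otimes>\<^sub>M NL. norm (?g p) \<le> \<bar>B\<bar>"
      using B by (intro AE_I2) (force simp: indicator_def)
  qed
  define g where "g x y = indicator (K \<times> L) (x, y) *\<^sub>R f x y" for x y
  have g_eq: "?g = case_prod g" by (auto simp: g_def)
  have gi': "integrable (MK \<Otimes>\<^sub>M NL) (case_prod g)" using gi unfolding g_eq .
  have gm': "case_prod g \<in> borel_measurable (MK \<Otimes>\<^sub>M NL)" using gi' by auto
  have m1: "(\<lambda>y. g x y) \<in> borel_measurable N" for x
  proof -
    have "(\<lambda>y. g x y) \<in> borel_measurable NL" using measurable_compose[OF measurable_Pair1' gm', of x]
      by (simp add: MK_def sp)
    then show ?thesis using assms(2) \<open>sets NL = sets borel\<close> by (simp cong: measurable_cong_sets)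
  qed
  have m2: "(\<lambda>x. g x y) \<in> borel_measurable M" for y
  proof -
    have "(\<lambda>x. g x y) \<in> borel_measurable MK" using measurable_compose[OF measurable_Pair2' gm', of y]
      by (simp add: NL_def sp)
    then show ?thesis using assms(1) \<open>sets MK = sets borel\<close> by (simp cong: measurable_cong_sets)
  qed
  have m3: "(\<lambda>x. LINT y|NL. g x y) \<in> borel_measurable M"
    using NL.borel_measurable_lebesgue_integral[OF gm'] assms(1) \<open>sets MK = sets borel\<close> by (simp cong: measurable_cong_sets)
  have "(\<lambda>(y, x). g x y) \<in> borel_measurable (NL \<Otimes>\<^sub>M MK)"
    using measurable_pair_swap[OF gm'] by (simp only: case_prod_conv)
  then have "(\<lambda>y. LINT x|MK. g x y) \<in> borel_measurable NL"
    by (rule MK.borel_measurable_lebesgue_integral)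
  then have m4: "(\<lambda>y. LINT x|MK. g x y) \<in> borel_measurable N"
    using assms(2) \<open>sets NL = sets borel\<close> by (simp cong: measurable_cong_sets)
  have id1: "(LINT y|NL. h y) = (LINT y:L|N. h y)" if "h \<in> borel_measurable N" for h :: "'b \<Rightarrow> real"
  proof -
    have "NL = density N (\<lambda>y. ennreal (indicator L y))" by (simp add: NL_def ennreal_indicator)
    then show ?thesis using that assms(2) Kb by (simp add: integral_density set_lebesgue_integral_def)
  qed
  have id2: "(LINT y|MK. h y) = (LINT y:K|M. h y)" if "h \<in> borel_measurable M" for h :: "'a \<Rightarrow> real"
  proof -
    have "MK = density M (\<lambda>y. ennreal (indicator K y))" by (simp add: MK_def ennreal_indicator)
    then show ?thesis using that assms(1) Kb by (simp add: integral_density set_lebesgue_integral_def)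
  qed
  have "(LINT y|NL. (LINT x|MK. g x y)) = (LINT x|MK. (LINT y|NL. g x y))"
    by (rule P.Fubini_integral[OF gi'])
  moreover have "(LINT x|MK. (LINT y|NL. g x y)) = (LINT x:K|M. (LINT y:L|N. f x y))"
    unfolding id2[OF m3] unfolding id1[OF m1] set_lebesgue_integral_def
    by (intro Bochner_Integration.integral_cong) (auto simp: g_def indicator_def intro!: Bochner_Integration.integral_cong)
  moreover have "(LINT y|NL. (LINT x|MK. g x y)) = (LINT y:L|N. (LINT x:K|M. f x y))"
    unfolding id1[OF m4] unfolding id2[OF m2] set_lebesgue_integral_def
    by (intro Bochner_Integration.integral_cong) (auto simp: g_def indicator_def intro!: Bochner_Integration.integral_cong)
  ultimately show ?thesis by simp
qed

text \<open>
  The mean value property for harmonic functions given as real parts; the boundary circle is parametrised so that it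
  can be matched with the rotations of the upper half plane about \<open>\<i>\<close>.
\<close>

lemma mean_value_unit_disc:
  assumes G: "G holomorphic_on ball 0 1" and z: "z \<in> ball 0 1"
  shows "((\<lambda>t. Re (G (z * exp (2 * of_real pi * \<i> * of_real t)))) has_integral Re (G 0)) {0..1}"
proof -
  define g where "g s = G (z * s)" for s
  have n: "norm z < 1" using z by simp
  have "g holomorphic_on cball 0 1"
    unfolding g_def
  proof (rule holomorphic_on_compose_gen[of "\<lambda>s. z * s" "cball 0 1" G "ball 0 1", unfolded o_def, OF _ G])
    show "(\<lambda>s. z * s) ` cball 0 1 \<subseteq> ball 0 1"
    proof clarsimp
      fix s :: complex assume "norm s \<le> 1"
      then have "norm z * norm s \<le> norm z * 1" by (intro mult_left_mono) auto
      then show "norm (z * s) < 1" using n by (simp add: norm_mult)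
    qed
  qed (intro holomorphic_intros)
  then have "((\<lambda>u. g u / (u - 0)) has_contour_integral (2 * of_real pi * \<i> * g 0)) (circlepath 0 1)"
    by (intro Cauchy_integral_circlepath_simple) auto
  then have "((\<lambda>t. g (circlepath 0 1 t) / circlepath 0 1 t * vector_derivative (circlepath 0 1) (at t within {0..1})) has_integral (2 * of_real pi * \<i> * g 0)) {0..1}"
    by (simp add: has_contour_integral_def)
  moreover have "g (circlepath 0 1 t) / circlepath 0 1 t * vector_derivative (circlepath 0 1) (at t within {0..1})
      = (2 * of_real pi * \<i>) * g (exp (2 * of_real pi * \<i> * of_real t))" if "t \<in> {0..1}" for t
    using that by (subst vector_derivative_circlepath01) (auto simp: circlepath field_simps)
  ultimately have "((\<lambda>t. (2 * of_real pi * \<i>) * g (exp (2 * of_real pi * \<i> * of_real t))) has_integral (2 * of_real pi * \<i> * g 0)) {0..1}"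
    by (subst has_integral_cong[symmetric]) auto
  from has_integral_mult_right[OF this, of "1 / (2 * of_real pi * \<i>)"]
  have "((\<lambda>t. g (exp (2 * of_real pi * \<i> * of_real t))) has_integral g 0) {0..1}"
    by simp
  from has_integral_linear[OF this bounded_linear_Re] show ?thesis
    by (simp add: g_def o_def)
qed

section \<open>Hyperbolic averages of a potential\<close>

definition rotation2 :: "real \<Rightarrow> real^2^2" where
  "rotation2 \<theta> = (\<chi> i j. if i = 1 then (if j = 1 then cos \<theta> else sin \<theta>) else (if j = 1 then - sin \<theta> else cos \<theta>))"

lemma det_rotation2 [simp]: "det (rotation2 \<theta>) = 1"
  by (simp add: det_2 rotation2_def power2_eq_square[symmetric])

lemma i_in_H [simp]: "\<i> \<in> \<H>"
  by (simp add: upper_half_plane_iff)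

lemma moebius_rotation2: "moebius (rotation2 \<theta>) w = (of_real (cos \<theta>) * w + of_real (sin \<theta>)) / (of_real (cos \<theta>) - of_real (sin \<theta>) * w)"
  by (simp add: moebius_def automorphy_def rotation2_def)

lemma rotation2_denominator_nonzero: "w \<in> \<H> \<Longrightarrow> of_real (cos \<theta>) - of_real (sin \<theta>) * w \<noteq> 0"
  using automorphy_nonzero[OF det_rotation2[of \<theta>], of w] by (simp add: automorphy_def rotation2_def)

lemma moebius_rotation2_i [simp]: "moebius (rotation2 \<theta>) \<i> = \<i>"
  unfolding moebius_rotation2 using rotation2_denominator_nonzero[OF i_in_H, of \<theta>]
  by (simp add: divide_eq_eq algebra_simps)

definition inverse_cayley :: "complex \<Rightarrow> complex" where
  "inverse_cayley \<zeta> = \<i> * (1 + \<zeta>) / (1 - \<zeta>)"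

lemma moebius_rotation2_cayley:
  assumes "w \<in> \<H>"
  shows "moebius (rotation2 \<theta>) w = inverse_cayley ((w - \<i>) / (w + \<i>) * exp (2 * \<i> * of_real \<theta>))"
proof -
  define c s where "c = complex_of_real (cos \<theta>)" and "s = complex_of_real (sin \<theta>)"
  define E where "E = c + \<i> * s"
  have cs: "c * c + s * s = 1" unfolding c_def s_def
    by (metis of_real_1 of_real_add of_real_mult sin_cos_squared_add3)
  have E': "E * (c - \<i> * s) = 1" using cs by (simp add: E_def algebra_simps)
  then have E0: "E \<noteq> 0" by auto
  have "exp (2 * \<i> * of_real \<theta>) = (exp (\<i> * of_real \<theta>))\<^sup>2"
    by (simp add: exp_double[symmetric] mult.assoc)
  also have "exp (\<i> * of_real \<theta>) = E"
    by (simp add: E_def c_def s_def exp_Euler cos_of_real sin_of_real)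
  finally have ex: "exp (2 * \<i> * of_real \<theta>) = E * E" by (simp add: power2_eq_square)
  have n: "w + \<i> \<noteq> 0" using assms by (auto simp: upper_half_plane_iff complex_eq_iff)
  have d: "c - s * w \<noteq> 0" using rotation2_denominator_nonzero[OF assms, of \<theta>] by (simp add: c_def s_def)
  have 1: "(w + \<i>) + (w - \<i>) * (E * E) = E * (2 * (c * w + s))"
  proof -
    have "(w + \<i>) + (w - \<i>) * (E * E) = (w + \<i>) * (E * (c - \<i> * s)) + (w - \<i>) * (E * E)" by (simp add: E')
    also have "\<dots> = E * ((w + \<i>) * (c - \<i> * s) + (w - \<i>) * E)" by (simp add: algebra_simps)
    also have "(w + \<i>) * (c - \<i> * s) + (w - \<i>) * E = 2 * (c * w + s)" by (simp add: E_def algebra_simps)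
    finally show ?thesis .
  qed
  have 2: "(w + \<i>) - (w - \<i>) * (E * E) = E * (2 * \<i> * (c - s * w))"
  proof -
    have "(w + \<i>) - (w - \<i>) * (E * E) = (w + \<i>) * (E * (c - \<i> * s)) - (w - \<i>) * (E * E)" by (simp add: E')
    also have "\<dots> = E * ((w + \<i>) * (c - \<i> * s) - (w - \<i>) * E)" by (simp add: algebra_simps)
    also have "(w + \<i>) * (c - \<i> * s) - (w - \<i>) * E = 2 * \<i> * (c - s * w)" by (simp add: E_def algebra_simps)
    finally show ?thesis .
  qed
  have gen: "inverse_cayley (u / v * e) = \<i> * (v + u * e) / (v - u * e)" if "v \<noteq> 0" for u v e
  proof -
    have "1 + u / v * e = (v + u * e) / v" "1 - u / v * e = (v - u * e) / v" using that by (simp_all add: field_simps)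
    then show ?thesis using that unfolding inverse_cayley_def by simp
  qed
  have "inverse_cayley ((w - \<i>) / (w + \<i>) * (E * E)) =
      \<i> * ((w + \<i>) + (w - \<i>) * (E * E)) / ((w + \<i>) - (w - \<i>) * (E * E))"
    by (rule gen[OF n])
  also have "\<dots> = \<i> * (E * (2 * (c * w + s))) / (E * (2 * \<i> * (c - s * w)))"
    by (simp only: 1 2)
  also have "\<dots> = (c * w + s) / (c - s * w)"
  proof -
    have "\<i> * (E * (2 * (c * w + s))) = (E * (2 * \<i>)) * (c * w + s)" "E * (2 * \<i> * (c - s * w)) = (E * (2 * \<i>)) * (c - s * w)"
      by (simp_all only: mult_ac)
    moreover have "E * (2 * \<i>) \<noteq> 0" using E0 by simp
    ultimately show ?thesis by (metis mult_divide_mult_cancel_left)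
  qed
  finally show ?thesis unfolding ex moebius_rotation2 c_def s_def by simp
qed

lemma inverse_cayley_Im:
  assumes "norm \<zeta> < 1"
  shows "Im (inverse_cayley \<zeta>) = (1 - (cmod \<zeta>)\<^sup>2) / (cmod (1 - \<zeta>))\<^sup>2"
  unfolding inverse_cayley_def Im_divide cmod_power2
  by (simp add: power2_eq_square algebra_simps diff_divide_distrib add_divide_distrib)

lemma inverse_cayley_in_H:
  assumes "norm \<zeta> < 1"
  shows "inverse_cayley \<zeta> \<in> \<H>"
proof -
  have "1 - \<zeta> \<noteq> 0" using assms by auto
  moreover have "(cmod \<zeta>)\<^sup>2 < 1" using assms by (simp add: power_less_one_iff)
  ultimately show ?thesis unfolding upper_half_plane_iff inverse_cayley_Im[OF assms] by simp
qed

text \<open>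
  The Cayley transform turns the rotations about \<open>\<i>\<close> into rotations of a disc. There \<open>Re F\<close> has the mean value
  property, and \<open>ln Im\<close> is the sum of a radial function and a harmonic function. The radial part gives the drop \<open>ln (1 + sig \<i> w / 4)\<close>, which depends only
  on the distance.
\<close>

lemma rotation_mean:
  assumes F: "F holomorphic_on \<H>" and w: "w \<in> \<H>"
  shows "((\<lambda>t. Re (F (moebius (rotation2 (pi * t)) w)) + ln (Im (moebius (rotation2 (pi * t)) w))) has_integral
           (Re (F \<i>) - ln (1 + sig \<i> w / 4))) {0..1}"
proof -
  define G where "G \<zeta> = F (inverse_cayley \<zeta>) - 2 * Ln (1 - \<zeta>)" for \<zeta>
  define \<zeta>0 where "\<zeta>0 = (w - \<i>) / (w + \<i>)"
  have y: "Im w > 0" using w by (simp add: upper_half_plane_iff)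
  have n: "w + \<i> \<noteq> 0" using y by (auto simp: complex_eq_iff)
  have m: "(cmod (w + \<i>))\<^sup>2 = (cmod (w - \<i>))\<^sup>2 + 4 * Im w"
    unfolding cmod_power2 by (simp add: power2_eq_square algebra_simps)
  have one: "1 - (cmod \<zeta>0)\<^sup>2 = 4 * Im w / (cmod (w + \<i>))\<^sup>2"
  proof -
    have "(cmod (w + \<i>))\<^sup>2 \<noteq> 0" using n by simp
    then have "1 - (cmod \<zeta>0)\<^sup>2 = ((cmod (w + \<i>))\<^sup>2 - (cmod (w - \<i>))\<^sup>2) / (cmod (w + \<i>))\<^sup>2"
      unfolding \<zeta>0_def norm_divide power_divide by (simp add: diff_divide_distrib)
    then show ?thesis unfolding m by simp
  qed
  moreover have "4 * Im w / (cmod (w + \<i>))\<^sup>2 > 0" using y n by simp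
  ultimately have "(cmod \<zeta>0)\<^sup>2 < 1" by linarith
  then have \<zeta>0: "cmod \<zeta>0 < 1" by (simp add: power_less_one_iff)
  have sig: "1 + sig \<i> w / 4 = (cmod (w + \<i>))\<^sup>2 / (4 * Im w)"
    unfolding m sig_def norm_minus_commute[of \<i> w] using y by (simp add: field_simps)
  have lns: "ln (1 - (cmod \<zeta>0)\<^sup>2) = - ln (1 + sig \<i> w / 4)"
    unfolding one sig using y n by (simp add: ln_div)
  have "G holomorphic_on ball 0 1"
    unfolding G_def
  proof (intro holomorphic_intros)
    show "(\<lambda>\<zeta>. F (inverse_cayley \<zeta>)) holomorphic_on ball 0 1"
    proof (rule holomorphic_on_compose_gen[of inverse_cayley _ F \<H>, unfolded o_def, OF _ F])
      show "inverse_cayley holomorphic_on ball 0 1"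
        unfolding inverse_cayley_def by (intro holomorphic_intros) auto
      show "inverse_cayley ` ball 0 1 \<subseteq> \<H>" using inverse_cayley_in_H by auto
    qed
  next
    fix \<zeta> :: complex assume "\<zeta> \<in> ball 0 1"
    then have "Re \<zeta> < 1" using complex_Re_le_cmod[of \<zeta>] by simp
    then show "1 - \<zeta> \<notin> \<real>\<^sub>\<le>\<^sub>0" by (auto simp: complex_nonpos_Reals_iff)
  qed
  from mean_value_unit_disc[OF this, of \<zeta>0]
  have "((\<lambda>t. Re (G (\<zeta>0 * exp (2 * of_real pi * \<i> * of_real t)))) has_integral Re (F \<i>)) {0..1}"
    using \<zeta>0 by (simp add: G_def inverse_cayley_def)
  from has_integral_add[OF this has_integral_const_real[of "ln (1 - (cmod \<zeta>0)\<^sup>2)" 0 1]]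
  have *: "((\<lambda>t. Re (G (\<zeta>0 * exp (2 * of_real pi * \<i> * of_real t))) + ln (1 - (cmod \<zeta>0)\<^sup>2)) has_integral
      (Re (F \<i>) - ln (1 + sig \<i> w / 4))) {0..1}"
    by (simp add: lns)
  have eq: "Re (F (moebius (rotation2 (pi * t)) w)) + ln (Im (moebius (rotation2 (pi * t)) w))
      = Re (G (\<zeta>0 * exp (2 * of_real pi * \<i> * of_real t))) + ln (1 - (cmod \<zeta>0)\<^sup>2)" for t
  proof -
    define \<zeta> where "\<zeta> = \<zeta>0 * exp (2 * of_real pi * \<i> * of_real t)"
    have nz: "norm \<zeta> = norm \<zeta>0" by (simp add: \<zeta>_def norm_mult)
    then have lt: "norm \<zeta> < 1" using \<zeta>0 by simp
    have n1: "1 - \<zeta> \<noteq> 0" using lt by auto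
    have mob: "moebius (rotation2 (pi * t)) w = inverse_cayley \<zeta>"
      using moebius_rotation2_cayley[OF w, of "pi * t"] by (simp add: \<zeta>_def \<zeta>0_def mult_ac)
    have "ln (Im (inverse_cayley \<zeta>)) = ln (1 - (cmod \<zeta>0)\<^sup>2) - 2 * ln (cmod (1 - \<zeta>))"
      unfolding inverse_cayley_Im[OF lt] nz using n1 \<open>(cmod \<zeta>0)\<^sup>2 < 1\<close>
      by (simp add: ln_div ln_realpow)
    moreover have "Re (Ln (1 - \<zeta>)) = ln (cmod (1 - \<zeta>))" using n1 by simp
    ultimately show ?thesis unfolding mob \<zeta>_def[symmetric] by (simp add: G_def)
  qed
  show ?thesis by (rule has_integral_eq[OF _ *]) (rule eq[symmetric])
qed

text \<open>
  A continuous averaging kernel that depends only on the hyperbolic distance and is supported in a disc of fixed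
  radius.
\<close>

definition hyp_kernel :: "complex \<Rightarrow> complex \<Rightarrow> real" where
  "hyp_kernel z w = (if w \<in> \<H> then max 0 (1 - sig z w) else 0)"

lemma hyp_kernel_moebius:
  assumes "det A = 1" "z \<in> \<H>" "w \<in> \<H>"
  shows "hyp_kernel (moebius A z) (moebius A w) = hyp_kernel z w"
  using assms by (simp add: hyp_kernel_def sig_moebius moebius_in_H)

lemma hyp_kernel_commute: "z \<in> \<H> \<Longrightarrow> w \<in> \<H> \<Longrightarrow> hyp_kernel z w = hyp_kernel w z"
  by (simp add: hyp_kernel_def sig_commute)

lemma open_H: "open \<H>"
  unfolding upper_half_plane_def by (simp add: open_halfspace_Im_gt)

lemma measurable_on_H:
  fixes f :: "complex \<Rightarrow> real"
  assumes "continuous_on \<H> f" "\<And>z. z \<notin> \<H> \<Longrightarrow> f z = 0"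
  shows "f \<in> borel_measurable borel"
proof -
  have "(\<lambda>z. indicator \<H> z *\<^sub>R f z) \<in> borel_measurable borel"
    using open_H assms(1) by (intro borel_measurable_continuous_on_indicator) auto
  also have "(\<lambda>z. indicator \<H> z *\<^sub>R f z) = f" using assms(2) by (auto simp: indicator_def fun_eq_iff)
  finally show ?thesis .
qed

lemma continuous_on_sig:
  assumes "continuous_on S f" "continuous_on S g" "\<And>x. x \<in> S \<Longrightarrow> f x \<in> \<H>" "\<And>x. x \<in> S \<Longrightarrow> g x \<in> \<H>"
  shows "continuous_on S (\<lambda>x. sig (f x) (g x))"
  unfolding sig_def using assms by (intro continuous_intros) (force simp: upper_half_plane_iff)+

lemma continuous_on_hyp_kernel:
  assumes "continuous_on S f" "continuous_on S g" "\<And>x. x \<in> S \<Longrightarrow> f x \<in> \<H>" "\<And>x. x \<in> S \<Longrightarrow> g x \<in> \<H>"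
  shows "continuous_on S (\<lambda>x. hyp_kernel (f x) (g x))"
proof -
  have "continuous_on S (\<lambda>x. max 0 (1 - sig (f x) (g x)))"
    by (intro continuous_intros continuous_on_sig assms)
  then show ?thesis by (rule continuous_on_cong[THEN iffD1, rotated -1]) (use assms(4) in \<open>auto simp: hyp_kernel_def\<close>)
qed

lemma continuous_on_moebius:
  assumes "det A = 1" "continuous_on S f" "\<And>x. x \<in> S \<Longrightarrow> f x \<in> \<H>"
  shows "continuous_on S (\<lambda>x. moebius A (f x))"
  unfolding moebius_def using assms automorphy_nonzero[OF assms(1)]
  by (intro continuous_intros) (auto simp: automorphy_def intro!: continuous_intros)

text \<open>
  The amount by which averaging with the kernel lowers a function \<open>Re F + ln Im\<close>.
\<close>

definition hyp_kernel_defect :: real where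
  "hyp_kernel_defect = (LINT w:hyp_disc 1|hyp_measure. hyp_kernel \<i> w * ln (1 + sig \<i> w / 4))"

lemma sig_pos: "z \<in> \<H> \<Longrightarrow> w \<in> \<H> \<Longrightarrow> z \<noteq> w \<Longrightarrow> sig z w > 0"
  by (simp add: sig_def upper_half_plane_iff)

lemma set_integrable_hyp_disc:
  fixes f :: "complex \<Rightarrow> real"
  shows "continuous_on (hyp_disc M) f \<Longrightarrow> set_integrable hyp_measure (hyp_disc M) f"
  by (rule integrable_on_compact[OF sets_hyp_measure compact_hyp_disc emeasure_hyp_disc])

lemma open_hyp_ball: "open {z\<in>\<H>. sig \<i> z < M}"
proof -
  have "open (\<H> \<inter> sig \<i> -` {..<M})"
    by (intro continuous_open_preimage[OF _ open_H] continuous_on_sig) (auto intro: continuous_intros)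
  moreover have "\<H> \<inter> sig \<i> -` {..<M} = {z\<in>\<H>. sig \<i> z < M}" by auto
  ultimately show ?thesis by simp
qed

lemma hyp_kernel_defect_pos: "hyp_kernel_defect > 0"
proof -
  let ?g = "\<lambda>w. indicator (hyp_disc 1) w *\<^sub>R (hyp_kernel \<i> w * ln (1 + sig \<i> w / 4))"
  define U where "U = {z\<in>\<H>. sig \<i> z < 1} - {\<i>}"
  have U: "w \<in> U \<longleftrightarrow> w \<in> \<H> \<and> sig \<i> w < 1 \<and> w \<noteq> \<i>" for w by (auto simp: U_def)
  have nonneg: "sig \<i> w \<ge> 0" if "w \<in> hyp_disc 1" for w
    using that sig_nonneg[OF i_in_H] hyp_disc_subset by blast
  show ?thesis unfolding hyp_kernel_defect_def set_lebesgue_integral_def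
  proof (rule hyp_integral_pos[of _ U])
    have "continuous_on (hyp_disc 1) (\<lambda>w. sig \<i> w)"
      by (rule continuous_on_sig) (use hyp_disc_subset in auto)
    then have "continuous_on (hyp_disc 1) (\<lambda>w. hyp_kernel \<i> w * ln (1 + sig \<i> w / 4))"
      using hyp_disc_subset nonneg
      by (intro continuous_intros continuous_on_hyp_kernel) (auto, force)
    from set_integrable_hyp_disc[OF this] show "integrable hyp_measure ?g"
      by (simp add: set_integrable_def)
    show "?g w \<ge> 0" for w
      using nonneg[of w] by (auto simp: indicator_def hyp_kernel_def)
    show "open U" unfolding U_def by (intro open_Diff open_hyp_ball) auto
    show "U \<subseteq> \<H>" using U by blast
    have "sig \<i> (\<i> + \<i> / 4) < 1" by (simp add: sig_def norm_mult norm_divide power_divide)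
    moreover have "\<i> + \<i> / 4 \<noteq> \<i>" by simp
    moreover have "\<i> + \<i> / 4 \<in> \<H>" by (simp add: upper_half_plane_iff)
    ultimately have "\<i> + \<i> / 4 \<in> U" using U by blast
    then show "U \<noteq> {}" by blast
    show "?g w > 0" if "w \<in> U" for w
      using that sig_pos[OF i_in_H, of w] unfolding U by (auto simp: hyp_disc_def hyp_kernel_def)
  qed
qed
lemma borel_measurable_hyp_measure: "borel_measurable hyp_measure = borel_measurable borel"
  by (rule measurable_cong_sets) simp_all

text \<open>
  The kernel and the measure are invariant under the rotations about \<open>\<i>\<close>, so \<open>v\<close> may be replaced by its average over
  all rotations, which \<open>rotation_mean\<close> evaluates.
\<close>

lemma hyp_kernel_mean_i:
  assumes F: "F holomorphic_on \<H>"
  defines "v \<equiv> \<lambda>w. Re (F w) + ln (Im w)"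
  shows "(LINT w:hyp_disc 1|hyp_measure. hyp_kernel \<i> w * (v w - v \<i>)) = - hyp_kernel_defect"
proof -
  let ?D = "hyp_disc 1"
  have H: "w \<in> \<H>" if "w \<in> ?D" for w using that hyp_disc_subset by blast
  have D: "?D \<in> sets borel" using compact_hyp_disc by (simp add: compact_imp_closed borel_closed)
  have cF: "continuous_on \<H> F" using F by (rule holomorphic_on_imp_continuous_on)
  have cv: "continuous_on S (\<lambda>x. v (f x))" if "continuous_on S f" "\<And>x. x \<in> S \<Longrightarrow> f x \<in> \<H>" for S :: "'c::topological_space set" and f
    unfolding v_def using that
    by (intro continuous_intros continuous_on_compose2[OF cF]) (fastforce simp: upper_half_plane_iff)+
  have ck: "continuous_on ?D (hyp_kernel \<i>)"
    by (rule continuous_on_hyp_kernel) (use H in auto)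
  define J where "J = (LINT w:?D|hyp_measure. hyp_kernel \<i> w * v w)"
  have inv: "(LINT w:?D|hyp_measure. hyp_kernel \<i> w * v (moebius (rotation2 \<theta>) w)) = J" for \<theta>
  proof -
    let ?R = "rotation2 \<theta>"
    let ?h = "\<lambda>w. indicator ?D w *\<^sub>R (hyp_kernel \<i> w * v w)"
    have h: "?h \<in> borel_measurable borel"
      by (intro borel_measurable_continuous_on_indicator D continuous_intros ck cv H) auto
    have eq: "AE w in hyp_measure. ?h (moebius ?R w) = indicator ?D w *\<^sub>R (hyp_kernel \<i> w * v (moebius ?R w))"
    proof (rule AE_mp[OF AE_hyp_measure], rule AE_I2, rule impI)
      fix w assume w: "w \<in> \<H>"
      have "moebius ?R w \<in> ?D \<longleftrightarrow> w \<in> ?D"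
        using sig_moebius[OF det_rotation2[of \<theta>] i_in_H w] moebius_in_H[OF det_rotation2[of \<theta>] w] w
        by (simp add: hyp_disc_def)
      moreover have "hyp_kernel \<i> (moebius ?R w) = hyp_kernel \<i> w"
        using hyp_kernel_moebius[OF det_rotation2[of \<theta>] i_in_H w] by simp
      ultimately show "?h (moebius ?R w) = indicator ?D w *\<^sub>R (hyp_kernel \<i> w * v (moebius ?R w))"
        by (simp add: indicator_def)
    qed
    have m1: "(\<lambda>w. ?h (moebius ?R w)) \<in> borel_measurable hyp_measure"
      using measurable_compose[OF measurable_moebius h] by simp
    have "continuous_on ?D (\<lambda>w. hyp_kernel \<i> w * v (moebius ?R w))"
      by (intro continuous_intros ck cv continuous_on_moebius det_rotation2 H moebius_in_H)
    then have m2: "(\<lambda>w. indicator ?D w *\<^sub>R (hyp_kernel \<i> w * v (moebius ?R w))) \<in> borel_measurable hyp_measure"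
      unfolding borel_measurable_hyp_measure by (rule borel_measurable_continuous_on_indicator[OF D])
    have "(LINT w|hyp_measure. ?h (moebius ?R w)) = integral\<^sup>L hyp_measure ?h"
      by (rule hyp_measure_moebius_invariant(2)[OF h det_rotation2])
    moreover have "(LINT w|hyp_measure. ?h (moebius ?R w)) = (LINT w:?D|hyp_measure. hyp_kernel \<i> w * v (moebius ?R w))"
      unfolding set_lebesgue_integral_def by (rule integral_cong_AE[OF m1 m2 eq])
    ultimately show ?thesis by (simp add: J_def set_lebesgue_integral_def)
  qed
  have rot: "moebius (rotation2 (pi * t)) w \<in> \<H>" if "w \<in> ?D" for t w
    using moebius_in_H[OF det_rotation2 H[OF that]] .
  have crot: "continuous_on ({0..1} \<times> ?D) (\<lambda>p. moebius (rotation2 (pi * fst p)) (snd p))"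
    unfolding moebius_rotation2
    by (intro continuous_intros) (use rotation2_denominator_nonzero H in auto)
  have "J = (LINT t:{0..1::real}|lborel. J)"
    by (simp add: set_lebesgue_integral_def)
  also have "\<dots> = (LINT t:{0..1::real}|lborel. LINT w:?D|hyp_measure. hyp_kernel \<i> w * v (moebius (rotation2 (pi * t)) w))"
    by (simp add: inv)
  also have "\<dots> = (LINT w:?D|hyp_measure. LINT t:{0..1}|lborel. hyp_kernel \<i> w * v (moebius (rotation2 (pi * t)) w))"
  proof (rule Fubini_on_compact)
    have "continuous_on ({0..1} \<times> ?D) (\<lambda>p. hyp_kernel \<i> (snd p) * v (moebius (rotation2 (pi * fst p)) (snd p)))"
      by (intro continuous_intros continuous_on_hyp_kernel cv crot) (use H rot in auto)
    then show "continuous_on ({0..1} \<times> ?D) (\<lambda>(t, w). hyp_kernel \<i> w * v (moebius (rotation2 (pi * t)) w))"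
      by (simp add: case_prod_unfold)
  qed (use compact_hyp_disc emeasure_hyp_disc in auto)
  also have "\<dots> = (LINT w:?D|hyp_measure. hyp_kernel \<i> w * (Re (F \<i>) - ln (1 + sig \<i> w / 4)))"
  proof (rule set_lebesgue_integral_cong)
    show "\<forall>w. w \<in> ?D \<longrightarrow> (LINT t:{0..1}|lborel. hyp_kernel \<i> w * v (moebius (rotation2 (pi * t)) w)) =
        hyp_kernel \<i> w * (Re (F \<i>) - ln (1 + sig \<i> w / 4))"
    proof (intro allI impI)
      fix w assume w: "w \<in> ?D"
      have c: "continuous_on {0..1} (\<lambda>t. v (moebius (rotation2 (pi * t)) w))"
      proof (rule cv)
        show "continuous_on {0..1} (\<lambda>t. moebius (rotation2 (pi * t)) w)"
          unfolding moebius_rotation2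
          by (intro continuous_intros) (use rotation2_denominator_nonzero[OF H[OF w]] in auto)
      qed (use rot[OF w] in auto)
      have "set_integrable lborel {0..1} (\<lambda>t. v (moebius (rotation2 (pi * t)) w))"
        using c by (rule borel_integrable_atLeastAtMost')
      then have "(LINT t:{0..1}|lborel. v (moebius (rotation2 (pi * t)) w)) = integral {0..1} (\<lambda>t. v (moebius (rotation2 (pi * t)) w))"
        by (rule set_borel_integral_eq_integral(2))
      also have "\<dots> = Re (F \<i>) - ln (1 + sig \<i> w / 4)"
        unfolding v_def using rotation_mean[OF F H[OF w]] by (rule integral_unique)
      finally show "(LINT t:{0..1}|lborel. hyp_kernel \<i> w * v (moebius (rotation2 (pi * t)) w)) =
        hyp_kernel \<i> w * (Re (F \<i>) - ln (1 + sig \<i> w / 4))"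
        by simp
    qed
  qed (use D in simp)
  finally have J: "J = (LINT w:?D|hyp_measure. hyp_kernel \<i> w * (v \<i> - ln (1 + sig \<i> w / 4)))"
    by (simp add: v_def)
  have nonneg: "sig \<i> w \<ge> 0" if "w \<in> ?D" for w
    using that sig_nonneg[OF i_in_H] H by blast
  have csig: "continuous_on ?D (\<lambda>w. ln (1 + sig \<i> w / 4))"
    by (intro continuous_intros continuous_on_sig) (use H nonneg in \<open>auto, force\<close>)
  have i1: "set_integrable hyp_measure ?D (\<lambda>w. hyp_kernel \<i> w * v w)"
    and i2: "set_integrable hyp_measure ?D (\<lambda>w. hyp_kernel \<i> w * v \<i>)"
    and i3: "set_integrable hyp_measure ?D (\<lambda>w. hyp_kernel \<i> w * ln (1 + sig \<i> w / 4))"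
    by (intro set_integrable_hyp_disc continuous_intros ck cv csig H; simp)+
  have "(LINT w:?D|hyp_measure. hyp_kernel \<i> w * (v w - v \<i>)) = J - (LINT w:?D|hyp_measure. hyp_kernel \<i> w * v \<i>)"
    unfolding right_diff_distrib J_def by (rule set_integral_diff(2)[OF i1 i2])
  also have "J = (LINT w:?D|hyp_measure. hyp_kernel \<i> w * v \<i>) - hyp_kernel_defect"
    unfolding J right_diff_distrib hyp_kernel_defect_def by (rule set_integral_diff(2)[OF i2 i3])
  finally show ?thesis by simp
qed

text \<open>
  An affine map moves \<open>\<i>\<close> to \<open>z\<close> and turns \<open>ln Im\<close> into \<open>ln Im\<close> plus a constant, so the general case reduces to the
  centre \<open>\<i>\<close>.
\<close>

lemma hyp_kernel_mean:
  assumes F: "F holomorphic_on \<H>" and z: "z \<in> \<H>" and u: "\<And>w. w \<in> \<H> \<Longrightarrow> u w = Re (F w) + ln (Im w)"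
  shows "(LINT w|hyp_measure. hyp_kernel z w * (u w - u z)) = - hyp_kernel_defect"
proof -
  \<comment> \<open>the matrix of the affine map \<open>w \<mapsto> Im z * w + Re z\<close>, which takes \<open>\<i>\<close> to \<open>z\<close>\<close>
  define B :: "real^2^2" where "B = (\<chi> i j. if i = 1 then (if j = 1 then sqrt (Im z) else Re z / sqrt (Im z)) else (if j = 1 then 0 else 1 / sqrt (Im z)))"
  have y: "Im z > 0" using z by (simp add: upper_half_plane_iff)
  have B: "det B = 1" using y by (simp add: det_2 B_def)
  have Bw: "moebius B w = of_real (Im z) * w + of_real (Re z)" for w
    using y unfolding moebius_def automorphy_def
    by (simp add: B_def field_simps of_real_mult[symmetric] del: of_real_mult)
  have Bi: "moebius B \<i> = z" unfolding Bw by (simp add: complex_eq_iff)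
  let ?h = "\<lambda>w. hyp_kernel z w * (u w - u z)"
  have cF: "continuous_on \<H> F" using F by (rule holomorphic_on_imp_continuous_on)
  have cu: "continuous_on \<H> u"
  proof (rule continuous_on_cong[THEN iffD2])
    show "continuous_on \<H> (\<lambda>w. Re (F w) + ln (Im w))"
      by (intro continuous_intros cF) (auto simp: upper_half_plane_iff)
  qed (use u in auto)
  have h: "?h \<in> borel_measurable borel"
  proof (rule measurable_on_H)
    show "continuous_on \<H> ?h"
      by (intro continuous_intros cu continuous_on_hyp_kernel) (use z in auto)
  qed (simp add: hyp_kernel_def)
  define F' where "F' w = F (moebius B w)" for w
  have F': "F' holomorphic_on \<H>"
    unfolding F'_def
  proof (rule holomorphic_on_compose_gen[of "moebius B" _ F \<H>, unfolded o_def, OF _ F])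
    show "moebius B holomorphic_on \<H>" unfolding Bw[abs_def] by (intro holomorphic_intros)
  qed (use moebius_in_H[OF B] in auto)
  define v where "v w = Re (F' w) + ln (Im w)" for w
  have uv: "u (moebius B w) = v w + ln (Im z)" if "w \<in> \<H>" for w
    using that y u[OF moebius_in_H[OF B that]] unfolding v_def F'_def
    by (simp add: Bw upper_half_plane_iff ln_mult)
  have D: "hyp_disc 1 \<in> sets borel" using compact_hyp_disc by (simp add: compact_imp_closed borel_closed)
  have "integral\<^sup>L hyp_measure ?h = (LINT w|hyp_measure. ?h (moebius B w))"
    by (rule hyp_measure_moebius_invariant(2)[OF h B, symmetric])
  also have "\<dots> = (LINT w:hyp_disc 1|hyp_measure. hyp_kernel \<i> w * (v w - v \<i>))"
    unfolding set_lebesgue_integral_def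
  proof (rule integral_cong_AE)
    show "(\<lambda>w. ?h (moebius B w)) \<in> borel_measurable hyp_measure"
      using measurable_compose[OF measurable_moebius h] by simp
    have "continuous_on (hyp_disc 1) (\<lambda>w. hyp_kernel \<i> w * (v w - v \<i>))"
      unfolding v_def
      by (intro continuous_intros continuous_on_hyp_kernel
           continuous_on_subset[OF holomorphic_on_imp_continuous_on[OF F'] hyp_disc_subset])
         (auto simp: hyp_disc_def upper_half_plane_iff)
    then show "(\<lambda>w. indicator (hyp_disc 1) w *\<^sub>R (hyp_kernel \<i> w * (v w - v \<i>))) \<in> borel_measurable hyp_measure"
      unfolding borel_measurable_hyp_measure by (rule borel_measurable_continuous_on_indicator[OF D])
    show "AE w in hyp_measure. ?h (moebius B w) = indicator (hyp_disc 1) w *\<^sub>R (hyp_kernel \<i> w * (v w - v \<i>))"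
    proof (rule AE_mp[OF AE_hyp_measure], rule AE_I2, rule impI)
      fix w assume w: "w \<in> \<H>"
      have "hyp_kernel z (moebius B w) = hyp_kernel \<i> w"
        using hyp_kernel_moebius[OF B i_in_H w] by (simp add: Bi)
      moreover have "u z = v \<i> + ln (Im z)" using uv[OF i_in_H] by (simp add: Bi)
      moreover have "hyp_kernel \<i> w = 0" if "w \<notin> hyp_disc 1" using that w by (auto simp: hyp_kernel_def hyp_disc_def)
      ultimately show "?h (moebius B w) = indicator (hyp_disc 1) w *\<^sub>R (hyp_kernel \<i> w * (v w - v \<i>))"
        using uv[OF w] by (auto simp: indicator_def)
    qed
  qed
  also have "\<dots> = - hyp_kernel_defect"
    unfolding v_def by (rule hyp_kernel_mean_i[OF F'])
  finally show ?thesis .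
qed

section \<open>Absence of additive potentials\<close>

lemma sig_hyp_disc_neighbour:
  assumes "z \<in> hyp_disc M" "w \<in> \<H>" "sig z w \<le> 1"
  shows "w \<in> hyp_disc ((M + 2) * 3)"
proof -
  have z: "z \<in> \<H>" "sig \<i> z \<le> M" using assms(1) by (auto simp: hyp_disc_def)
  obtain B where B: "det B = 1" "moebius B \<i> = z" using moebius_transitive[OF z(1)] .
  have w': "moebius (adjugate2 B) w \<in> \<H>" using moebius_in_H[of "adjugate2 B"] B assms(2) by simp
  obtain C where C: "det C = 1" "moebius C \<i> = moebius (adjugate2 B) w" using moebius_transitive[OF w'] .
  have "sig \<i> (moebius C \<i>) = sig (moebius B \<i>) (moebius B (moebius C \<i>))"
    by (rule sig_moebius[OF B(1), symmetric]) (use C w' in auto)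
  also have "\<dots> = sig z w" using B C assms(2) moebius_inverse(2)[OF B(1)] by simp
  finally have "(norm C)\<^sup>2 \<le> 3" using sig_i_moebius_i[OF C(1)] assms(3) by simp
  moreover have "(norm B)\<^sup>2 \<le> M + 2" using sig_i_moebius_i[OF B(1)] B z by simp
  moreover from this have "0 \<le> M + 2" using zero_le_power2[of "norm B"] by linarith
  ultimately have "(norm B)\<^sup>2 * (norm C)\<^sup>2 \<le> (M + 2) * 3" by (intro mult_mono) auto
  moreover have "(norm (B ** C))\<^sup>2 \<le> (norm B * norm C)\<^sup>2" by (intro power_mono norm_matrix_mult_2) simp
  ultimately have "(norm (B ** C))\<^sup>2 \<le> (M + 2) * 3" by (simp add: power_mult_distrib)
  moreover have "sig \<i> (moebius (B ** C) \<i>) + 2 = (norm (B ** C))\<^sup>2"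
    using sig_i_moebius_i[of "B ** C"] B C by (simp add: det_mul)
  moreover have "moebius (B ** C) \<i> = w"
    using B C assms(2) moebius_inverse(2)[OF B(1)] by (simp add: moebius_mult)
  ultimately show ?thesis using assms(2) by (simp add: hyp_disc_def)
qed

context cocompact_fuchsian
begin

text \<open>
  Let \<open>\<psi>\<close> be a bump function whose translates cover the half plane, and divide it by the invariant sum \<open>S\<close> of its translates to get a
  partition of unity. Integrated against this partition \<open>\<eta>\<close>, the kernel means of \<open>u w - u z\<close> give a negative number by
  \<open>hyp_kernel_mean\<close>. Inserting a second copy of \<open>\<eta>\<close> in the variable \<open>w\<close> writes the same number as a double integral of
  \<open>\<eta> z * \<eta> w * H z w\<close>, where \<open>H\<close> sums over the translates of \<open>w\<close>. Since \<open>u (A w) - u z\<close> changes sign when \<open>z\<close> and \<open>w\<close> are exchanged and \<open>A\<close> is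
  inverted, \<open>H\<close> is antisymmetric and the double integral is zero.
\<close>

lemma no_additive_potential:
  assumes F: "F holomorphic_on \<H>" and u: "\<And>w. w \<in> \<H> \<Longrightarrow> u w = Re (F w) + ln (Im w)"
    and r: "\<And>A w. A \<in> G \<Longrightarrow> w \<in> \<H> \<Longrightarrow> u (moebius A w) = u w + r A"
  shows False
proof -
  obtain M where M: "\<And>z. z \<in> \<H> \<Longrightarrow> \<exists>A\<in>G. sig \<i> (moebius A z) \<le> M" using cocompact_G by blast
  define \<psi> where "\<psi> z = (if z \<in> \<H> then max 0 (M + 1 - sig \<i> z) else 0)" for z
  define M' where "M' = max (M + 1) ((M + 1 + 2) * 3)"
  define L where "L = hyp_disc (M + 1)"
  define T where "T = {A\<in>G. \<exists>z\<in>\<H>. sig \<i> z \<le> M' \<and> sig \<i> (moebius A z) \<le> M'}"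
  have T: "finite T" unfolding T_def by (rule proper_G)
  have TG: "A \<in> G" if "A \<in> T" for A using that by (simp add: T_def)
  have TI: "A \<in> T" if "A \<in> G" "z \<in> hyp_disc M'" "moebius A z \<in> hyp_disc M'" for A z
    using that by (auto simp: T_def hyp_disc_def)
  have LH: "z \<in> \<H>" if "z \<in> L" for z using that by (simp add: L_def hyp_disc_def)
  have LM: "z \<in> hyp_disc M'" if "z \<in> L" for z using that by (auto simp: L_def hyp_disc_def M'_def)
  have near: "w \<in> hyp_disc M'" if "z \<in> L" "w \<in> \<H>" "hyp_kernel z w \<noteq> 0" for z w
  proof -
    have "sig z w \<le> 1" using that by (simp add: hyp_kernel_def split: if_splits)
    then have "w \<in> hyp_disc ((M + 1 + 2) * 3)" using sig_hyp_disc_neighbour that(1,2) unfolding L_def by blast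
    then show ?thesis by (auto simp: hyp_disc_def M'_def)
  qed
  have T_inv: "adjugate2 A \<in> T" if "A \<in> T" for A
  proof -
    obtain z where z: "z \<in> \<H>" "sig \<i> z \<le> M'" "sig \<i> (moebius A z) \<le> M'" and A: "A \<in> G" using \<open>A \<in> T\<close> by (auto simp: T_def)
    have "moebius A z \<in> \<H>" using moebius_in_H det_G A z by blast
    moreover have "moebius (adjugate2 A) (moebius A z) = z" using moebius_inverse(1) det_G A z by blast
    ultimately show ?thesis using z A inverse_G by (auto simp: T_def)
  qed
  have bij_inv: "bij_betw adjugate2 T T"
    by (rule bij_betwI[of _ _ _ adjugate2]) (use T_inv in auto)
  have \<psi>0: "\<psi> z \<ge> 0" for z by (simp add: \<psi>_def)
  have \<psi>L: "z \<in> L" if "\<psi> z \<noteq> 0" for z using that by (auto simp: \<psi>_def L_def hyp_disc_def split: if_splits)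
  \<comment> \<open>on the disc the infinite sum over the group only involves the finite set \<open>T\<close>\<close>
  define S where "S z = (\<Sum>A\<in>{A\<in>G. \<psi> (moebius A z) \<noteq> 0}. \<psi> (moebius A z))" for z
  have S_T: "S z = (\<Sum>A\<in>T. \<psi> (moebius A z))" if "z \<in> hyp_disc M'" for z
    unfolding S_def
  proof (rule sum.mono_neutral_left[OF T])
    show "{A \<in> G. \<psi> (moebius A z) \<noteq> 0} \<subseteq> T" using TI[OF _ that] \<psi>L LM by blast
  qed (use TG in auto)
  have S_inv: "S (moebius B z) = S z" if B: "B \<in> G" and z: "z \<in> \<H>" for B z
    unfolding S_def
  proof (rule sum.reindex_bij_witness[of _ "\<lambda>A. A ** adjugate2 B" "\<lambda>A. A ** B"])
    fix A assume A: "A \<in> {A \<in> G. \<psi> (moebius A (moebius B z)) \<noteq> 0}"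
    show "A ** B ** adjugate2 B = A" 
      using adjugate2_mult(2)[OF det_G[OF B]] by (simp add: matrix_mul_assoc[symmetric])
    show "A ** B \<in> {A \<in> G. \<psi> (moebius A z) \<noteq> 0}"
      using A B mult_G moebius_mult[of A B z] det_G z by auto
    show "\<psi> (moebius (A ** B) z) = \<psi> (moebius A (moebius B z))"
      using A B moebius_mult[of A B z] det_G z by auto
  next
    fix A assume A: "A \<in> {A \<in> G. \<psi> (moebius A z) \<noteq> 0}"
    show "A ** adjugate2 B ** B = A"
      using adjugate2_mult(1)[OF det_G[OF B]] by (simp add: matrix_mul_assoc[symmetric])
    have "moebius (A ** adjugate2 B) (moebius B z) = moebius A z"
      using moebius_mult[of A "adjugate2 B" "moebius B z"] moebius_inverse(1)[OF det_G[OF B] z]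
        moebius_in_H[OF det_G[OF B] z] A det_G det_G[OF B] by simp
    then show "A ** adjugate2 B \<in> {A \<in> G. \<psi> (moebius A (moebius B z)) \<noteq> 0}"
      using A B mult_G inverse_G by auto
  qed
  have S_pos: "S z > 0" if z: "z \<in> hyp_disc M'" for z
  proof -
    have zH: "z \<in> \<H>" using z by (simp add: hyp_disc_def)
    obtain A where A: "A \<in> G" "sig \<i> (moebius A z) \<le> M" using M[OF zH] by blast
    have p: "\<psi> (moebius A z) > 0" using A moebius_in_H[OF det_G[OF A(1)] zH] by (simp add: \<psi>_def)
    then have "moebius A z \<in> hyp_disc M'" using \<psi>L LM by force
    then have "A \<in> T" using TI A z by blast
    then have "\<psi> (moebius A z) \<le> (\<Sum>A\<in>T. \<psi> (moebius A z))"
      by (intro member_le_sum T) (auto simp: \<psi>0)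
    then show ?thesis using p S_T[OF z] by simp
  qed
  have c\<psi>: "continuous_on X (\<lambda>x. \<psi> (f x))" if "continuous_on X f" "\<And>x. x \<in> X \<Longrightarrow> f x \<in> \<H>" for X :: "'c::topological_space set" and f
  proof -
    have "continuous_on X (\<lambda>x. max 0 (M + 1 - sig \<i> (f x)))"
      by (intro continuous_intros continuous_on_sig that) auto
    then show ?thesis by (rule continuous_on_cong[THEN iffD1, rotated -1]) (use that(2) in \<open>auto simp: \<psi>_def\<close>)
  qed
  have cF: "continuous_on \<H> F" using F by (rule holomorphic_on_imp_continuous_on)
  have cu: "continuous_on X (\<lambda>x. u (f x))" if "continuous_on X f" "\<And>x. x \<in> X \<Longrightarrow> f x \<in> \<H>" for X :: "'c::topological_space set" and f
  proof -
    have "continuous_on X (\<lambda>x. Re (F (f x)) + ln (Im (f x)))"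
      using that
      by (intro continuous_intros continuous_on_compose2[OF cF]) (fastforce simp: upper_half_plane_iff)+
    then show ?thesis by (rule continuous_on_cong[THEN iffD1, rotated -1]) (use that(2) u in auto)
  qed
  have idL: "continuous_on L (\<lambda>x. x)" by (rule continuous_on_id)
  have cS: "continuous_on L S"
  proof -
    have "continuous_on L (\<lambda>z. \<Sum>A\<in>T. \<psi> (moebius A z))"
      by (intro continuous_intros c\<psi> continuous_on_moebius det_G TG moebius_in_H LH) auto
    then show ?thesis by (rule continuous_on_cong[THEN iffD1, rotated -1]) (use S_T LM in auto)
  qed
  define \<eta> where "\<eta> z = \<psi> z / S z" for z
  have SL: "S z \<noteq> 0" if "z \<in> L" for z using S_pos[OF LM[OF that]] by simp
  have ceta: "continuous_on L \<eta>"
    unfolding \<eta>_def using SL by (intro continuous_intros cS c\<psi> idL LH) auto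
  have compL: "compact L" "emeasure hyp_measure L < \<infinity>" "L \<in> sets borel"
    using compact_hyp_disc emeasure_hyp_disc by (auto simp: L_def compact_imp_closed borel_closed)
  define k where "k z A w = hyp_kernel z (moebius A w) * (u (moebius A w) - u z)" for z A w
  define H where "H z w = (\<Sum>A\<in>T. k z A w)" for z w
  have H_anti: "H w z = - H z w" if zw: "z \<in> \<H>" "w \<in> \<H>" for z w
  proof -
    have "H w z = (\<Sum>A\<in>T. k w (adjugate2 A) z)"
      unfolding H_def by (rule sum.reindex_bij_betw[OF bij_inv, symmetric])
    also have "\<dots> = (\<Sum>A\<in>T. - k z A w)"
    proof (rule sum.cong[OF refl])
      fix A assume "A \<in> T"
      then have A: "A \<in> G" "det A = 1" using TG det_G by auto
      let ?z = "moebius (adjugate2 A) z"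
      have z': "?z \<in> \<H>" "moebius A ?z = z" using moebius_in_H[of "adjugate2 A"] moebius_inverse(2) A zw by auto
      have w': "moebius A w \<in> \<H>" using moebius_in_H A zw by auto
      have "hyp_kernel w ?z = hyp_kernel (moebius A w) (moebius A ?z)"
        using hyp_kernel_moebius[OF A(2) zw(2) z'(1)] by simp
      also have "\<dots> = hyp_kernel z (moebius A w)" using z' w' zw hyp_kernel_commute by simp
      finally have 1: "hyp_kernel w ?z = hyp_kernel z (moebius A w)" .
      have "u z = u ?z + r A" using r[OF A(1) z'(1)] z' by simp
      moreover have "u (moebius A w) = u w + r A" by (rule r[OF A(1) zw(2)])
      ultimately show "k w (adjugate2 A) z = - k z A w" unfolding k_def 1 by (simp add: algebra_simps)
    qed
    also have "\<dots> = - H z w" by (simp add: H_def sum_negf)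
    finally show ?thesis .
  qed
  have inner: "(LINT w:L|hyp_measure. \<eta> w * H z w) = - hyp_kernel_defect" if z: "z \<in> L" for z
  proof -
    have zH: "z \<in> \<H>" using LH z by blast
    define f where "f A w = indicator L w *\<^sub>R (\<eta> w * k z A w)" for A w
    have cf: "continuous_on L (\<lambda>w. \<eta> w * k z A w)" if "A \<in> T" for A
      unfolding k_def using zH
      by (intro continuous_intros ceta continuous_on_hyp_kernel cu continuous_on_moebius det_G[OF TG[OF that]] moebius_in_H) (use zH LH in auto)
    have mf: "f A \<in> borel_measurable borel" if "A \<in> T" for A
      unfolding f_def by (rule borel_measurable_continuous_on_indicator[OF compL(3) cf[OF that]])
    have si: "set_integrable hyp_measure L (\<lambda>w. \<eta> w * k z A w)" if "A \<in> T" for A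
      by (rule integrable_on_compact[OF sets_hyp_measure compL(1,2) cf[OF that]])
    have fi: "integrable hyp_measure (f A)" if "A \<in> T" for A
      using si[OF that] unfolding set_integrable_def f_def[abs_def] .
    have dA: "det (adjugate2 A) = 1" if "A \<in> T" for A using det_G TG that by simp
    have fi': "integrable hyp_measure (\<lambda>w. f A (moebius (adjugate2 A) w))" if "A \<in> T" for A
      using hyp_measure_moebius_invariant(1)[OF mf[OF that] dA[OF that]] fi[OF that] by blast
    have "(LINT w:L|hyp_measure. \<eta> w * H z w) = (LINT w|hyp_measure. (\<Sum>A\<in>T. f A w))"
      unfolding set_lebesgue_integral_def f_def H_def
      by (simp add: sum_distrib_left)
    also have "\<dots> = (\<Sum>A\<in>T. integral\<^sup>L hyp_measure (f A))"
      by (rule Bochner_Integration.integral_sum[OF fi])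
    also have "\<dots> = (\<Sum>A\<in>T. (LINT w|hyp_measure. f A (moebius (adjugate2 A) w)))"
      by (intro sum.cong refl hyp_measure_moebius_invariant(2)[symmetric] mf dA)
    also have "\<dots> = (LINT w|hyp_measure. (\<Sum>A\<in>T. f A (moebius (adjugate2 A) w)))"
      by (rule Bochner_Integration.integral_sum[OF fi', symmetric])
    also have "\<dots> = (LINT w|hyp_measure. hyp_kernel z w * (u w - u z))"
    proof (rule integral_cong_AE)
      show "(\<lambda>w. \<Sum>A\<in>T. f A (moebius (adjugate2 A) w)) \<in> borel_measurable hyp_measure"
        using fi' by (intro borel_measurable_sum) auto
      show "(\<lambda>w. hyp_kernel z w * (u w - u z)) \<in> borel_measurable hyp_measure"
        unfolding borel_measurable_hyp_measure
        by (rule measurable_on_H, intro continuous_intros continuous_on_hyp_kernel cu)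
           (use zH in \<open>auto simp: hyp_kernel_def\<close>)
      show "AE w in hyp_measure. (\<Sum>A\<in>T. f A (moebius (adjugate2 A) w)) = hyp_kernel z w * (u w - u z)"
      proof (rule AE_mp[OF AE_hyp_measure], rule AE_I2, rule impI)
        fix w assume w: "w \<in> \<H>"
        have "f A (moebius (adjugate2 A) w) = \<psi> (moebius (adjugate2 A) w) / S w * (hyp_kernel z w * (u w - u z))" if "A \<in> T" for A
        proof -
          have A: "A \<in> G" "det A = 1" "adjugate2 A \<in> G" using TG[OF that] det_G inverse_G by auto
          have "S (moebius (adjugate2 A) w) = S w" by (rule S_inv[OF A(3) w])
          moreover have "moebius A (moebius (adjugate2 A) w) = w" by (rule moebius_inverse(2)[OF A(2) w])
          ultimately show ?thesis
            using \<psi>L[of "moebius (adjugate2 A) w"] by (auto simp: f_def \<eta>_def k_def indicator_def)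
        qed
        then have "(\<Sum>A\<in>T. f A (moebius (adjugate2 A) w)) =
            (\<Sum>A\<in>T. \<psi> (moebius (adjugate2 A) w)) / S w * (hyp_kernel z w * (u w - u z))"
          by (simp add: sum_distrib_right sum_divide_distrib)
        also have "\<dots> = hyp_kernel z w * (u w - u z)"
        proof (cases "hyp_kernel z w = 0")
          case False
          then have wM: "w \<in> hyp_disc M'" using near z w by blast
          have "(\<Sum>A\<in>T. \<psi> (moebius (adjugate2 A) w)) = (\<Sum>A\<in>T. \<psi> (moebius A w))"
            by (rule sum.reindex_bij_betw[OF bij_inv])
          also have "\<dots> = S w" by (rule S_T[OF wM, symmetric])
          finally show ?thesis using S_pos[OF wM] by simp
        qed simp
        finally show "(\<Sum>A\<in>T. f A (moebius (adjugate2 A) w)) = hyp_kernel z w * (u w - u z)" .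
      qed
    qed
    also have "\<dots> = - hyp_kernel_defect" by (rule hyp_kernel_mean[OF F zH u])
    finally show ?thesis .
  qed
  have neg: "(LINT z:L|hyp_measure. - g z) = - (LINT z:L|hyp_measure. g z)" for g :: "complex \<Rightarrow> real"
    by (simp only: set_lebesgue_integral_def scaleR_minus_right Bochner_Integration.integral_minus)
  have LS: "L \<in> sets hyp_measure" using compL(3) by simp
  define X where "X = (LINT z:L|hyp_measure. LINT w:L|hyp_measure. \<eta> z * (\<eta> w * H z w))"
  have "X = (LINT z:L|hyp_measure. - hyp_kernel_defect * \<eta> z)"
    unfolding X_def
    by (rule set_lebesgue_integral_cong) (use compL inner in auto)
  then have X1: "X = - hyp_kernel_defect * (LINT z:L|hyp_measure. \<eta> z)"
    by (simp only: set_integral_mult_right)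
  have X2: "X = (LINT w:L|hyp_measure. LINT z:L|hyp_measure. \<eta> z * (\<eta> w * H z w))"
    unfolding X_def
  proof (rule Fubini_on_compact[OF sets_hyp_measure sets_hyp_measure compL(1,2) compL(1,2)])
    have "continuous_on (L \<times> L) (\<lambda>p. \<eta> (fst p) * (\<eta> (snd p) * H (fst p) (snd p)))"
      unfolding H_def k_def
      by (intro continuous_intros continuous_on_compose2[OF ceta] continuous_on_hyp_kernel cu continuous_on_moebius det_G TG moebius_in_H LH)
         auto
    then show "continuous_on (L \<times> L) (\<lambda>(z, w). \<eta> z * (\<eta> w * H z w))" by (simp add: case_prod_unfold)
  qed
  have flip: "(LINT z:L|hyp_measure. \<eta> z * (\<eta> w * H z w)) = - (LINT z:L|hyp_measure. \<eta> w * (\<eta> z * H w z))"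
    if w: "w \<in> L" for w
  proof -
    have "(LINT z:L|hyp_measure. \<eta> z * (\<eta> w * H z w)) = (LINT z:L|hyp_measure. - (\<eta> w * (\<eta> z * H w z)))"
    proof (rule set_lebesgue_integral_cong[OF LS], intro allI impI)
      fix z assume "z \<in> L"
      then have "H z w = - H w z" using H_anti LH w by blast
      then show "\<eta> z * (\<eta> w * H z w) = - (\<eta> w * (\<eta> z * H w z))" by simp
    qed
    then show ?thesis unfolding neg .
  qed
  have "X = (LINT w:L|hyp_measure. - (LINT z:L|hyp_measure. \<eta> w * (\<eta> z * H w z)))"
    unfolding X2 by (rule set_lebesgue_integral_cong[OF LS]) (use flip in blast)
  also have "\<dots> = - X" unfolding X_def by (rule neg)
  finally have "X = 0" by simp
  then have zero: "(LINT z:L|hyp_measure. \<eta> z) = 0" using X1 hyp_kernel_defect_pos by simp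
  let ?U = "{z\<in>\<H>. sig \<i> z < M + 1}"
  obtain z1 where z1: "z1 \<in> ?U"
  proof -
    obtain A where "A \<in> G" "sig \<i> (moebius A \<i>) \<le> M" using M[OF i_in_H] by blast
    then show ?thesis using that[of "moebius A \<i>"] moebius_in_H[OF det_G, of A \<i>] by simp
  qed
  have "integral\<^sup>L hyp_measure (\<lambda>z. indicator L z *\<^sub>R \<eta> z) > 0"
  proof (rule hyp_integral_pos[where U = ?U])
    show "integrable hyp_measure (\<lambda>z. indicator L z *\<^sub>R \<eta> z)"
      using integrable_on_compact[OF sets_hyp_measure compL(1,2) ceta] unfolding set_integrable_def .
    show "0 \<le> indicator L z *\<^sub>R \<eta> z" for z
    proof (cases "z \<in> L")
      case True
      then show ?thesis using S_pos[OF LM[OF True]] \<psi>0[of z] by (simp add: \<eta>_def)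
    qed simp
    show "open ?U" by (rule open_hyp_ball)
    show "?U \<noteq> {}" using z1 by blast
    show "indicator L z *\<^sub>R \<eta> z > 0" if "z \<in> ?U" for z
    proof -
      have "z \<in> L" using that by (simp add: L_def hyp_disc_def)
      moreover have "\<psi> z > 0" using that by (simp add: \<psi>_def)
      ultimately show ?thesis using S_pos[OF LM[OF \<open>z \<in> L\<close>]] by (simp add: \<eta>_def)
    qed
  qed blast
  then show False using zero by (simp add: set_lebesgue_integral_def)
qed

end

section \<open>The cocycle and forms of weight two\<close>

text \<open>
  Minus one half of the logarithmic derivative of \<open>(c z + d)^-2\<close>, the derivative of the Moebius map.
\<close>

definition cocycle :: "real^2^2 \<Rightarrow> complex \<Rightarrow> complex" where
  "cocycle A z = of_real (A$2$1) / automorphy A z"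

lemma cocycle_mat_1 [simp]: "cocycle (mat 1) z = 0"
  by (simp add: cocycle_def)

lemma cocycle_mult:
  assumes A: "det A = 1" and B: "det B = 1" and z: "z \<in> \<H>"
  shows "cocycle (A ** B) z = cocycle A (moebius B z) / (automorphy B z)\<^sup>2 + cocycle B z"
proof -
  define a c d where "a = complex_of_real (A$2$1)" and "c = complex_of_real (B$2$1)" and "d = complex_of_real (B$2$2)"
  define p j where "p = automorphy A (moebius B z)" and "j = automorphy B z"
  have p: "p \<noteq> 0" unfolding p_def by (rule automorphy_nonzero[OF A moebius_in_H[OF B z]])
  have j: "j \<noteq> 0" unfolding j_def by (rule automorphy_nonzero[OF B z])
  define e where "e = complex_of_real ((A ** B)$2$1)"
  have pj: "automorphy (A ** B) z = p * j" unfolding p_def j_def by (rule automorphy_mult[OF B z])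
  have dB: "of_real (B$1$1) * d - of_real (B$1$2) * c = (1::complex)"
    using B unfolding det_2 c_def d_def by (metis of_real_1 of_real_diff of_real_mult)
  have "e * j - c * (p * j) = a * (of_real (B$1$1) * d - of_real (B$1$2) * c)"
    unfolding pj[symmetric] unfolding j_def e_def automorphy_def a_def c_def d_def matrix_mult_2
    by (simp add: algebra_simps)
  then have "e * j = a + c * (p * j)" unfolding dB by (simp add: algebra_simps)
  then have "e = (a + c * (p * j)) / j" using j by (simp add: eq_divide_eq)
  then have "e / (p * j) = a / (p * j * j) + c / j"
    using p j by (simp add: add_divide_distrib mult_ac)
  then show ?thesis
    unfolding cocycle_def pj e_def[symmetric] a_def[symmetric] c_def[symmetric] p_def[symmetric] j_def[symmetric]
    by (simp add: power2_eq_square mult.assoc)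
qed

text \<open>
  The value at one point determines the value at any other by a fixed injective map, so the number of
  values does not depend on the point.
\<close>

lemma cocycle_shift:
  assumes A: "det A = 1" and z: "z \<in> \<H>" and w: "w \<in> \<H>"
  shows "1 + cocycle A w * (z - w) \<noteq> 0"
    and "cocycle A z = cocycle A w / (1 + cocycle A w * (z - w))"
proof -
  have n: "automorphy A z \<noteq> 0" "automorphy A w \<noteq> 0" using automorphy_nonzero A z w by auto
  have "automorphy A z = automorphy A w + of_real (A$2$1) * (z - w)"
    by (simp add: automorphy_def algebra_simps)
  then have *: "1 + cocycle A w * (z - w) = automorphy A z / automorphy A w"
    using n by (simp add: cocycle_def add_divide_distrib)
  show "1 + cocycle A w * (z - w) \<noteq> 0" unfolding * using n by simp
  show "cocycle A z = cocycle A w / (1 + cocycle A w * (z - w))"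
    unfolding * using n by (simp add: cocycle_def)
qed

lemma cocycle_eq_iff:
  assumes "det A = 1" "det B = 1" "z \<in> \<H>" "w \<in> \<H>"
  shows "cocycle A z = cocycle B z \<longleftrightarrow> cocycle A w = cocycle B w"
  using cocycle_shift(2)[of _ z w] cocycle_shift(2)[of _ w z] assms by metis

lemma automorphy_has_field_derivative:
  "(automorphy A has_field_derivative of_real (A$2$1)) (at z)"
  unfolding automorphy_def[abs_def] by (auto intro!: derivative_eq_intros)

lemma automorphy_holomorphic: "automorphy A holomorphic_on S"
  unfolding automorphy_def[abs_def] by (intro holomorphic_intros)

lemma cocycle_holomorphic: "det A = 1 \<Longrightarrow> cocycle A holomorphic_on \<H>"
  unfolding cocycle_def[abs_def] by (intro holomorphic_intros automorphy_holomorphic automorphy_nonzero)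

lemma moebius_holomorphic: "det A = 1 \<Longrightarrow> moebius A holomorphic_on \<H>"
  unfolding holomorphic_on_open[OF open_H] using moebius_has_field_derivative by blast

lemma comp_moebius_holomorphic:
  assumes "f holomorphic_on \<H>" "det A = 1"
  shows "(\<lambda>z. f (moebius A z)) holomorphic_on \<H>"
  by (rule holomorphic_on_compose_gen[OF moebius_holomorphic[OF assms(2)] assms(1), unfolded o_def])
     (use moebius_in_H assms(2) in auto)

lemma convex_H: "convex \<H>"
  unfolding upper_half_plane_def by (rule convex_halfspace_Im_gt)

context cocompact_fuchsian
begin

text \<open>
  If \<open>\<kappa>\<close> were nonzero, let \<open>F\<close> be a primitive of \<open>2 f / \<kappa>\<close>. The transformation law says that
  \<open>exp (F (A z) - F z) / (c z + d)\<^sup>2\<close> is constant in \<open>z\<close>. Taking absolute values, \<open>Re F + ln Im\<close> changes by an additive constant under each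
  group element.
\<close>

lemma no_weight_2_quasi:
  assumes f: "f holomorphic_on \<H>"
    and eq: "\<And>A z. A \<in> G \<Longrightarrow> z \<in> \<H> \<Longrightarrow> f (moebius A z) / (automorphy A z)\<^sup>2 = f z + \<kappa> * cocycle A z"
  shows "\<kappa> = 0"
proof (rule ccontr)
  assume \<kappa>: "\<kappa> \<noteq> 0"
  define g where "g z = 2 * f z / \<kappa>" for z
  have g: "g holomorphic_on \<H>" unfolding g_def using f \<kappa> by (intro holomorphic_intros) auto
  obtain F where "\<And>z. z \<in> \<H> \<Longrightarrow> (F has_field_derivative g z) (at z within \<H>)"
    using holomorphic_convex_primitive'[OF convex_H open_H g] by blast
  then have F: "(F has_field_derivative g z) (at z)" if "z \<in> \<H>" for z
    using that at_within_open[OF _ open_H] by metis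
  have F_hol: "F holomorphic_on \<H>"
    using F open_H by (auto simp: holomorphic_on_open)
  have geq: "g (moebius A z) / (automorphy A z)\<^sup>2 = g z + 2 * cocycle A z" if "A \<in> G" "z \<in> \<H>" for A z
  proof -
    have "g (moebius A z) / (automorphy A z)\<^sup>2 = 2 / \<kappa> * (f (moebius A z) / (automorphy A z)\<^sup>2)" by (simp add: g_def)
    also have "\<dots> = g z + 2 * cocycle A z" unfolding eq[OF that] using \<kappa> by (simp add: g_def field_simps)
    finally show ?thesis .
  qed
  define h where "h A z = exp (F (moebius A z) - F z) / (automorphy A z)\<^sup>2" for A z
  have h_const: "\<exists>C. \<forall>z\<in>\<H>. h A z = C" if A: "A \<in> G" for A
    proof (rule has_field_derivative_zero_constant[OF convex_H])
      fix z assume z: "z \<in> \<H>"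
      define j where "j = automorphy A z"
      have j: "j \<noteq> 0" unfolding j_def by (rule automorphy_nonzero[OF det_G[OF A] z])
      define E where "E = exp (F (moebius A z) - F z)"
      have d1: "((\<lambda>z. F (moebius A z)) has_field_derivative g (moebius A z) * (1 / j\<^sup>2)) (at z)"
        unfolding j_def
        by (rule DERIV_chain2[OF F[OF moebius_in_H[OF det_G[OF A] z]] moebius_has_field_derivative[OF det_G[OF A] z]])
      have "(h A has_field_derivative
          ((E * (g (moebius A z) * (1 / j\<^sup>2) - g z)) * j\<^sup>2 - E * (2 * j * of_real (A$2$1))) / (j\<^sup>2 * j\<^sup>2)) (at z)"
        unfolding h_def[abs_def] E_def j_def
        by (rule derivative_eq_intros d1[unfolded j_def] F[OF z] automorphy_has_field_derivative refl
             | use j in \<open>simp add: j_def\<close>)+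
      also have "g (moebius A z) * (1 / j\<^sup>2) - g z = 2 * (of_real (A$2$1) / j)"
        using geq[OF A z] by (simp add: j_def cocycle_def)
      also have "((E * (2 * (of_real (A$2$1) / j))) * j\<^sup>2 - E * (2 * j * of_real (A$2$1))) / (j\<^sup>2 * j\<^sup>2) = 0"
        using j by (simp add: power2_eq_square)
      finally show "(h A has_field_derivative 0) (at z within \<H>)"
        by (rule has_field_derivative_at_within)
    qed
  define u where "u z = Re (F z) + ln (Im z)" for z
  have uA: "u (moebius A z) = u z + ln (cmod (h A z))" if A: "A \<in> G" and z: "z \<in> \<H>" for A z
  proof -
    have j: "automorphy A z \<noteq> 0" by (rule automorphy_nonzero[OF det_G[OF A] z])
    have y: "Im z > 0" using z by (simp add: upper_half_plane_iff)
    have "ln (cmod (h A z)) = Re (F (moebius A z)) - Re (F z) - ln ((cmod (automorphy A z))\<^sup>2)"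
      unfolding h_def norm_divide norm_exp_eq_Re norm_power using j by (simp add: ln_div)
    moreover have "ln (Im (moebius A z)) = ln (Im z) - ln ((cmod (automorphy A z))\<^sup>2)"
      unfolding Im_moebius[OF det_G[OF A] z] using j y by (simp add: ln_div)
    ultimately show ?thesis by (simp add: u_def)
  qed
  show False
  proof (rule no_additive_potential[OF F_hol, of u "\<lambda>A. ln (cmod (h A \<i>))"])
    show "u w = Re (F w) + ln (Im w)" for w by (simp add: u_def)
    fix A w assume A: "A \<in> G" and w: "w \<in> \<H>"
    have "h A w = h A \<i>" using h_const[OF A] w by (metis i_in_H)
    then show "u (moebius A w) = u w + ln (cmod (h A \<i>))" using uA[OF A w] by simp
  qed
qed

text \<open>
  If the values were finite in number, then minus their sum would be a holomorphic form of weight two with \<open>\<kappa>\<close>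
  equal to that number, since the cocycle relation only permutes and shifts the values.
\<close>

lemma infinite_cocycle:
  assumes w: "w \<in> \<H>"
  shows "infinite ((\<lambda>A. cocycle A w) ` G)"
proof
  define V where "V z = (\<lambda>A. cocycle A z) ` G" for z
  assume "finite ((\<lambda>A. cocycle A w) ` G)"
  then have finw: "finite (V w)" by (simp add: V_def)
  have sh: "V z = (\<lambda>x. x / (1 + x * (z - w))) ` V w" if "z \<in> \<H>" for z
    unfolding V_def image_image
    by (rule image_cong[OF refl]) (rule cocycle_shift(2)[OF det_G that w])
  have inj: "inj_on (\<lambda>x. x / (1 + x * (z - w))) (V w)" if z: "z \<in> \<H>" for z
  proof (rule inj_onI)
    fix x y assume "x \<in> V w" "y \<in> V w" and e: "x / (1 + x * (z - w)) = y / (1 + y * (z - w))"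
    then obtain A B where A: "A \<in> G" "x = cocycle A w" and B: "B \<in> G" "y = cocycle B w" by (auto simp: V_def)
    have "cocycle A z = cocycle B z"
      using e unfolding A B cocycle_shift(2)[OF det_G[OF A(1)] z w, symmetric] cocycle_shift(2)[OF det_G[OF B(1)] z w, symmetric] .
    then show "x = y" using cocycle_eq_iff[OF det_G[OF A(1)] det_G[OF B(1)] z w] A B by simp
  qed
  have fin: "finite (V z)" "card (V z) = card (V w)" if "z \<in> \<H>" for z
    unfolding sh[OF that] using finw card_image[OF inj[OF that]] by auto
  \<comment> \<open>written with the fixed set \<open>V w\<close>, the sum over all values is visibly holomorphic\<close>
  define f where "f z = - (\<Sum>x\<in>V w. x / (1 + x * (z - w)))" for z
  have fV: "f z = - (\<Sum>x\<in>V z. x)" if "z \<in> \<H>" for z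
    unfolding f_def sh[OF that] sum.reindex[OF inj[OF that]] by (simp add: o_def)
  have "f holomorphic_on \<H>"
    unfolding f_def
  proof (intro holomorphic_intros)
    fix x z assume "x \<in> V w" "z \<in> \<H>"
    then show "1 + x * (z - w) \<noteq> 0" unfolding V_def using cocycle_shift(1)[OF det_G _ w] by blast
  qed
  moreover have "f (moebius B z) / (automorphy B z)\<^sup>2 = f z + of_nat (card (V w)) * cocycle B z"
    if B: "B \<in> G" and z: "z \<in> \<H>" for B z
  proof -
    define j where "j = automorphy B z"
    have j: "j \<noteq> 0" unfolding j_def by (rule automorphy_nonzero[OF det_G[OF B] z])
    have Bz: "moebius B z \<in> \<H>" by (rule moebius_in_H[OF det_G[OF B] z])
    have inj2: "inj_on (\<lambda>y. y / j\<^sup>2 + cocycle B z) (V (moebius B z))"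
      using j by (auto simp: inj_on_def)
    have "V z = (\<lambda>y. y / j\<^sup>2 + cocycle B z) ` V (moebius B z)"
    proof (intro equalityI subsetI)
      fix x assume "x \<in> V z"
      then obtain A where A: "A \<in> G" "x = cocycle A z" by (auto simp: V_def)
      define C where "C = A ** adjugate2 B"
      have C: "C \<in> G" unfolding C_def by (intro mult_G A inverse_G B)
      have "C ** B = A" unfolding C_def using adjugate2_mult(1)[OF det_G[OF B]]
        by (simp add: matrix_mul_assoc[symmetric])
      then have "x = cocycle C (moebius B z) / j\<^sup>2 + cocycle B z"
        unfolding j_def A(2) using cocycle_mult[OF det_G[OF C] det_G[OF B] z] by simp
      then show "x \<in> (\<lambda>y. y / j\<^sup>2 + cocycle B z) ` V (moebius B z)" using C by (auto simp: V_def)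
    next
      fix x assume "x \<in> (\<lambda>y. y / j\<^sup>2 + cocycle B z) ` V (moebius B z)"
      then obtain A where A: "A \<in> G" "x = cocycle A (moebius B z) / j\<^sup>2 + cocycle B z" by (auto simp: V_def)
      then have "x = cocycle (A ** B) z" unfolding j_def cocycle_mult[OF det_G[OF A(1)] det_G[OF B] z] by simp
      then show "x \<in> V z" using mult_G[OF A(1) B] by (auto simp: V_def)
    qed
    then have "f z = - (\<Sum>y\<in>V (moebius B z). y / j\<^sup>2 + cocycle B z)"
      unfolding fV[OF z] using sum.reindex[OF inj2, of "\<lambda>x. x"] by (simp add: o_def)
    also have "\<dots> = - ((\<Sum>y\<in>V (moebius B z). y) / j\<^sup>2) - of_nat (card (V w)) * cocycle B z"
      using fin(2)[OF Bz] by (simp add: sum.distrib sum_divide_distrib)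
    finally show ?thesis unfolding fV[OF Bz] j_def by simp
  qed
  ultimately have "of_nat (card (V w)) = (0::complex)" by (rule no_weight_2_quasi)
  then have "V w = {}" using finw by simp
  then show False using one_G by (auto simp: V_def)
qed

end

section \<open>Quasimodularity as a polynomial transformation law\<close>

text \<open>
  Divided differences at nodes that never collide are holomorphic, and they are values of a family of lower degree.
\<close>

lemma poly_family_holomorphic:
  fixes R :: "complex \<Rightarrow> complex poly" and x :: "'i \<Rightarrow> complex \<Rightarrow> complex"
  assumes "infinite I" "\<And>i. i \<in> I \<Longrightarrow> x i holomorphic_on S"
    and "\<And>i j z. i \<in> I \<Longrightarrow> j \<in> I \<Longrightarrow> i \<noteq> j \<Longrightarrow> z \<in> S \<Longrightarrow> x i z \<noteq> x j z"
    and "\<And>z. z \<in> S \<Longrightarrow> degree (R z) \<le> p"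
    and "\<And>i. i \<in> I \<Longrightarrow> (\<lambda>z. poly (R z) (x i z)) holomorphic_on S"
  shows "(\<lambda>z. coeff (R z) n) holomorphic_on S"
  using assms
proof (induction p arbitrary: I R n)
  case 0
  obtain i where i: "i \<in> I" using 0(1) by (metis ex_in_conv finite.emptyI)
  have "poly (R z) (x i z) = coeff (R z) 0" if "z \<in> S" for z
  proof -
    have "degree (R z) = 0" using 0(4)[OF that] by simp
    then obtain a where "R z = [:a:]" by (rule degree_eq_zeroE)
    then show ?thesis by simp
  qed
  then have "(\<lambda>z. coeff (R z) 0) holomorphic_on S" using 0(5)[OF i] holomorphic_transform by fastforce
  moreover have "(\<lambda>z. coeff (R z) n) holomorphic_on S" if "n \<noteq> 0"
  proof (rule holomorphic_transform[of "\<lambda>_. 0"])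
    show "0 = coeff (R z) n" if "z \<in> S" for z using 0(4)[OF that] \<open>n \<noteq> 0\<close> by (simp add: coeff_eq_0)
  qed simp
  ultimately show ?case by (cases "n = 0") auto
next
  case (Suc p)
  obtain k where k: "k \<in> I" using Suc(2) by (metis ex_in_conv finite.emptyI)
  define Q where "Q z = synthetic_div (R z) (x k z)" for z
  have R: "R z = [:- x k z, 1:] * Q z + [:poly (R z) (x k z):]" for z
    unfolding Q_def by (rule synthetic_div_correct'[symmetric])
  have Q: "(\<lambda>z. coeff (Q z) m) holomorphic_on S" for m
  proof (rule Suc.IH[of "I - {k}"])
    show "infinite (I - {k})" using Suc(2) by simp
    show "degree (Q z) \<le> p" if "z \<in> S" for z using Suc(5)[OF that] by (simp add: Q_def degree_synthetic_div)
    fix i assume i: "i \<in> I - {k}"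
    have "poly (Q z) (x i z) = (poly (R z) (x i z) - poly (R z) (x k z)) / (x i z - x k z)" if "z \<in> S" for z
    proof -
      have "x i z - x k z \<noteq> 0" using Suc(4)[of i k z] i k that by auto
      moreover have "poly (R z) (x i z) = (x i z - x k z) * poly (Q z) (x i z) + poly (R z) (x k z)"
        by (subst R) (simp add: algebra_simps)
      ultimately show ?thesis by simp
    qed
    moreover have "(\<lambda>z. (poly (R z) (x i z) - poly (R z) (x k z)) / (x i z - x k z)) holomorphic_on S"
      using Suc(4)[of i k] i k by (intro holomorphic_intros Suc.prems) auto
    ultimately show "(\<lambda>z. poly (Q z) (x i z)) holomorphic_on S" by (simp cong: holomorphic_cong)
  qed (use Suc.prems in auto)
  have "coeff (R z) n = - x k z * coeff (Q z) n + (if n = 0 then poly (R z) (x k z) else coeff (Q z) (n - 1))" for z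
    by (subst R) (simp add: coeff_pCons split: nat.split)
  moreover have "(\<lambda>z. - x k z * coeff (Q z) n + (if n = 0 then poly (R z) (x k z) else coeff (Q z) (n - 1))) holomorphic_on S"
    by (cases "n = 0") (auto intro!: holomorphic_intros Q Suc.prems(2,5) k)
  ultimately show ?case by simp
qed

context cocompact_fuchsian
begin

text \<open>
  The functions \<open>f\<^sub>0, \<dots>, f\<^sub>p\<close> of a quasimodular form are collected into one polynomial at each point; the depth is a common
  bound of the degrees.
\<close>

definition quasi :: "int \<Rightarrow> (complex \<Rightarrow> complex) \<Rightarrow> (complex \<Rightarrow> complex poly) \<Rightarrow> bool" where
  "quasi k f Q \<longleftrightarrow> (\<exists>p. \<forall>z\<in>\<H>. degree (Q z) \<le> p) \<and>
     (\<forall>A\<in>G. \<forall>z\<in>\<H>. automorphy A z powi (- k) * f (moebius A z) = poly (Q z) (cocycle A z))"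

lemma quasi_eq:
  "quasi k f Q \<Longrightarrow> A \<in> G \<Longrightarrow> z \<in> \<H> \<Longrightarrow> automorphy A z powi (- k) * f (moebius A z) = poly (Q z) (cocycle A z)"
  by (simp add: quasi_def)

lemma poly_eq_on_cocycles:
  assumes "z \<in> \<H>" "\<And>A. A \<in> G \<Longrightarrow> poly p (cocycle A z) = poly q (cocycle A z)"
  shows "p = q"
proof (rule ccontr)
  assume "p \<noteq> q"
  then have "finite {x. poly (p - q) x = 0}" by (intro poly_roots_finite) simp
  moreover have "(\<lambda>A. cocycle A z) ` G \<subseteq> {x. poly (p - q) x = 0}" using assms(2) by auto
  ultimately show False using infinite_cocycle[OF assms(1)] finite_subset by blast
qed

lemma quasi_unique: "quasi k f Q \<Longrightarrow> quasi k f R \<Longrightarrow> z \<in> \<H> \<Longrightarrow> Q z = R z"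
  by (rule poly_eq_on_cocycles) (auto simp: quasi_eq[symmetric])

lemma quasi_coeff_0: "quasi k f Q \<Longrightarrow> z \<in> \<H> \<Longrightarrow> coeff (Q z) 0 = f z"
  using quasi_eq[OF _ one_G, of k f Q z] by (simp add: poly_0_coeff_0)

text \<open>
  Comparing the law for a product \<open>A ** B\<close> with those for \<open>A\<close> and \<open>B\<close> gives a Taylor shift of \<open>Q z\<close> by the cocycle of \<open>B\<close>. The linear
  coefficient of the shifted polynomial is the value of the derivative of \<open>Q z\<close>.
\<close>

lemma quasi_lower:
  assumes Q: "quasi k f Q"
  shows "quasi (k - 2) (\<lambda>z. coeff (Q z) 1) (\<lambda>z. pderiv (Q z))"
  unfolding quasi_def
proof (intro conjI ballI)
  obtain p where p: "\<And>z. z \<in> \<H> \<Longrightarrow> degree (Q z) \<le> p" using Q by (auto simp: quasi_def)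
  show "\<exists>p. \<forall>z\<in>\<H>. degree (pderiv (Q z)) \<le> p"
    using p by (auto simp: degree_pderiv intro!: exI[of _ p] intro: order_trans[OF diff_le_self])
next
  fix B z assume B: "B \<in> G" and z: "z \<in> \<H>"
  define j where "j = automorphy B z"
  have j: "j \<noteq> 0" unfolding j_def by (rule automorphy_nonzero[OF det_G[OF B] z])
  have Bz: "moebius B z \<in> \<H>" by (rule moebius_in_H[OF det_G[OF B] z])
  have "smult (j powi (- k)) (Q (moebius B z)) = pcompose (Q z) [:cocycle B z, 1 / j\<^sup>2:]"
  proof (rule poly_eq_on_cocycles[OF Bz])
    fix A assume A: "A \<in> G"
    have "poly (smult (j powi (- k)) (Q (moebius B z))) (cocycle A (moebius B z)) =
        j powi (- k) * (automorphy A (moebius B z) powi (- k) * f (moebius A (moebius B z)))"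
      using quasi_eq[OF Q A Bz] by simp
    also have "\<dots> = automorphy (A ** B) z powi (- k) * f (moebius (A ** B) z)"
      unfolding automorphy_mult[OF det_G[OF B] z] moebius_mult[OF det_G[OF A] det_G[OF B] z] j_def
      by (simp add: power_int_mult_distrib mult_ac)
    also have "\<dots> = poly (Q z) (cocycle (A ** B) z)" by (rule quasi_eq[OF Q mult_G[OF A B] z])
    also have "\<dots> = poly (pcompose (Q z) [:cocycle B z, 1 / j\<^sup>2:]) (cocycle A (moebius B z))"
      unfolding cocycle_mult[OF det_G[OF A] det_G[OF B] z] j_def by (simp add: poly_pcompose add.commute)
    finally show "poly (smult (j powi (- k)) (Q (moebius B z))) (cocycle A (moebius B z)) =
        poly (pcompose (Q z) [:cocycle B z, 1 / j\<^sup>2:]) (cocycle A (moebius B z))" .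
  qed
  then have "poly (pderiv (smult (j powi (- k)) (Q (moebius B z)))) 0 = poly (pderiv (pcompose (Q z) [:cocycle B z, 1 / j\<^sup>2:])) 0"
    by simp
  then have "j powi (- k) * coeff (Q (moebius B z)) 1 = poly (pderiv (Q z)) (cocycle B z) * (1 / j\<^sup>2)"
    by (simp add: pderiv_smult pderiv_pcompose poly_pcompose poly_0_coeff_0 coeff_pderiv pderiv_pCons)
  then have "j powi (- k) * j\<^sup>2 * coeff (Q (moebius B z)) 1 = poly (pderiv (Q z)) (cocycle B z)"
    using j by (simp add: field_simps)
  moreover have "j powi (- (k - 2)) = j powi (- k) * j\<^sup>2"
  proof -
    have "j powi (- (k - 2)) = j powi (- k + 2)" by simp
    also have "\<dots> = j powi (- k) * j powi 2" using j by (subst power_int_add) auto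
    finally show ?thesis by simp
  qed
  ultimately show "automorphy B z powi (- (k - 2)) * coeff (Q (moebius B z)) 1 = poly (pderiv (Q z)) (cocycle B z)"
    by (simp add: j_def)
qed

lemma quasi_cong: "quasi k f Q \<Longrightarrow> (\<And>z. z \<in> \<H> \<Longrightarrow> f z = g z) \<Longrightarrow> quasi k g Q"
  unfolding quasi_def using moebius_in_H[OF det_G] by simp

lemma quasi_add: "quasi k f Q \<Longrightarrow> quasi k g R \<Longrightarrow> quasi k (\<lambda>z. f z + g z) (\<lambda>z. Q z + R z)"
proof -
  assume Q: "quasi k f Q" and R: "quasi k g R"
  then obtain p q where pq: "\<And>z. z \<in> \<H> \<Longrightarrow> degree (Q z) \<le> p" "\<And>z. z \<in> \<H> \<Longrightarrow> degree (R z) \<le> q"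
    unfolding quasi_def by blast
  have "degree (Q z + R z) \<le> max p q" if "z \<in> \<H>" for z
    using pq[OF that] by (intro degree_add_le) auto
  then show ?thesis unfolding quasi_def using quasi_eq[OF Q] quasi_eq[OF R]
    by (auto simp: distrib_left)
qed

lemma quasi_smult: "quasi k f Q \<Longrightarrow> quasi k (\<lambda>z. c * f z) (\<lambda>z. smult c (Q z))"
  unfolding quasi_def by (auto simp: mult.left_commute)

lemma quasi_mult:
  assumes Q: "quasi k f Q" and R: "quasi l g R"
  shows "quasi (k + l) (\<lambda>z. f z * g z) (\<lambda>z. Q z * R z)"
proof -
  obtain p q where pq: "\<And>z. z \<in> \<H> \<Longrightarrow> degree (Q z) \<le> p" "\<And>z. z \<in> \<H> \<Longrightarrow> degree (R z) \<le> q"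
    using Q R unfolding quasi_def by blast
  have "degree (Q z * R z) \<le> p + q" if "z \<in> \<H>" for z
    using pq[OF that] degree_mult_le[of "Q z" "R z"] by linarith
  moreover have "automorphy A z powi (- (k + l)) = automorphy A z powi (- k) * automorphy A z powi (- l)"
    if "A \<in> G" "z \<in> \<H>" for A z
    using automorphy_nonzero[OF det_G[OF that(1)] that(2)] by (simp add: power_int_add[symmetric])
  ultimately show ?thesis unfolding quasi_def using quasi_eq[OF Q] quasi_eq[OF R]
    by (auto simp: mult_ac)
qed

text \<open>
  At the infinitely many group elements with different cocycles the polynomial takes holomorphic values.
\<close>

lemma quasi_coeff_holomorphic:
  assumes Q: "quasi k f Q" and f: "f holomorphic_on \<H>"
  shows "(\<lambda>z. coeff (Q z) n) holomorphic_on \<H>"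
proof -
  obtain p where p: "\<And>z. z \<in> \<H> \<Longrightarrow> degree (Q z) \<le> p" using Q by (auto simp: quasi_def)
  obtain I where I: "I \<subseteq> G" "inj_on (\<lambda>A. cocycle A \<i>) I" "(\<lambda>A. cocycle A \<i>) ` I = (\<lambda>A. cocycle A \<i>) ` G"
    using subset_image_inj[of "(\<lambda>A. cocycle A \<i>) ` G" "\<lambda>A. cocycle A \<i>" G] by auto
  have "infinite I" using infinite_cocycle[OF i_in_H] I(3) finite_imageI by metis
  then show ?thesis
  proof (rule poly_family_holomorphic[where x = cocycle and p = p])
    fix A assume A: "A \<in> I"
    then have AG: "A \<in> G" using I by blast
    show "cocycle A holomorphic_on \<H>" by (rule cocycle_holomorphic[OF det_G[OF AG]])
    have "(\<lambda>z. automorphy A z powi (- k) * f (moebius A z)) holomorphic_on \<H>"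
      using automorphy_nonzero[OF det_G[OF AG]]
      by (intro holomorphic_intros automorphy_holomorphic comp_moebius_holomorphic det_G AG f) auto
    then show "(\<lambda>z. poly (Q z) (cocycle A z)) holomorphic_on \<H>"
      by (rule holomorphic_transform) (rule quasi_eq[OF Q AG])
  next
    fix A B z assume "A \<in> I" "B \<in> I" "A \<noteq> B" "z \<in> \<H>"
    then show "cocycle A z \<noteq> cocycle B z"
      using I cocycle_eq_iff[of A B z \<i>] det_G by (metis i_in_H inj_onD subsetD)
  qed (use p in auto)
qed

text \<open>
  Differentiate the transformation law, using that the derivative of the cocycle is minus its square and that
  the logarithmic derivative of \<open>c z + d\<close> is the cocycle.
\<close>

lemma quasi_deriv:
  assumes Q: "quasi k f Q" and f: "f holomorphic_on \<H>"
  obtains R where "quasi (k + 2) (deriv f) R" "\<And>z. z \<in> \<H> \<Longrightarrow> coeff (R z) 1 = deriv (\<lambda>z. coeff (Q z) 1) z + of_int k * f z"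
proof -
  obtain p where p: "\<And>z. z \<in> \<H> \<Longrightarrow> degree (Q z) \<le> p" using Q by (auto simp: quasi_def)
  define c where "c n z = coeff (Q z) n" for n z
  have c_hol: "c n holomorphic_on \<H>" for n unfolding c_def[abs_def] by (rule quasi_coeff_holomorphic[OF Q f])
  have c_der: "(c n has_field_derivative deriv (c n) z) (at z)" if "z \<in> \<H>" for n z
    using holomorphic_derivI[OF c_hol open_H that] .
  have Qsum: "Q z = (\<Sum>n\<le>p. monom (c n z) n)" if "z \<in> \<H>" for z
    unfolding c_def using poly_as_sum_of_monoms'[OF p[OF that]] by simp
  define Q1 where "Q1 z = (\<Sum>n\<le>p. monom (deriv (c n) z) n)" for z
  define R where "R z = Q1 z + [:0, of_int k:] * Q z - [:0, 0, 1:] * pderiv (Q z)" for z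
  have dQ1: "degree (Q1 z) \<le> p" for z
    unfolding Q1_def by (intro degree_sum_le) (auto intro: order_trans[OF degree_monom_le])
  have "quasi (k + 2) (deriv f) R"
    unfolding quasi_def
  proof (intro conjI exI[of _ "p + 2"] ballI)
    fix z assume z: "z \<in> \<H>"
    have "degree ([:0, of_int k:] * Q z) \<le> 1 + p"
      by (rule order_trans[OF degree_mult_le]) (use p[OF z] in \<open>simp add: add_mono\<close>)
    moreover have "degree ([:0, 0, 1:] * pderiv (Q z)) \<le> 2 + p"
      by (rule order_trans[OF degree_mult_le]) (use p[OF z] degree_pderiv[of "Q z"] in simp)
    ultimately show "degree (R z) \<le> p + 2" unfolding R_def using dQ1[of z]
      by (intro degree_diff_le degree_add_le) auto
  next
    fix A z assume A: "A \<in> G" and z: "z \<in> \<H>"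
    define j where "j = automorphy A z"
    have j: "j \<noteq> 0" unfolding j_def by (rule automorphy_nonzero[OF det_G[OF A] z])
    define X where "X = cocycle A z"
    have Xj: "X = of_real (A$2$1) / j" by (simp add: X_def j_def cocycle_def)
    have dX: "(cocycle A has_field_derivative - X\<^sup>2) (at z)"
    proof -
      have "((\<lambda>z. of_real (A$2$1) / automorphy A z) has_field_derivative - (of_real (A$2$1) * of_real (A$2$1)) / (j * j)) (at z)"
        using j unfolding j_def by (auto intro!: derivative_eq_intros automorphy_has_field_derivative)
      then show ?thesis unfolding Xj cocycle_def[abs_def] by (simp add: power2_eq_square)
    qed
    have fm: "((\<lambda>z. f (moebius A z)) has_field_derivative deriv f (moebius A z) * (1 / j\<^sup>2)) (at z)"
      unfolding j_def
      by (rule DERIV_chain2[OF holomorphic_derivI[OF f open_H moebius_in_H[OF det_G[OF A] z]] moebius_has_field_derivative[OF det_G[OF A] z]])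
    have jp: "((\<lambda>z. automorphy A z powi (- k)) has_field_derivative of_int (- k) * j powi (- k - 1) * of_real (A$2$1)) (at z)"
      unfolding j_def
      by (rule derivative_eq_intros automorphy_has_field_derivative refl | use j in \<open>simp add: j_def\<close>)+
    have lhs: "((\<lambda>z. automorphy A z powi (- k) * f (moebius A z)) has_field_derivative
        of_int (- k) * j powi (- k - 1) * of_real (A$2$1) * f (moebius A z) + deriv f (moebius A z) * (1 / j\<^sup>2) * j powi (- k)) (at z)"
      using DERIV_mult[OF jp fm] by (simp add: j_def)
    have rhs: "((\<lambda>z. \<Sum>n\<le>p. c n z * cocycle A z ^ n) has_field_derivative
        (\<Sum>n\<le>p. deriv (c n) z * X ^ n + of_nat n * X ^ (n - 1) * (- X\<^sup>2) * c n z)) (at z)"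
    proof (rule DERIV_sum)
      fix n
      have "((\<lambda>z. cocycle A z ^ n) has_field_derivative of_nat n * X ^ (n - 1) * (- X\<^sup>2)) (at z)"
        using DERIV_power[OF dX, of n] by (simp add: X_def mult_ac)
      from DERIV_mult[OF c_der[OF z, of n] this]
      show "((\<lambda>z. c n z * cocycle A z ^ n) has_field_derivative
          deriv (c n) z * X ^ n + of_nat n * X ^ (n - 1) * (- X\<^sup>2) * c n z) (at z)"
        by (simp add: X_def)
    qed
    have "((\<lambda>z. automorphy A z powi (- k) * f (moebius A z)) has_field_derivative
        (\<Sum>n\<le>p. deriv (c n) z * X ^ n + of_nat n * X ^ (n - 1) * (- X\<^sup>2) * c n z)) (at z)"
    proof (rule has_field_derivative_transform_within_open[OF rhs open_H z])
      fix w assume w: "w \<in> \<H>"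
      show "(\<Sum>n\<le>p. c n w * cocycle A w ^ n) = automorphy A w powi (- k) * f (moebius A w)"
        unfolding quasi_eq[OF Q A w] by (subst Qsum[OF w]) (simp add: poly_sum poly_monom)
    qed
    from DERIV_unique[OF lhs this]
    have main: "of_int (- k) * j powi (- k - 1) * of_real (A$2$1) * f (moebius A z) + deriv f (moebius A z) * (1 / j\<^sup>2) * j powi (- k)
      = (\<Sum>n\<le>p. deriv (c n) z * X ^ n + of_nat n * X ^ (n - 1) * (- X\<^sup>2) * c n z)" .
    have pdQ: "poly (pderiv (Q z)) X = (\<Sum>n\<le>p. of_nat n * c n z * X ^ (n - 1))"
      by (subst Qsum[OF z]) (simp add: higher_pderiv_sum[of 1, simplified] pderiv_monom poly_sum poly_monom)
    have Q1X: "poly (Q1 z) X = (\<Sum>n\<le>p. deriv (c n) z * X ^ n)"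
      by (simp add: Q1_def poly_sum poly_monom)
    have s: "(\<Sum>n\<le>p. deriv (c n) z * X ^ n + of_nat n * X ^ (n - 1) * (- X\<^sup>2) * c n z) = poly (Q1 z) X - X\<^sup>2 * poly (pderiv (Q z)) X"
      unfolding pdQ Q1X sum.distrib sum_distrib_left by (simp add: sum_negf[symmetric] mult_ac)
    have pw: "j powi (- k - 1) * of_real (A$2$1) = X * j powi (- k)"
      using j by (simp add: Xj power_int_diff)
    have "of_int (- k) * j powi (- k - 1) * of_real (A$2$1) * f (moebius A z) = - (of_int k * X * poly (Q z) X)"
      using quasi_eq[OF Q A z] pw unfolding j_def[symmetric] X_def[symmetric]
      by (metis (no_types, opaque_lifting) mult.assoc mult.commute mult_minus_left of_int_minus)
    moreover have "deriv f (moebius A z) * (1 / j\<^sup>2) * j powi (- k) = j powi (- (k + 2)) * deriv f (moebius A z)"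
      using j by (simp add: power_int_diff)
    ultimately have "j powi (- (k + 2)) * deriv f (moebius A z) = poly (Q1 z) X - X\<^sup>2 * poly (pderiv (Q z)) X + of_int k * X * poly (Q z) X"
      using main unfolding s by (simp add: algebra_simps)
    then show "automorphy A z powi (- (k + 2)) * deriv f (moebius A z) = poly (R z) (cocycle A z)"
      unfolding j_def[symmetric] X_def[symmetric] R_def by (simp add: power2_eq_square algebra_simps)
  qed
  moreover have "coeff (R z) 1 = deriv (\<lambda>z. coeff (Q z) 1) z + of_int k * f z" if z: "z \<in> \<H>" for z
  proof -
    have "coeff (Q1 z) 1 = deriv (c 1) z"
    proof (cases "p \<ge> 1")
      case True
      then show ?thesis unfolding Q1_def by (simp add: coeff_sum)
    next
      case False
      then have "c 1 w = 0" if "w \<in> \<H>" for w unfolding c_def using p[OF that] by (simp add: coeff_eq_0)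
      then have "(c 1 has_field_derivative 0) (at z)"
        by (intro has_field_derivative_transform_within_open[OF DERIV_const open_H z]) auto
      then have "deriv (c 1) z = 0" by (rule DERIV_imp_deriv)
      then show ?thesis using False unfolding Q1_def by (simp add: coeff_sum)
    qed
    then show ?thesis unfolding R_def using quasi_coeff_0[OF Q z]
      by (simp add: c_def[abs_def] coeff_pCons)
  qed
  ultimately show ?thesis by (rule that)
qed

end

section \<open>Modular and quasimodular forms and the lowering operator\<close>

lemma D_in_H: "z \<in> \<H> \<Longrightarrow> D f z = deriv f z" and D_off_H: "z \<notin> \<H> \<Longrightarrow> D f z = 0"
  by (simp_all add: D_def)

lemma D_holomorphic: "f holomorphic_on \<H> \<Longrightarrow> D f holomorphic_on \<H>"
  by (rule holomorphic_transform[OF holomorphic_deriv[OF _ open_H]]) (auto simp: D_in_H)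

lemma holomorphic_H_differentiable: "f holomorphic_on \<H> \<Longrightarrow> z \<in> \<H> \<Longrightarrow> f field_differentiable at z"
  using open_H holomorphic_on_imp_differentiable_at by blast

lemma D_add: "f holomorphic_on \<H> \<Longrightarrow> g holomorphic_on \<H> \<Longrightarrow> D (f + g) = D f + D g"
  by (auto simp: D_def fun_eq_iff plus_fun_def holomorphic_H_differentiable)

lemma D_scale: "f holomorphic_on \<H> \<Longrightarrow> D (\<lambda>z. c * f z) = (\<lambda>z. c * D f z)"
  by (auto simp: D_def fun_eq_iff holomorphic_H_differentiable)

lemma D_zero [simp]: "D 0 = 0"
  by (auto simp: D_def fun_eq_iff zero_fun_def)

lemma D_mult: "f holomorphic_on \<H> \<Longrightarrow> g holomorphic_on \<H> \<Longrightarrow> D (f * g) = D f * g + f * D g"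
  by (auto simp: D_def fun_eq_iff times_fun_def holomorphic_H_differentiable)

lemma D_pow_holomorphic: "f holomorphic_on \<H> \<Longrightarrow> (D ^^ n) f holomorphic_on \<H>"
  by (induction n) (auto intro: D_holomorphic)

lemma moderate_growth_base:
  assumes "z \<in> \<H>"
  shows "(1 + (norm z)\<^sup>2) / Im z \<ge> 1" "(1 + (norm z)\<^sup>2) / Im z \<ge> 1 / Im z"
proof -
  have y: "Im z > 0" using assms by (simp add: upper_half_plane_iff)
  have "0 \<le> (Im z - 1)\<^sup>2 + (Re z)\<^sup>2 + Im z" using y by simp
  then have "Im z \<le> 1 + (norm z)\<^sup>2" unfolding cmod_power2 by (simp add: power2_eq_square algebra_simps)
  then show "(1 + (norm z)\<^sup>2) / Im z \<ge> 1" using y by (simp add: le_divide_eq)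
  show "(1 + (norm z)\<^sup>2) / Im z \<ge> 1 / Im z" using y by (simp add: divide_right_mono)
qed

lemma moderate_growth_add:
  assumes "moderate_growth f" "moderate_growth g"
  shows "moderate_growth (f + g)"
proof -
  let ?b = "\<lambda>z. (1 + (norm z)\<^sup>2) / Im z"
  obtain N C where 1: "\<And>z. z \<in> \<H> \<Longrightarrow> norm (f z) \<le> C * ?b z ^ N" using assms(1) by (auto simp: moderate_growth_def)
  obtain M E where 2: "\<And>z. z \<in> \<H> \<Longrightarrow> norm (g z) \<le> E * ?b z ^ M" using assms(2) by (auto simp: moderate_growth_def)
  have "norm ((f + g) z) \<le> (\<bar>C\<bar> + \<bar>E\<bar>) * ?b z ^ (N + M)" if z: "z \<in> \<H>" for z
  proof -
    have b: "?b z \<ge> 1" by (rule moderate_growth_base(1)[OF z])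
    have "norm (f z) \<le> \<bar>C\<bar> * ?b z ^ (N + M)"
      using 1[OF z] b by (elim order_trans) (intro mult_mono power_increasing; simp)
    moreover have "norm (g z) \<le> \<bar>E\<bar> * ?b z ^ (N + M)"
      using 2[OF z] b by (elim order_trans) (intro mult_mono power_increasing; simp)
    ultimately show ?thesis
      using norm_triangle_ineq[of "f z" "g z"] by (simp add: distrib_right)
  qed
  then show ?thesis unfolding moderate_growth_def by blast
qed

lemma moderate_growth_scale:
  assumes "moderate_growth f"
  shows "moderate_growth (\<lambda>z. c * f z)"
proof -
  let ?b = "\<lambda>z. (1 + (norm z)\<^sup>2) / Im z"
  obtain N C where 1: "\<And>z. z \<in> \<H> \<Longrightarrow> norm (f z) \<le> C * ?b z ^ N" using assms(1) by (auto simp: moderate_growth_def)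
  have "norm (c * f z) \<le> (norm c * C) * ?b z ^ N" if z: "z \<in> \<H>" for z
    using mult_left_mono[OF 1[OF z], of "norm c"] by (simp add: norm_mult mult.assoc)
  then show ?thesis unfolding moderate_growth_def by blast
qed

lemma moderate_growth_zero: "moderate_growth 0"
  unfolding moderate_growth_def by (intro exI[of _ 0]) auto

text \<open>Cauchy's estimate on the disc of radius \<open>Im z / 2\<close>.\<close>

lemma moderate_growth_D:
  assumes f: "f holomorphic_on \<H>" and "moderate_growth f"
  shows "moderate_growth (D f)"
proof -
  let ?b = "\<lambda>z. (1 + (norm z)\<^sup>2) / Im z"
  obtain N C where 1: "\<And>z. z \<in> \<H> \<Longrightarrow> norm (f z) \<le> C * ?b z ^ N" using assms(2) by (auto simp: moderate_growth_def)
  have "norm (D f z) \<le> (2 * \<bar>C\<bar> * 5 ^ N) * ?b z ^ (Suc N)" if z: "z \<in> \<H>" for z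
  proof -
    have y: "Im z > 0" using z by (simp add: upper_half_plane_iff)
    define r where "r = Im z / 2"
    have r: "r > 0" using y by (simp add: r_def)
    have near: "Im w \<ge> r" "norm w \<le> 3 / 2 * norm z" if "norm (z - w) \<le> r" for w
    proof -
      have "\<bar>Im (z - w)\<bar> \<le> r" using abs_Im_le_cmod[of "z - w"] that by linarith
      then have "Im z - Im w \<le> r" by (simp add: abs_le_iff)
      then show "Im w \<ge> r" unfolding r_def by linarith
      have "norm w \<le> norm z + norm (z - w)" by (metis norm_minus_commute norm_triangle_sub)
      moreover have "Im z \<le> norm z" using abs_Im_le_cmod[of z] by linarith
      ultimately show "norm w \<le> 3 / 2 * norm z" using that by (simp add: r_def)
    qed
    then have sub: "cball z r \<subseteq> \<H>" using r by (force simp: upper_half_plane_iff dist_norm)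
    have B: "norm (f w) \<le> \<bar>C\<bar> * (5 * ?b z) ^ N" if w: "norm (z - w) = r" for w
    proof -
      have wr: "Im w \<ge> r" "norm w \<le> 3 / 2 * norm z" using near[of w] w by auto
      have wH: "w \<in> \<H>" using wr r by (simp add: upper_half_plane_iff)
      have "(norm w)\<^sup>2 \<le> (3 / 2 * norm z)\<^sup>2" using wr(2) by (intro power_mono) auto
      then have "(norm w)\<^sup>2 \<le> 9 / 4 * (norm z)\<^sup>2" by (simp add: power_mult_distrib power_divide)
      then have "1 + (norm w)\<^sup>2 \<le> 5 / 2 * (1 + (norm z)\<^sup>2)"
        using zero_le_power2[of "norm z"] unfolding distrib_left by linarith
      then have "?b w \<le> (5 / 2 * (1 + (norm z)\<^sup>2)) / r" using wr r by (intro frac_le) auto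
      also have "\<dots> = 5 * ?b z" using y by (simp add: r_def field_simps)
      finally have b: "?b w \<le> 5 * ?b z" .
      have "norm (f w) \<le> C * ?b w ^ N" by (rule 1[OF wH])
      also have "\<dots> \<le> \<bar>C\<bar> * (5 * ?b z) ^ N"
        using b moderate_growth_base(1)[OF wH] by (intro mult_mono power_mono) auto
      finally show ?thesis .
    qed
    have "norm ((deriv ^^ 1) f z) \<le> fact 1 * (\<bar>C\<bar> * (5 * ?b z) ^ N) / r ^ 1"
    proof (rule Cauchy_inequality[OF _ _ r B])
      show "f holomorphic_on ball z r" using f sub by (meson ball_subset_cball holomorphic_on_subset order_trans)
      show "continuous_on (cball z r) f" using f sub by (meson holomorphic_on_imp_continuous_on holomorphic_on_subset)
    qed
    moreover have b0: "0 \<le> 5 * ?b z" using moderate_growth_base(1)[OF z] by linarith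
    ultimately have "norm (D f z) \<le> (\<bar>C\<bar> * (5 * ?b z) ^ N) * 2 * (1 / Im z)"
      using z by (simp add: D_in_H r_def)
    also have "\<dots> \<le> (\<bar>C\<bar> * (5 * ?b z) ^ N) * 2 * ?b z"
      by (intro mult_left_mono mult_nonneg_nonneg zero_le_power moderate_growth_base(2)[OF z] b0) simp_all
    also have "\<dots> = (2 * \<bar>C\<bar> * 5 ^ N) * ?b z ^ (Suc N)"
      unfolding power_mult_distrib[of 5 "?b z" N] power_Suc by (simp only: mult_ac)
    finally show ?thesis .
  qed
  then show ?thesis unfolding moderate_growth_def by blast
qed

context cocompact_fuchsian
begin

text \<open>
  Over a cocompact group moderate growth follows from the transformation law, so this set and the next one are the spaces of
  all modular and quasimodular forms.
\<close>

definition MF :: "int \<Rightarrow> (complex \<Rightarrow> complex) set" where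
  "MF k = {f. (\<forall>z. z \<notin> \<H> \<longrightarrow> f z = 0) \<and> f holomorphic_on \<H> \<and>
     (\<forall>A\<in>G. \<forall>z\<in>\<H>. automorphy A z powi (- k) * f (moebius A z) = f z)}"

definition QF :: "int \<Rightarrow> (complex \<Rightarrow> complex) set" where
  "QF k = {f. (\<forall>z. z \<notin> \<H> \<longrightarrow> f z = 0) \<and> f holomorphic_on \<H> \<and> (\<exists>Q. quasi k f Q)}"

lemma MF_D: "f \<in> MF k \<Longrightarrow> z \<notin> \<H> \<Longrightarrow> f z = 0" "f \<in> MF k \<Longrightarrow> f holomorphic_on \<H>"
   "f \<in> MF k \<Longrightarrow> A \<in> G \<Longrightarrow> z \<in> \<H> \<Longrightarrow> automorphy A z powi (- k) * f (moebius A z) = f z"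
  by (auto simp: MF_def)

lemma QF_D: "f \<in> QF k \<Longrightarrow> z \<notin> \<H> \<Longrightarrow> f z = 0" "f \<in> QF k \<Longrightarrow> f holomorphic_on \<H>"
  by (auto simp: QF_def)

lemma QF_quasi: assumes "f \<in> QF k" obtains Q where "quasi k f Q"
  using assms by (auto simp: QF_def)

lemma quasi_const: "f \<in> MF k \<Longrightarrow> quasi k f (\<lambda>z. [:f z:])"
  by (auto simp: quasi_def MF_D(3))

lemma MF_subset_QF: "MF k \<subseteq> QF k"
  using quasi_const by (auto simp: QF_def MF_D)

lemma MF_transform:
  assumes "f \<in> MF k" "A \<in> G" "z \<in> \<H>"
  shows "f (moebius A z) = automorphy A z powi k * f z"
  using MF_D(3)[OF assms] automorphy_nonzero[OF det_G[OF assms(2)] assms(3)]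
  by (simp add: power_int_minus field_simps)

lemma subspace_MF: "form.subspace (MF k)"
  by (rule form.subspaceI)
     (auto simp: MF_def plus_fun_def zero_fun_def distrib_left mult.left_commute intro!: holomorphic_intros)

lemma subspace_QF: "form.subspace (QF k)"
proof (rule form.subspaceI)
  have "quasi k 0 (\<lambda>_. 0)" by (auto simp: quasi_def zero_fun_def)
  then show "0 \<in> QF k" by (auto simp: QF_def zero_fun_def)
next
  fix f g assume "f \<in> QF k" "g \<in> QF k"
  then show "f + g \<in> QF k"
    using quasi_add by (fastforce simp: QF_def plus_fun_def intro!: holomorphic_intros)
next
  fix c f assume "f \<in> QF k"
  then show "(\<lambda>z. c * f z) \<in> QF k"
    using quasi_smult by (fastforce simp: QF_def intro!: holomorphic_intros)
qed

lemma MF_mult: 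
  assumes "f \<in> MF k" "g \<in> MF l" shows "f * g \<in> MF (k + l)"
proof -
  have "automorphy A z powi (- (k + l)) * (f (moebius A z) * g (moebius A z)) = f z * g z" if "A \<in> G" "z \<in> \<H>" for A z
  proof -
    have "automorphy A z powi (- (k + l)) = automorphy A z powi (- k) * automorphy A z powi (- l)"
      using automorphy_nonzero[OF det_G[OF that(1)] that(2)] by (simp add: power_int_add[symmetric])
    then have "automorphy A z powi (- (k + l)) * (f (moebius A z) * g (moebius A z)) =
      (automorphy A z powi (- k) * f (moebius A z)) * (automorphy A z powi (- l) * g (moebius A z))"
      by (simp add: mult_ac)
    then show ?thesis using MF_D(3)[OF assms(1) that] MF_D(3)[OF assms(2) that] by simp
  qed
  then show ?thesis using assms by (auto simp: MF_def times_fun_def intro!: holomorphic_intros)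
qed

lemma QF_mult: 
  assumes "f \<in> QF k" "g \<in> QF l" shows "f * g \<in> QF (k + l)"
  using assms quasi_mult by (fastforce simp: QF_def times_fun_def intro!: holomorphic_intros)

lemma D_QF: assumes "f \<in> QF k" shows "D f \<in> QF (k + 2)"
proof -
  obtain Q where Q: "quasi k f Q" using assms by (rule QF_quasi)
  obtain R where "quasi (k + 2) (deriv f) R" using quasi_deriv[OF Q QF_D(2)[OF assms]] by blast
  then have "quasi (k + 2) (D f) R" by (rule quasi_cong) (simp add: D_in_H)
  then show ?thesis using D_holomorphic[OF QF_D(2)[OF assms]] by (auto simp: QF_def D_off_H)
qed

lemma D_pow_QF: "f \<in> QF k \<Longrightarrow> (D ^^ n) f \<in> QF (k + 2 * int n)"
proof (induction n)
  case (Suc n)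
  then have "D ((D ^^ n) f) \<in> QF ((k + 2 * int n) + 2)" by (intro D_QF)
  then show ?case by (simp add: algebra_simps)
qed simp

text \<open>
  The polynomial is unique, so the choice does not matter. The weight is an argument because a function alone does not
  determine it.
\<close>

definition lower :: "int \<Rightarrow> (complex \<Rightarrow> complex) \<Rightarrow> complex \<Rightarrow> complex" where
  "lower k f z = (if z \<in> \<H> then coeff ((SOME Q. quasi k f Q) z) 1 else 0)"

lemma lower_eq:
  assumes "quasi k f Q" "z \<in> \<H>"
  shows "lower k f z = coeff (Q z) 1"
proof -
  have "quasi k f (SOME Q. quasi k f Q)" by (rule someI[of "quasi k f", OF assms(1)])
  then show ?thesis using quasi_unique[OF _ assms] assms(2) by (simp add: lower_def)
qed

lemma lower_off_H: "z \<notin> \<H> \<Longrightarrow> lower k f z = 0"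
  by (simp add: lower_def)

lemma quasi_lower': "quasi k f Q \<Longrightarrow> quasi (k - 2) (lower k f) (\<lambda>z. pderiv (Q z))"
  by (rule quasi_cong[OF quasi_lower]) (simp_all add: lower_eq)

lemma lower_QF: assumes "f \<in> QF k" shows "lower k f \<in> QF (k - 2)"
proof -
  obtain Q where Q: "quasi k f Q" using assms by (rule QF_quasi)
  have "lower k f holomorphic_on \<H>"
    by (rule holomorphic_transform[OF quasi_coeff_holomorphic[OF Q QF_D(2)[OF assms], of 1]]) (simp add: lower_eq[OF Q])
  then show ?thesis using quasi_lower'[OF Q] by (auto simp: QF_def lower_off_H)
qed

lemma lower_add: assumes "f \<in> QF k" "g \<in> QF k" shows "lower k (f + g) = lower k f + lower k g"
proof
  fix z
  obtain Q where Q: "quasi k f Q" using assms(1) by (rule QF_quasi)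
  obtain R where R: "quasi k g R" using assms(2) by (rule QF_quasi)
  have "quasi k (f + g) (\<lambda>z. Q z + R z)" using quasi_add[OF Q R] by (simp add: plus_fun_def)
  then show "lower k (f + g) z = (lower k f + lower k g) z"
    using lower_eq[OF Q] lower_eq[OF R] by (cases "z \<in> \<H>") (simp_all add: lower_eq lower_off_H)
qed

lemma lower_scale: assumes "f \<in> QF k" shows "lower k (\<lambda>z. c * f z) = (\<lambda>z. c * lower k f z)"
proof
  fix z
  obtain Q where Q: "quasi k f Q" using assms(1) by (rule QF_quasi)
  show "lower k (\<lambda>z. c * f z) z = c * lower k f z"
    using lower_eq[OF Q] lower_eq[OF quasi_smult[OF Q]] by (cases "z \<in> \<H>") (simp_all add: lower_off_H)
qed

lemma lower_mult: assumes "f \<in> QF k" "g \<in> QF l" shows "lower (k + l) (f * g) = lower k f * g + f * lower l g"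
proof
  fix z
  obtain Q where Q: "quasi k f Q" using assms(1) by (rule QF_quasi)
  obtain R where R: "quasi l g R" using assms(2) by (rule QF_quasi)
  have "quasi (k + l) (f * g) (\<lambda>z. Q z * R z)" using quasi_mult[OF Q R] by (simp add: times_fun_def)
  moreover have "coeff (Q z * R z) 1 = coeff (Q z) 1 * coeff (R z) 0 + coeff (Q z) 0 * coeff (R z) 1"
    by (simp add: coeff_mult atMost_Suc add.commute)
  ultimately show "lower (k + l) (f * g) z = (lower k f * g + f * lower l g) z"
    using lower_eq[OF Q] lower_eq[OF R] quasi_coeff_0[OF Q] quasi_coeff_0[OF R]
    by (cases "z \<in> \<H>") (simp_all add: lower_eq lower_off_H)
qed

text \<open>
  The commutator relation: up to normalisation, lowering and \<open>D\<close> generate the action of \<open>sl\<^sub>2\<close> in which the weight is the third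
  element.
\<close>

lemma lower_D: assumes "f \<in> QF k" shows "lower (k + 2) (D f) = D (lower k f) + (\<lambda>z. of_int k * f z)"
proof
  fix z
  obtain Q where Q: "quasi k f Q" using assms by (rule QF_quasi)
  obtain R where R: "quasi (k + 2) (deriv f) R" "\<And>z. z \<in> \<H> \<Longrightarrow> coeff (R z) 1 = deriv (\<lambda>z. coeff (Q z) 1) z + of_int k * f z"
    using quasi_deriv[OF Q QF_D(2)[OF assms]] by blast
  have R': "quasi (k + 2) (D f) R" by (rule quasi_cong[OF R(1)]) (simp add: D_in_H)
  show "lower (k + 2) (D f) z = (D (lower k f) + (\<lambda>z. of_int k * f z)) z"
  proof (cases "z \<in> \<H>")
    case True
    have "deriv (lower k f) z = deriv (\<lambda>z. coeff (Q z) 1) z"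
      by (rule deriv_cong_ev[OF _ refl])
         (use eventually_nhds_in_open[OF open_H True] lower_eq[OF Q] in \<open>auto elim: eventually_mono\<close>)
    then show ?thesis using lower_eq[OF R' True] R(2)[OF True] True by (simp add: D_in_H)
  qed (simp add: lower_off_H D_off_H QF_D(1)[OF assms])
qed

lemma lower_MF: "f \<in> MF k \<Longrightarrow> lower k f = 0"
  using lower_eq[OF quasi_const] by (auto simp: fun_eq_iff lower_off_H coeff_pCons)
     (metis lower_off_H coeff_pCons_Suc coeff_0)

lemma MF_if_lower_0:
  assumes f: "f \<in> QF k" and z: "lower k f = 0"
  shows "f \<in> MF k"
proof -
  obtain Q where Q: "quasi k f Q" using f by (rule QF_quasi)
  have "quasi (k - 2) (lower k f) (\<lambda>_. 0)" unfolding z by (auto simp: quasi_def)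
  then have "pderiv (Q w) = 0" if "w \<in> \<H>" for w using quasi_unique[OF quasi_lower'[OF Q] _ that] by simp
  then have "Q w = [:f w:]" if "w \<in> \<H>" for w
    using quasi_coeff_0[OF Q that] that by (metis coeff_pCons_0 degree_eq_zeroE pderiv_eq_0_iff)
  then show ?thesis using QF_D[OF f] quasi_eq[OF Q] by (auto simp: MF_def)
qed

lemma MF_norm_invariant:
  assumes "f \<in> MF k" "A \<in> G" "z \<in> \<H>"
  shows "(cmod (f (moebius A z)))\<^sup>2 * Im (moebius A z) powi k = (cmod (f z))\<^sup>2 * Im z powi k"
proof -
  have j: "automorphy A z \<noteq> 0" by (rule automorphy_nonzero[OF det_G[OF assms(2)] assms(3)])
  have "(cmod (f (moebius A z)))\<^sup>2 * Im (moebius A z) powi k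
      = ((cmod (automorphy A z) powi k)\<^sup>2 * (cmod (f z))\<^sup>2) * (Im z powi k / ((cmod (automorphy A z))\<^sup>2) powi k)"
    unfolding MF_transform[OF assms] Im_moebius[OF det_G[OF assms(2)] assms(3)]
    by (simp add: norm_mult norm_power_int power_mult_distrib power_int_divide_distrib)
  also have "((cmod (automorphy A z))\<^sup>2) powi k = (cmod (automorphy A z) powi k)\<^sup>2"
    by (simp add: power2_eq_square power_int_mult_distrib)
  finally show ?thesis using j by (simp add: power_int_not_zero)
qed

text \<open>
  The function \<open>|f|\<^sup>2 (Im z)^k\<close> is invariant under the group, and a compact disc meets every orbit.
\<close>

lemma MF_attains_max:
  assumes "f \<in> MF k"
  obtains z where "z \<in> \<H>" "\<And>w. w \<in> \<H> \<Longrightarrow> (cmod (f w))\<^sup>2 * Im w powi k \<le> (cmod (f z))\<^sup>2 * Im z powi k"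
proof -
  obtain M where M: "\<And>z. z \<in> \<H> \<Longrightarrow> \<exists>A\<in>G. sig \<i> (moebius A z) \<le> M" using cocompact_G by blast
  have M': "\<exists>A\<in>G. moebius A z \<in> hyp_disc M" if z: "z \<in> \<H>" for z
    using M[OF z] moebius_in_H[OF det_G z] by (auto simp: hyp_disc_def)
  let ?g = "\<lambda>w. (cmod (f w))\<^sup>2 * Im w powi k"
  have ne: "hyp_disc M \<noteq> {}" using M'[OF i_in_H] by blast
  have cont: "continuous_on (hyp_disc M) ?g"
  proof (intro continuous_on_mult continuous_on_power continuous_on_norm continuous_on_power_int continuous_on_Im continuous_on_id)
    show "continuous_on (hyp_disc M) f"
      by (rule continuous_on_subset[OF holomorphic_on_imp_continuous_on[OF MF_D(2)[OF assms]] hyp_disc_subset])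
  qed (auto dest: hyp_disc_bounds(1))
  from continuous_attains_sup[OF compact_hyp_disc ne cont]
  obtain z where z: "z \<in> hyp_disc M" "\<And>w. w \<in> hyp_disc M \<Longrightarrow> ?g w \<le> ?g z" by blast
  show ?thesis
  proof (rule that)
    show "z \<in> \<H>" using z(1) hyp_disc_subset by blast
    fix w assume w: "w \<in> \<H>"
    obtain A where A: "A \<in> G" "moebius A w \<in> hyp_disc M" using M'[OF w] by blast
    show "?g w \<le> ?g z" using z(2)[OF A(2)] MF_norm_invariant[OF assms A(1) w] by simp
  qed
qed

lemma MF_weight_0:
  assumes f: "f \<in> MF 0"
  obtains c where "\<And>z. z \<in> \<H> \<Longrightarrow> f z = c"
proof -
  obtain z where z: "z \<in> \<H>" "\<And>w. w \<in> \<H> \<Longrightarrow> (cmod (f w))\<^sup>2 * Im w powi 0 \<le> (cmod (f z))\<^sup>2 * Im z powi 0"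
    using MF_attains_max[OF f] by blast
  have "f constant_on \<H>"
    by (rule maximum_modulus_principle[OF MF_D(2)[OF f] open_H convex_connected[OF convex_H] open_H subset_refl z(1)])
       (use z(2) in \<open>simp add: power2_le_iff_abs_le\<close>)
  then show ?thesis using that by (auto simp: constant_on_def)
qed

lemma MF_moderate_growth:
  assumes f: "f \<in> MF k" and k: "k \<ge> 0"
  shows "moderate_growth f"
proof -
  let ?b = "\<lambda>z. (1 + (norm z)\<^sup>2) / Im z"
  obtain z0 where z0: "\<And>w. w \<in> \<H> \<Longrightarrow> (cmod (f w))\<^sup>2 * Im w powi k \<le> (cmod (f z0))\<^sup>2 * Im z0 powi k" "z0 \<in> \<H>"
    using MF_attains_max[OF f] by blast
  define C where "C = (cmod (f z0))\<^sup>2 * Im z0 powi k"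
  have C: "C \<ge> 0" unfolding C_def using z0(2) by (simp add: upper_half_plane_iff)
  define n where "n = nat k"
  have kn: "k = int n" using k by (simp add: n_def)
  have "norm (f z) \<le> sqrt C * ?b z ^ n" if z: "z \<in> \<H>" for z
  proof (rule power2_le_imp_le)
    have y: "Im z > 0" using z by (simp add: upper_half_plane_iff)
    have b: "?b z \<ge> 1" "?b z \<ge> 1 / Im z" using moderate_growth_base[OF z] by auto
    have "(cmod (f z))\<^sup>2 \<le> C * (1 / Im z) ^ n"
      using z0(1)[OF z] y unfolding C_def[symmetric] unfolding kn by (simp add: power_divide le_divide_eq)
    also have "\<dots> \<le> C * ?b z ^ n" using C b y by (intro mult_left_mono power_mono) auto
    also have "\<dots> \<le> C * ?b z ^ (2 * n)" using C b by (intro mult_left_mono power_increasing) auto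
    also have "\<dots> = (sqrt C * ?b z ^ n)\<^sup>2" unfolding power_mult_distrib power_even_eq using C by simp
    finally show "(cmod (f z))\<^sup>2 \<le> (sqrt C * ?b z ^ n)\<^sup>2" .
    show "0 \<le> sqrt C * ?b z ^ n" using C b y by simp
  qed
  then show ?thesis unfolding moderate_growth_def by blast
qed

text \<open>
  The invariant function \<open>|f|\<^sup>2 (Im z)^k\<close> is bounded. For negative \<open>k\<close> this forces \<open>f\<close> to tend to zero
  at the real axis, so that its extension by zero to the lower half plane is entire.
\<close>

lemma MF_negative:
  assumes f: "f \<in> MF k" and k: "k < 0"
  shows "f = 0"
proof -
  obtain z0 where z0: "\<And>w. w \<in> \<H> \<Longrightarrow> (cmod (f w))\<^sup>2 * Im w powi k \<le> (cmod (f z0))\<^sup>2 * Im z0 powi k"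
    using MF_attains_max[OF f] by blast
  define C where "C = (cmod (f z0))\<^sup>2 * Im z0 powi k"
  define n where "n = nat (- k)"
  have kn: "k = - int n" "n > 0" using k by (auto simp: n_def)
  have bound: "(cmod (f z))\<^sup>2 \<le> C * Im z ^ n" if "z \<in> \<H>" for z
    using z0[OF that] that unfolding C_def[symmetric] unfolding kn
    by (simp add: power_int_minus upper_half_plane_iff field_simps)
  have "(cmod (f \<i>))\<^sup>2 \<le> C" using bound[OF i_in_H] by simp
  then have C: "C \<ge> 0" by (rule order_trans[OF zero_le_power2])
  have isC: "isCont f z" for z
  proof (cases "Im z = 0")
    case False
    show ?thesis
    proof (cases "z \<in> \<H>")
      case True
      then show ?thesis using holomorphic_on_imp_continuous_on[OF MF_D(2)[OF f]] open_H
        by (simp add: continuous_on_eq_continuous_at)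
    next
      case zn: False
      have o: "open {z. Im z < 0}" by (simp add: open_halfspace_Im_lt)
      have "\<forall>\<^sub>F w in nhds z. f w = 0"
        by (rule eventually_mono[OF eventually_nhds_in_open[OF o]])
           (use False zn MF_D(1)[OF f] in \<open>auto simp: upper_half_plane_iff\<close>)
      then show ?thesis by (subst isCont_cong[of _ "\<lambda>_. 0"]) auto
    qed
  next
    case True
    have fz: "f z = 0" using True MF_D(1)[OF f] by (simp add: upper_half_plane_iff)
    have "((\<lambda>w. sqrt (C * \<bar>Im w\<bar> ^ n)) \<longlongrightarrow> sqrt (C * \<bar>Im z\<bar> ^ n)) (at z)"
      by (intro tendsto_intros)
    then have lim: "((\<lambda>w. sqrt (C * \<bar>Im w\<bar> ^ n)) \<longlongrightarrow> 0) (at z)" using True kn(2) by (simp add: power_0_left)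
    have "norm (f w) \<le> sqrt (C * \<bar>Im w\<bar> ^ n)" for w
    proof (cases "w \<in> \<H>")
      case True
      then show ?thesis using bound[OF True] by (intro real_le_rsqrt) (simp add: upper_half_plane_iff)
    next
      case False
      then show ?thesis using C MF_D(1)[OF f] by simp
    qed
    then have "(f \<longlongrightarrow> 0) (at z)" by (intro Lim_null_comparison[OF _ lim] always_eventually allI)
    then show ?thesis by (simp add: isCont_def fz)
  qed
  have "f holomorphic_on UNIV"
  proof (rule holomorphic_on_paste_across_line[OF open_UNIV, of "\<i>" f 0])
    have "{z. \<i> \<bullet> z < 0} = {z. Im z < 0}" "{z. 0 < \<i> \<bullet> z} = \<H>"
      by (auto simp: upper_half_plane_def inner_complex_def)
    then show "f holomorphic_on UNIV \<inter> {z. \<i> \<bullet> z < 0}" "f holomorphic_on UNIV \<inter> {z. 0 < \<i> \<bullet> z}"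
      using MF_D[OF f] holomorphic_transform[OF holomorphic_on_const[of 0 "{z. Im z < 0}"], of f]
      by (auto simp: upper_half_plane_iff)
    show "continuous_on UNIV f" using isC by (simp add: continuous_on_eq_continuous_at)
  qed simp
  then have "f z = 0" for z
    by (rule analytic_continuation_open[of "{z. Im z < 0}" UNIV f "\<lambda>_. 0" z, rotated 5])
       (use MF_D(1)[OF f] in \<open>auto simp: open_halfspace_Im_lt upper_half_plane_iff intro: exI[of _ "- \<i>"]\<close>)
  then show ?thesis by (simp add: fun_eq_iff)
qed

end

section \<open>Structure of quasimodular forms\<close>

context cocompact_fuchsian
begin

lemma MF_QF: "f \<in> MF k \<Longrightarrow> f \<in> QF k"
  using MF_subset_QF by blast

lemma QF_zero: "0 \<in> QF k" and QF_add: "f \<in> QF k \<Longrightarrow> g \<in> QF k \<Longrightarrow> f + g \<in> QF k"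
  and QF_scale: "f \<in> QF k \<Longrightarrow> (\<lambda>z. c * f z) \<in> QF k"
  using form.subspace_0[OF subspace_QF] form.subspace_add[OF subspace_QF] form.subspace_scale[OF subspace_QF] by auto

lemma lower_0 [simp]: "lower k 0 = 0"
  using lower_scale[OF QF_zero, of k 0] by (simp add: zero_fun_def)

fun lowern :: "nat \<Rightarrow> int \<Rightarrow> (complex \<Rightarrow> complex) \<Rightarrow> complex \<Rightarrow> complex" where
  "lowern 0 k f = f"
| "lowern (Suc n) k f = lower (k - 2 * int n) (lowern n k f)"

lemma lowern_QF: "f \<in> QF k \<Longrightarrow> lowern n k f \<in> QF (k - 2 * int n)"
proof (induction n)
  case (Suc n)
  then have "lower (k - 2 * int n) (lowern n k f) \<in> QF (k - 2 * int n - 2)" by (intro lower_QF)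
  then show ?case by (simp add: algebra_simps)
qed simp

lemma lowern_add: "f \<in> QF k \<Longrightarrow> g \<in> QF k \<Longrightarrow> lowern n k (f + g) = lowern n k f + lowern n k g"
  by (induction n) (simp_all add: lower_add lowern_QF)

lemma lowern_scale: "f \<in> QF k \<Longrightarrow> lowern n k (\<lambda>z. c * f z) = (\<lambda>z. c * lowern n k f z)"
  by (induction n) (simp_all add: lower_scale lowern_QF)

lemma lowern_0 [simp]: "lowern n k 0 = 0"
  by (induction n) (simp_all only: lowern.simps lower_0)

lemma lower_D_pow:
  assumes B: "B \<in> MF l"
  shows "lower (l + 2 * int j) ((D ^^ j) B) = (\<lambda>z. (of_nat j * of_int (l + int j - 1)) * (D ^^ (j - 1)) B z)"
proof (induction j)
  case 0
  then show ?case using lower_MF[OF B] by (simp add: zero_fun_def)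
next
  case (Suc j)
  have q: "(D ^^ j) B \<in> QF (l + 2 * int j)" using D_pow_QF[OF MF_QF[OF B]] .
  have h: "(D ^^ (j - 1)) B holomorphic_on \<H>" by (rule D_pow_holomorphic[OF MF_D(2)[OF B]])
  have "lower (l + 2 * int (Suc j)) ((D ^^ Suc j) B) = lower (l + 2 * int j + 2) (D ((D ^^ j) B))"
    by (simp add: algebra_simps)
  also have "\<dots> = D (\<lambda>z. (of_nat j * of_int (l + int j - 1)) * (D ^^ (j - 1)) B z) + (\<lambda>z. of_int (l + 2 * int j) * (D ^^ j) B z)"
    unfolding lower_D[OF q] Suc.IH ..
  also have "D (\<lambda>z. (of_nat j * of_int (l + int j - 1)) * (D ^^ (j - 1)) B z) = (\<lambda>z. (of_nat j * of_int (l + int j - 1)) * (D ^^ j) B z)"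
    unfolding D_scale[OF h] by (cases j) (auto simp: fun_eq_iff)
  finally show ?case by (simp add: fun_eq_iff algebra_simps)
qed

lemma lowern_D_pow:
  assumes B: "B \<in> MF l"
  shows "n \<le> j \<Longrightarrow> lowern n (l + 2 * int j) ((D ^^ j) B) =
    (\<lambda>z. (\<Prod>i<n. of_nat (j - i) * of_int (l + int (j - i) - 1)) * (D ^^ (j - n)) B z)"
proof (induction n)
  case (Suc n)
  let ?c = "\<Prod>i<n. of_nat (j - i) * complex_of_int (l + int (j - i) - 1)"
  have w: "l + 2 * int j - 2 * int n = l + 2 * int (j - n)" using Suc.prems by simp
  have "lowern (Suc n) (l + 2 * int j) ((D ^^ j) B) = lower (l + 2 * int (j - n)) (\<lambda>z. ?c * (D ^^ (j - n)) B z)"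
    using Suc.IH Suc.prems unfolding lowern.simps(2) w by simp
  also have "\<dots> = (\<lambda>z. ?c * ((of_nat (j - n) * of_int (l + int (j - n) - 1)) * (D ^^ (j - n - 1)) B z))"
    unfolding lower_scale[OF D_pow_QF[OF MF_QF[OF B]]] lower_D_pow[OF B] ..
  finally have *: "lowern (Suc n) (l + 2 * int j) ((D ^^ j) B) =
      (\<lambda>z. ?c * ((of_nat (j - n) * of_int (l + int (j - n) - 1)) * (D ^^ (j - n - 1)) B z))" .
  have e: "j - n - 1 = j - Suc n" by simp
  show ?case unfolding * e prod.lessThan_Suc by (simp only: mult.assoc)
qed simp

text \<open>
  Each lowering of a derivative of \<open>B\<close> contributes the number of remaining derivatives times a weight, and these factors
  are nonzero for positive weight.
\<close>

lemma lowern_top: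
  assumes B: "B \<in> MF l" and l: "l > 0"
  obtains c where "c \<noteq> 0" "lowern j (l + 2 * int j) ((D ^^ j) B) = (\<lambda>z. c * B z)"
proof
  show "(\<Prod>i<j. of_nat (j - i) * complex_of_int (l + int (j - i) - 1)) \<noteq> 0"
  proof -
    have "complex_of_int (l + int (j - i) - 1) \<noteq> 0" if "i < j" for i
    proof -
      have "l + int (j - i) - 1 > 0" using that l by linarith
      then show ?thesis unfolding of_int_eq_0_iff by linarith
    qed
    then show ?thesis by (auto simp: prod_zero_iff)
  qed
qed (use lowern_D_pow[OF B order_refl] in simp)

lemma lowern_above:
  assumes B: "B \<in> MF l" and n: "j < n"
  shows "lowern n (l + 2 * int j) ((D ^^ j) B) = 0"
proof -
  obtain m where m: "n = m + Suc j" using less_imp_Suc_add[OF n] by auto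
  have "lowern (Suc j) (l + 2 * int j) ((D ^^ j) B) = 0"
    using lowern_D_pow[OF B order_refl, of j] lower_scale[OF MF_QF[OF B]] lower_MF[OF B]
    by (simp add: zero_fun_def)
  then have "lowern (m + Suc j) (l + 2 * int j) ((D ^^ j) B) = 0"
    by (induction m) (simp_all only: add_0 add_Suc lowern.simps(2) lower_0)
  then show ?thesis using m by simp
qed

lemma lowern_eventually_0:
  assumes f: "f \<in> QF k"
  obtains p where "lowern (Suc p) k f = 0"
proof -
  obtain Q where Q: "quasi k f Q" using f by (rule QF_quasi)
  obtain p where p: "\<And>z. z \<in> \<H> \<Longrightarrow> degree (Q z) \<le> p" using Q by (auto simp: quasi_def)
  have q: "quasi (k - 2 * int n) (lowern n k f) (\<lambda>z. (pderiv ^^ n) (Q z))" for n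
  proof (induction n)
    case (Suc n)
    from quasi_lower'[OF this] show ?case by (simp add: algebra_simps)
  qed (simp add: Q)
  have d: "degree ((pderiv ^^ n) R) \<le> degree R - n" for n and R :: "complex poly"
    by (induction n) (auto simp: degree_pderiv)
  have "lowern (Suc p) k f z = 0" for z
  proof (cases "z \<in> \<H>")
    case True
    have "degree ((pderiv ^^ p) (Q z)) = 0" using d[of p "Q z"] p[OF True] by simp
    then have "pderiv ((pderiv ^^ p) (Q z)) = 0" by (simp add: pderiv_eq_0_iff)
    then have "coeff ((pderiv ^^ Suc p) (Q z)) 0 = 0" by simp
    then show ?thesis using quasi_coeff_0[OF q True, of "Suc p"] by simp
  qed (use lower_off_H in simp)
  then show ?thesis using that[of p] by (simp add: fun_eq_iff)
qed

text \<open>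
  Derivatives are restricted to forms of positive weight. This loses nothing, since forms of weight zero
  are constant, and it makes the number of derivatives recoverable by lowering.
\<close>

definition DM :: "int \<Rightarrow> (complex \<Rightarrow> complex) set" where
  "DM k = {(D ^^ j) B | j B. B \<in> MF (k - 2 * int j) \<and> (j = 0 \<or> 2 * int j < k)}"

text \<open>
  Induction on the depth. The last nonzero lowering \<open>g\<close> of \<open>f\<close> is modular. If its weight is positive, a multiple of
  a derivative of \<open>g\<close> has the same last lowering, and subtracting it reduces the depth. A negative weight is
  impossible. If the weight is zero, \<open>g\<close> is a constant, and the lowering before it is a weight-two form
  excluded by \<open>no_weight_2_quasi\<close>.
\<close>

lemma QF_subset_span_DM:
  assumes "f \<in> QF k"
  shows "f \<in> form.span (DM k)"
proof -
  have "f \<in> form.span (DM k)" if "f \<in> QF k" "lowern (Suc p) k f = 0" for p f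
    using that
  proof (induction p arbitrary: f)
    case 0
    then have "f \<in> MF k" by (intro MF_if_lower_0) auto
    then have "(D ^^ 0) f \<in> DM k" unfolding DM_def by force
    then show ?case by (intro form.span_base) simp
  next
    case (Suc p)
    define g where "g = lowern (Suc p) k f"
    define l where "l = k - 2 * int (Suc p)"
    have gQ: "g \<in> QF l" unfolding g_def l_def by (rule lowern_QF[OF Suc.prems(1)])
    have g: "g \<in> MF l"
      by (rule MF_if_lower_0[OF gQ]) (use Suc.prems(2) in \<open>simp only: lowern.simps(2)[of "Suc p"] g_def l_def\<close>)
    consider "l < 0" | "l = 0" | "l > 0" by linarith
    then show ?case
    proof cases
      case 1
      then have "lowern (Suc p) k f = 0" using MF_negative[OF g] by (simp add: g_def)
      then show ?thesis by (rule Suc.IH[OF Suc.prems(1)])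
    next
      case 2
      define h where "h = lowern p k f"
      have w: "k - 2 * int p = 2" using 2 by (simp add: l_def)
      have hQ: "h \<in> QF 2" using lowern_QF[OF Suc.prems(1), of p] unfolding w h_def .
      have gh: "g = lower 2 h" unfolding g_def h_def lowern.simps(2) w ..
      obtain c where c: "\<And>z. z \<in> \<H> \<Longrightarrow> g z = c" using MF_weight_0 g 2 by metis
      obtain Q where Q: "quasi 2 h Q" using hQ by (rule QF_quasi)
      have qg: "quasi 0 g (\<lambda>z. pderiv (Q z))" using quasi_lower'[OF Q] unfolding gh by simp
      have g0: "g \<in> MF 0" using g 2 by simp
      have Qz: "Q z = [:h z, c:]" if z: "z \<in> \<H>" for z
      proof -
        have "pderiv (Q z) = [:c:]" using quasi_unique[OF qg quasi_const[OF g0] z] c[OF z] by simp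
        then have "pderiv (Q z - [:h z, c:]) = 0" by (simp add: pderiv_diff pderiv_pCons)
        then obtain a where a: "Q z - [:h z, c:] = [:a:]" unfolding pderiv_eq_0_iff by (rule degree_eq_zeroE)
        moreover have "a = 0" using arg_cong[OF a, of "\<lambda>q. coeff q 0"] quasi_coeff_0[OF Q z] by simp
        ultimately show ?thesis by simp
      qed
      have "c = 0"
      proof (rule no_weight_2_quasi[OF QF_D(2)[OF hQ]])
        fix A z assume A: "A \<in> G" and z: "z \<in> \<H>"
        show "h (moebius A z) / (automorphy A z)\<^sup>2 = h z + c * cocycle A z"
          using quasi_eq[OF Q A z] Qz[OF z] by (simp add: power_int_minus divide_inverse mult.commute)
      qed
      then have "g = 0" using c MF_D(1)[OF g] by (force simp: fun_eq_iff)
      then have "lowern (Suc p) k f = 0" by (simp add: g_def)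
      then show ?thesis by (rule Suc.IH[OF Suc.prems(1)])
    next
      case 3
      have w: "l + 2 * int (Suc p) = k" by (simp add: l_def)
      obtain c where c: "c \<noteq> 0" "lowern (Suc p) k ((D ^^ Suc p) g) = (\<lambda>z. c * g z)"
        using lowern_top[OF g 3, of "Suc p"] unfolding w by blast
      define e where "e = (\<lambda>z. (- 1 / c) * (D ^^ Suc p) g z)"
      have Dg: "(D ^^ Suc p) g \<in> QF k" using D_pow_QF[OF gQ, of "Suc p"] unfolding w .
      have eQ: "e \<in> QF k" unfolding e_def by (rule QF_scale[OF Dg])
      have "lowern (Suc p) k (f + e) = g + (\<lambda>z. (- 1 / c) * (c * g z))"
        unfolding lowern_add[OF Suc.prems(1) eQ] unfolding e_def unfolding lowern_scale[OF Dg] unfolding c(2) unfolding g_def ..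
      also have "\<dots> = 0" using c(1) by (simp add: fun_eq_iff)
      finally have "f + e \<in> form.span (DM k)" by (rule Suc.IH[OF QF_add[OF Suc.prems(1) eQ]])
      moreover have "(D ^^ Suc p) g \<in> DM k"
        unfolding DM_def using g 3 unfolding l_def by (intro CollectI exI[of _ "Suc p"] exI[of _ g]) auto
      then have "e \<in> form.span (DM k)" unfolding e_def by (intro form.span_scale form.span_base)
      ultimately have "(f + e) - e \<in> form.span (DM k)" by (rule form.span_diff)
      then show ?thesis by simp
    qed
  qed
  moreover obtain p where "lowern (Suc p) k f = 0" using lowern_eventually_0[OF assms] .
  ultimately show ?thesis using assms by blast
qed

lemma QF_low_weight:
  assumes "k \<le> 2"
  shows "QF k = MF k"
proof
  have "DM k \<subseteq> MF k"
  proof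
    fix x assume "x \<in> DM k"
    then obtain j B where x: "x = (D ^^ j) B" "B \<in> MF (k - 2 * int j)" "j = 0 \<or> 2 * int j < k"
      unfolding DM_def by blast
    then have "j = 0" using assms by linarith
    then show "x \<in> MF k" using x by simp
  qed
  then have "form.span (DM k) \<subseteq> MF k" by (rule form.span_minimal[OF _ subspace_MF])
  then show "QF k \<subseteq> MF k" using QF_subset_span_DM by blast
qed (rule MF_subset_QF)

lemma QF_moderate_growth:
  assumes "f \<in> QF k"
  shows "moderate_growth f"
proof -
  have "DM k \<subseteq> {f. moderate_growth f}"
  proof
    fix x assume "x \<in> DM k"
    then obtain j B where x: "x = (D ^^ j) B" and B: "B \<in> MF (k - 2 * int j)" and j: "j = 0 \<or> 2 * int j < k"
      by (auto simp: DM_def)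
    have "moderate_growth B"
    proof (cases "k - 2 * int j \<ge> 0")
      case True
      then show ?thesis by (rule MF_moderate_growth[OF B])
    next
      case False
      then show ?thesis using MF_negative[OF B] moderate_growth_zero by simp
    qed
    then have "moderate_growth ((D ^^ j) B)"
      by (induction j) (auto intro: moderate_growth_D D_pow_holomorphic MF_D(2)[OF B])
    then show "x \<in> {f. moderate_growth f}" using x by simp
  qed
  moreover have "form.subspace {f. moderate_growth f}"
    by (rule form.subspaceI) (auto intro: moderate_growth_zero moderate_growth_add moderate_growth_scale)
  ultimately have "form.span (DM k) \<subseteq> {f. moderate_growth f}" by (rule form.span_minimal)
  then show ?thesis using QF_subset_span_DM[OF assms] by blast
qed

end

section \<open>Divisibility of modular forms\<close>

text \<open>
  More unknowns than equations.
\<close>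

lemma homogeneous_system:
  fixes a :: "'i \<Rightarrow> 'j \<Rightarrow> 'a::field"
  assumes "finite I" "finite J" "card I < card J"
  shows "\<exists>c. (\<exists>j\<in>J. c j \<noteq> 0) \<and> (\<forall>i\<in>I. (\<Sum>j\<in>J. c j * a i j) = 0)"
  using assms
proof (induction I arbitrary: J a rule: finite_induct)
  case empty
  then have "J \<noteq> {}" by auto
  then show ?case by (intro exI[of _ "\<lambda>_. 1"]) auto
next
  case (insert i0 I)
  show ?case
  proof (cases "\<forall>j\<in>J. a i0 j = 0")
    case True
    have "card I < card J" using insert by simp
    from insert.IH[OF insert.prems(1) this, of a] True show ?thesis by auto
  next
    case False
    then obtain k where k: "k \<in> J" "a i0 k \<noteq> 0" by blast
    define b where "b i j = a i j - a i k * (a i0 j / a i0 k)" for i j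
    have "card I < card (J - {k})" using insert k by simp
    then obtain c where c: "\<exists>j\<in>J - {k}. c j \<noteq> 0" "\<And>i. i \<in> I \<Longrightarrow> (\<Sum>j\<in>J - {k}. c j * b i j) = 0"
      using insert.IH[of "J - {k}" b] insert.prems(1) by auto
    define s where "s = (\<Sum>j\<in>J - {k}. c j * (a i0 j / a i0 k))"
    define e where "e j = (if j = k then - s else c j)" for j
    have e: "(\<Sum>j\<in>J. e j * a i j) = (\<Sum>j\<in>J - {k}. c j * a i j) - s * a i k" for i
    proof -
      have "(\<Sum>j\<in>J. e j * a i j) = e k * a i k + (\<Sum>j\<in>J - {k}. e j * a i j)"
        using insert.prems(1) k(1) by (simp add: sum.remove)
      also have "(\<Sum>j\<in>J - {k}. e j * a i j) = (\<Sum>j\<in>J - {k}. c j * a i j)"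
        by (intro sum.cong) (auto simp: e_def)
      finally show ?thesis by (simp add: e_def)
    qed
    have "(\<Sum>j\<in>J. e j * a i j) = 0" if "i \<in> insert i0 I" for i
    proof (cases "i = i0")
      case True
      have "s * a i0 k = (\<Sum>j\<in>J - {k}. c j * a i0 j)" using k(2) by (simp add: s_def sum_distrib_right)
      then show ?thesis unfolding e True by simp
    next
      case False
      then have "i \<in> I" using that by simp
      from c(2)[OF this] have "(\<Sum>j\<in>J - {k}. c j * a i j) - s * a i k = 0"
        by (simp add: b_def s_def right_diff_distrib sum_subtractf sum_distrib_left sum_distrib_right mult_ac)
      then show ?thesis unfolding e .
    qed
    moreover have "\<exists>j\<in>J. e j \<noteq> 0" using c(1) by (auto simp: e_def)
    ultimately show ?thesis by blast
  qed
qed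

text \<open>
  Iterated at the same base point, this shifts the Taylor expansion. Its values express the order of vanishing at \<open>a\<close>
  by linear conditions, without mention of factorials.
\<close>

definition diff_quot :: "complex \<Rightarrow> (complex \<Rightarrow> complex) \<Rightarrow> complex \<Rightarrow> complex" where
  "diff_quot a h w = (if w = a then deriv h a else (h w - h a) / (w - a))"

lemma diff_quot_at: "diff_quot a h a = deriv h a"
  and diff_quot_off: "w \<noteq> a \<Longrightarrow> diff_quot a h w = (h w - h a) / (w - a)"
  by (simp_all add: diff_quot_def)

lemma diff_quot_holomorphic: "h holomorphic_on \<H> \<Longrightarrow> diff_quot a h holomorphic_on \<H>"
  unfolding diff_quot_def[abs_def] by (rule pole_lemma_open[OF _ open_H])

lemma diff_quot_pow_holomorphic: "h holomorphic_on \<H> \<Longrightarrow> (diff_quot a ^^ n) h holomorphic_on \<H>"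
  by (induction n) (auto intro: diff_quot_holomorphic)

lemma diff_quot_pow_linear:
  assumes "finite J" "\<And>j. j \<in> J \<Longrightarrow> h j holomorphic_on \<H>" and a: "a \<in> \<H>"
  shows "(diff_quot a ^^ n) (\<lambda>w. \<Sum>j\<in>J. c j * h j w) = (\<lambda>w. \<Sum>j\<in>J. c j * (diff_quot a ^^ n) (h j) w)"
proof (induction n)
  case (Suc n)
  have d: "(diff_quot a ^^ n) (h j) field_differentiable at a" if "j \<in> J" for j
    by (rule holomorphic_H_differentiable[OF diff_quot_pow_holomorphic[OF assms(2)[OF that]] a])
  have "deriv (\<lambda>w. \<Sum>j\<in>J. c j * (diff_quot a ^^ n) (h j) w) a = (\<Sum>j\<in>J. c j * deriv ((diff_quot a ^^ n) (h j)) a)"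
    by (rule DERIV_imp_deriv, rule DERIV_sum, rule DERIV_cmult) (use d DERIV_deriv_iff_field_differentiable in blast)
  note der = this
  show ?case
  proof
    fix w
    show "(diff_quot a ^^ Suc n) (\<lambda>w. \<Sum>j\<in>J. c j * h j w) w = (\<Sum>j\<in>J. c j * (diff_quot a ^^ Suc n) (h j) w)"
    proof (cases "w = a")
      case True
      show ?thesis unfolding funpow.simps o_def Suc.IH True diff_quot_at der ..
    next
      case False
      then show ?thesis unfolding funpow.simps o_def Suc.IH diff_quot_off[OF False]
        by (simp only: sum_subtractf[symmetric] sum_divide_distrib right_diff_distrib times_divide_eq_right)
    qed
  qed
qed simp

lemma diff_quot_factor:
  assumes "\<And>i. i < n \<Longrightarrow> (diff_quot a ^^ i) h a = 0"
  shows "h w = (w - a) ^ n * (diff_quot a ^^ n) h w"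
  using assms
proof (induction n)
  case (Suc n)
  have "(diff_quot a ^^ n) h w = (w - a) * (diff_quot a ^^ Suc n) h w"
    using Suc.prems[of n] unfolding funpow.simps o_def by (cases "w = a") (simp_all add: diff_quot_off)
  then show ?case using Suc.IH Suc.prems by simp
qed simp

definition locally_divides :: "(complex \<Rightarrow> complex) \<Rightarrow> (complex \<Rightarrow> complex) \<Rightarrow> complex \<Rightarrow> bool" where
  "locally_divides f h z \<longleftrightarrow>
     (\<exists>r>0. \<exists>p. ball z r \<subseteq> \<H> \<and> p holomorphic_on ball z r \<and> (\<forall>w\<in>ball z r. h w = f w * p w))"

lemma local_factor:
  assumes f: "f holomorphic_on \<H>" and nz: "\<exists>z\<in>\<H>. f z \<noteq> 0" and z: "z \<in> \<H>"
  obtains n r u where "r > 0" "ball z r \<subseteq> \<H>" "u holomorphic_on ball z r"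
    "\<And>w. w \<in> ball z r \<Longrightarrow> u w \<noteq> 0" "\<And>w. w \<in> ball z r \<Longrightarrow> f w = (w - z) ^ n * u w"
proof (cases "f z = 0")
  case False
  have "open (\<H> \<inter> f -` (- {0}))"
    by (rule continuous_open_preimage[OF holomorphic_on_imp_continuous_on[OF f] open_H]) auto
  moreover have "z \<in> \<H> \<inter> f -` (- {0})" using z False by simp
  ultimately obtain r where r: "r > 0" "ball z r \<subseteq> \<H> \<inter> f -` (- {0})" by (meson openE)
  show ?thesis
    by (rule that[of r f 0]) (use r f in \<open>auto intro: holomorphic_on_subset\<close>)
next
  case True
  have "\<not> f constant_on \<H>" using True nz z unfolding constant_on_def by metis
  show ?thesis
  proof (rule holomorphic_factor_zero_nonconstant[OF f open_H convex_connected[OF convex_H] z True \<open>\<not> f constant_on \<H>\<close>])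
    fix g r and n :: nat
    assume "0 < r" "ball z r \<subseteq> \<H>" "g holomorphic_on ball z r"
      and "\<And>w. w \<in> ball z r \<Longrightarrow> f w = (w - z) ^ n * g w" "\<And>w. w \<in> ball z r \<Longrightarrow> g w \<noteq> 0"
    then show ?thesis by (intro that[of r g n])
  qed
qed

lemma eventually_nonzero:
  assumes f: "f holomorphic_on \<H>" and nz: "\<exists>z\<in>\<H>. f z \<noteq> 0" and z: "z \<in> \<H>"
  shows "\<forall>\<^sub>F w in at z. f w \<noteq> 0"
proof -
  obtain n r u where u: "r > 0" "ball z r \<subseteq> \<H>" "u holomorphic_on ball z r"
    "\<And>w. w \<in> ball z r \<Longrightarrow> u w \<noteq> 0" "\<And>w. w \<in> ball z r \<Longrightarrow> f w = (w - z) ^ n * u w"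
    by (rule local_factor[OF assms]) (rule that)
  show ?thesis unfolding eventually_at
    by (intro exI[of _ r]) (use u in \<open>auto simp: dist_commute\<close>)
qed

lemma holomorphic_cancel:
  assumes f: "f holomorphic_on \<H>" and nz: "\<exists>z\<in>\<H>. f z \<noteq> 0"
    and g: "g holomorphic_on \<H>" and eq: "\<And>z. z \<in> \<H> \<Longrightarrow> f z * g z = 0" and z: "z \<in> \<H>"
  shows "g z = 0"
proof -
  have "(g \<longlongrightarrow> g z) (at z)"
    using holomorphic_on_imp_continuous_on[OF g] z open_H by (simp add: continuous_on_eq_continuous_at isCont_def)
  moreover have "\<forall>\<^sub>F w in at z. g w = 0"
    using eventually_nonzero[OF f nz z] eventually_at_in_open'[OF open_H z]
    by eventually_elim (use eq in force)
  then have "(g \<longlongrightarrow> 0) (at z)" by (rule tendsto_eventually)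
  ultimately show ?thesis by (rule tendsto_unique[OF at_neq_bot])
qed

text \<open>
  Local quotients are unique, since a nonzero holomorphic function is nonzero on a dense set; hence they fit together.
\<close>

lemma global_quotient:
  assumes f: "f holomorphic_on \<H>" and nz: "\<exists>z\<in>\<H>. f z \<noteq> 0"
    and loc: "\<And>z. z \<in> \<H> \<Longrightarrow> locally_divides f h z"
  obtains q where "q holomorphic_on \<H>" "\<And>z. z \<in> \<H> \<Longrightarrow> h z = f z * q z"
proof
  let ?q = "remove_sings (\<lambda>w. h w / f w)"
  have *: "\<exists>r>0. \<exists>p. ball z r \<subseteq> \<H> \<and> p holomorphic_on ball z r \<and> (\<forall>w\<in>ball z r. h w = f w * p w \<and> ?q w = p w)"
    if z: "z \<in> \<H>" for z
  proof -
    obtain r p where r: "r > 0" "ball z r \<subseteq> \<H>" and p: "p holomorphic_on ball z r" "\<And>w. w \<in> ball z r \<Longrightarrow> h w = f w * p w"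
      using loc[OF z] unfolding locally_divides_def by blast
    have "?q w = p w" if w: "w \<in> ball z r" for w
    proof (rule remove_sings_eqI)
      have wH: "w \<in> \<H>" using w r by blast
      have ev: "\<forall>\<^sub>F v in at w. p v = h v / f v"
        using eventually_nonzero[OF f nz wH] eventually_at_in_open'[OF open_ball w]
        by eventually_elim (use p(2) in simp)
      have "isCont p w"
        using holomorphic_on_imp_continuous_on[OF p(1)] w by (simp add: continuous_on_eq_continuous_at)
      then have "(p \<longlongrightarrow> p w) (at w)" by (simp add: isCont_def)
      then show "((\<lambda>w. h w / f w) \<longlongrightarrow> p w) (at w)" by (rule Lim_transform_eventually[OF _ ev])
    qed
    then show ?thesis using r p by blast
  qed
  show "?q holomorphic_on \<H>"
    unfolding holomorphic_on_open[OF open_H]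
  proof
    fix z assume "z \<in> \<H>"
    from *[OF this] obtain r p where r: "r > 0" and p: "p holomorphic_on ball z r" "\<And>w. w \<in> ball z r \<Longrightarrow> ?q w = p w" by blast
    have "?q holomorphic_on ball z r" by (rule holomorphic_transform[OF p(1)]) (simp add: p(2))
    then show "\<exists>f'. (?q has_field_derivative f') (at z)"
      using r by (simp add: holomorphic_on_open)
  qed
  show "h z = f z * ?q z" if "z \<in> \<H>" for z
  proof -
    from *[OF that] obtain r p where "r > 0" "\<forall>w\<in>ball z r. h w = f w * p w \<and> ?q w = p w" by blast
    then have "h z = f z * p z \<and> ?q z = p z" by (meson centre_in_ball)
    then show ?thesis by simp
  qed
qed

lemma locally_divides_nonzero:
  assumes f: "f holomorphic_on \<H>" and h: "h holomorphic_on \<H>" and z: "z \<in> \<H>" "f z \<noteq> 0"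
  shows "locally_divides f h z"
proof -
  have nz0: "\<exists>z\<in>\<H>. f z \<noteq> 0" using z by blast
  obtain n r u where u: "r > 0" "ball z r \<subseteq> \<H>" "u holomorphic_on ball z r"
    "\<And>w. w \<in> ball z r \<Longrightarrow> u w \<noteq> 0" "\<And>w. w \<in> ball z r \<Longrightarrow> f w = (w - z) ^ n * u w"
    by (rule local_factor[OF f nz0 z(1)]) (rule that)
  have "n = 0" using u(5)[of z] u(1) z(2) by (cases n) auto
  then have nz: "f w \<noteq> 0" if "w \<in> ball z r" for w using u(4,5)[OF that] by simp
  show ?thesis unfolding locally_divides_def
  proof (intro exI[of _ r] exI[of _ "\<lambda>w. h w / f w"] conjI ballI)
    show "(\<lambda>w. h w / f w) holomorphic_on ball z r"
      using f h u(2) nz by (intro holomorphic_intros) (auto intro: holomorphic_on_subset)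
  qed (use u nz in auto)
qed

text \<open>
  The number of conditions is the order of the zero of \<open>f\<close> at \<open>z\<close>.
\<close>

lemma diff_quot_divides:
  assumes f: "f holomorphic_on \<H>" and nz: "\<exists>z\<in>\<H>. f z \<noteq> 0" and z: "z \<in> \<H>"
  obtains n where "\<And>h. h holomorphic_on \<H> \<Longrightarrow> (\<And>i. i < n \<Longrightarrow> (diff_quot z ^^ i) h z = 0) \<Longrightarrow> locally_divides f h z"
proof -
  obtain n r u where u: "r > 0" "ball z r \<subseteq> \<H>" "u holomorphic_on ball z r"
    "\<And>w. w \<in> ball z r \<Longrightarrow> u w \<noteq> 0" "\<And>w. w \<in> ball z r \<Longrightarrow> f w = (w - z) ^ n * u w"
    by (rule local_factor[OF assms]) (rule that)
  show ?thesis
  proof (rule that[of n])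
    fix h assume h: "h holomorphic_on \<H>" "\<And>i. i < n \<Longrightarrow> (diff_quot z ^^ i) h z = 0"
    define p where "p w = (diff_quot z ^^ n) h w / u w" for w
    have "p holomorphic_on ball z r"
      unfolding p_def using u(3,4) diff_quot_pow_holomorphic[OF h(1)] u(2)
      by (intro holomorphic_intros) (auto intro: holomorphic_on_subset)
    moreover have "h w = f w * p w" if "w \<in> ball z r" for w
      using diff_quot_factor[of n z h w, OF h(2)] u(4,5)[OF that] by (simp add: p_def)
    ultimately show "locally_divides f h z" unfolding locally_divides_def using u(1,2) by blast
  qed
qed

context cocompact_fuchsian
begin

lemma MF_nonzero: "f \<in> MF k \<Longrightarrow> f \<noteq> 0 \<Longrightarrow> \<exists>z\<in>\<H>. f z \<noteq> 0"
  using MF_D(1) by (fastforce simp: fun_eq_iff)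

lemma MF_quotient:
  assumes f: "f \<in> MF m" "f \<noteq> 0" and h: "h \<in> MF k"
    and loc: "\<And>z. z \<in> \<H> \<Longrightarrow> locally_divides f h z"
  obtains q where "q \<in> MF (k - m)" "h = f * q"
proof -
  have nz: "\<exists>z\<in>\<H>. f z \<noteq> 0" by (rule MF_nonzero[OF f])
  obtain q0 where q0: "q0 holomorphic_on \<H>" "\<And>z. z \<in> \<H> \<Longrightarrow> h z = f z * q0 z"
    by (rule global_quotient[OF MF_D(2)[OF f(1)] nz loc]) (assumption, rule that)
  define q where "q z = (if z \<in> \<H> then q0 z else 0)" for z
  have qhol: "q holomorphic_on \<H>" by (rule holomorphic_transform[OF q0(1)]) (simp add: q_def)
  have hfq: "h z = f z * q z" for z
    using q0(2) MF_D(1)[OF h] by (simp add: q_def)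
  have "automorphy A z powi (- (k - m)) * q (moebius A z) - q z = 0" if A: "A \<in> G" and z: "z \<in> \<H>" for A z
  proof (rule holomorphic_cancel[OF MF_D(2)[OF f(1)] nz _ _ z])
    show "(\<lambda>z. automorphy A z powi (- (k - m)) * q (moebius A z) - q z) holomorphic_on \<H>"
      using automorphy_nonzero[OF det_G[OF A]]
      by (intro holomorphic_intros automorphy_holomorphic comp_moebius_holomorphic det_G A qhol) auto
    fix w assume w: "w \<in> \<H>"
    let ?j = "automorphy A w"
    have j: "?j \<noteq> 0" by (rule automorphy_nonzero[OF det_G[OF A] w])
    have pw: "?j powi (- (k - m)) = ?j powi (- k) * ?j powi m"
      using j by (simp add: power_int_add[symmetric])
    have "f w * (?j powi (- (k - m)) * q (moebius A w)) = ?j powi (- k) * ((?j powi m * f w) * q (moebius A w))"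
      unfolding pw by (simp add: mult_ac)
    also have "?j powi m * f w = f (moebius A w)" using MF_transform[OF f(1) A w] by simp
    also have "?j powi (- k) * (f (moebius A w) * q (moebius A w)) = h w"
      using MF_D(3)[OF h A w] unfolding hfq .
    finally show "f w * (?j powi (- (k - m)) * q (moebius A w) - q w) = 0"
      using hfq[of w] by (simp add: right_diff_distrib)
  qed
  then have "q \<in> MF (k - m)" unfolding MF_def using qhol by (auto simp: q_def)
  moreover have "h = f * q" using hfq by (simp add: fun_eq_iff)
  ultimately show ?thesis by (rule that)
qed

lemma locally_divides_moebius:
  assumes f: "f \<in> MF m" and h: "h \<in> MF k" and A: "A \<in> G" and z: "z \<in> \<H>"
    and loc: "locally_divides f h (moebius A z)"
  shows "locally_divides f h z"
proof -
  obtain r p where r: "r > 0" "ball (moebius A z) r \<subseteq> \<H>" and p: "p holomorphic_on ball (moebius A z) r"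
    and hp: "\<And>w. w \<in> ball (moebius A z) r \<Longrightarrow> h w = f w * p w"
    using loc unfolding locally_divides_def by blast
  have "open (\<H> \<inter> moebius A -` ball (moebius A z) r)"
    by (rule continuous_open_preimage[OF holomorphic_on_imp_continuous_on[OF moebius_holomorphic[OF det_G[OF A]]] open_H]) auto
  moreover have "z \<in> \<H> \<inter> moebius A -` ball (moebius A z) r" using z r by simp
  ultimately obtain s where s: "s > 0" "ball z s \<subseteq> \<H> \<inter> moebius A -` ball (moebius A z) r" by (meson openE)
  define p' where "p' w = automorphy A w powi (m - k) * p (moebius A w)" for w
  have p'_hol: "p' holomorphic_on ball z s"
    unfolding p'_def
  proof (intro holomorphic_intros automorphy_holomorphic)
    show "(\<lambda>w. p (moebius A w)) holomorphic_on ball z s"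
    proof (rule holomorphic_on_compose_gen[OF _ p, unfolded o_def])
      show "moebius A holomorphic_on ball z s"
        using moebius_holomorphic[OF det_G[OF A]] s(2) by (blast intro: holomorphic_on_subset)
    qed (use s in blast)
    show "0 \<le> m - k \<or> (\<forall>w\<in>ball z s. automorphy A w \<noteq> 0)"
      using automorphy_nonzero[OF det_G[OF A]] s(2) by blast
  qed
  have "h w = f w * p' w" if "w \<in> ball z s" for w
  proof -
    have w: "w \<in> \<H>" "moebius A w \<in> ball (moebius A z) r" using s that by auto
    let ?j = "automorphy A w"
    have j: "?j \<noteq> 0" by (rule automorphy_nonzero[OF det_G[OF A] w(1)])
    have "h w = ?j powi (- k) * (f (moebius A w) * p (moebius A w))"
      using MF_D(3)[OF h A w(1)] hp[OF w(2)] by simp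
    also have "f (moebius A w) = ?j powi m * f w" by (rule MF_transform[OF f A w(1)])
    also have "?j powi (- k) * (?j powi m * f w * p (moebius A w)) = f w * ((?j powi (- k) * ?j powi m) * p (moebius A w))"
      by (simp add: mult_ac)
    also have "?j powi (- k) * ?j powi m = ?j powi (m - k)" using j by (simp add: power_int_add[symmetric])
    finally show ?thesis by (simp add: p'_def)
  qed
  then show ?thesis unfolding locally_divides_def using s p'_hol by blast
qed

text \<open>
  Zeros are isolated, so a compact disc that meets every orbit contains finitely many.
\<close>

lemma finite_zeros_mod_G:
  assumes f: "f \<in> MF m" "f \<noteq> 0"
  obtains Z where "finite Z" "Z \<subseteq> \<H>" "\<And>z. z \<in> Z \<Longrightarrow> f z = 0"
    "\<And>z. z \<in> \<H> \<Longrightarrow> f z = 0 \<Longrightarrow> \<exists>A\<in>G. moebius A z \<in> Z"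
proof -
  obtain M where M: "\<And>z. z \<in> \<H> \<Longrightarrow> \<exists>A\<in>G. sig \<i> (moebius A z) \<le> M" using cocompact_G by blast
  define Z where "Z = {z\<in>hyp_disc M. f z = 0}"
  have "finite Z"
  proof (cases "f constant_on \<H>")
    case True
    then have "Z = {}" using MF_nonzero[OF f] hyp_disc_subset unfolding Z_def constant_on_def by force
    then show ?thesis by simp
  next
    case False
    then show ?thesis unfolding Z_def
      by (rule holomorphic_compact_finite_zeros[OF MF_D(2)[OF f(1)] open_H convex_connected[OF convex_H] compact_hyp_disc hyp_disc_subset])
  qed
  moreover have "\<exists>A\<in>G. moebius A z \<in> Z" if z: "z \<in> \<H>" "f z = 0" for z
  proof -
    obtain A where A: "A \<in> G" "sig \<i> (moebius A z) \<le> M" using M[OF z(1)] by blast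
    have "moebius A z \<in> Z"
      using A z MF_transform[OF f(1) A(1) z(1)] moebius_in_H[OF det_G[OF A(1)] z(1)] by (simp add: Z_def hyp_disc_def)
    then show ?thesis using A by blast
  qed
  ultimately show ?thesis by (intro that[of Z]) (auto simp: Z_def hyp_disc_def)
qed

text \<open>
  Divisibility by \<open>f\<close> is a local condition at the zeros of \<open>f\<close>, it is invariant under the group, and the zeros
  form finitely many orbits. The conditions do not involve the weight of \<open>h\<close>.
\<close>

lemma MF_divisibility_conditions:
  assumes f: "f \<in> MF m" "f \<noteq> 0"
  obtains I :: "(complex \<times> nat) set" where "finite I" "\<And>z i. (z, i) \<in> I \<Longrightarrow> z \<in> \<H>"
    "\<And>k h. h \<in> MF k \<Longrightarrow> (\<And>z i. (z, i) \<in> I \<Longrightarrow> (diff_quot z ^^ i) h z = 0) \<Longrightarrow> \<exists>q\<in>MF (k - m). h = f * q"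
proof -
  obtain Z where Z: "finite Z" "Z \<subseteq> \<H>" "\<And>z. z \<in> Z \<Longrightarrow> f z = 0"
      "\<And>z. z \<in> \<H> \<Longrightarrow> f z = 0 \<Longrightarrow> \<exists>A\<in>G. moebius A z \<in> Z"
    by (rule finite_zeros_mod_G[OF f]) (rule that)
  have "\<exists>n. \<forall>h. h holomorphic_on \<H> \<longrightarrow> (\<forall>i<n. (diff_quot z ^^ i) h z = 0) \<longrightarrow> locally_divides f h z" if "z \<in> Z" for z
  proof -
    have "z \<in> \<H>" using that Z(2) by blast
    then show ?thesis
      by (rule diff_quot_divides[OF MF_D(2)[OF f(1)] MF_nonzero[OF f]]) blast
  qed
  then obtain n where n: "\<And>z h. z \<in> Z \<Longrightarrow> h holomorphic_on \<H> \<Longrightarrow> (\<forall>i<n z. (diff_quot z ^^ i) h z = 0) \<Longrightarrow> locally_divides f h z"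
    by metis
  define I where "I = (SIGMA z:Z. {..<n z})"
  show ?thesis
  proof (rule that[of I])
    show "finite I" using Z(1) by (simp add: I_def)
    show "z \<in> \<H>" if "(z, i) \<in> I" for z i using that Z(2) by (auto simp: I_def)
    fix k h assume h: "h \<in> MF k" "\<And>z i. (z, i) \<in> I \<Longrightarrow> (diff_quot z ^^ i) h z = 0"
    have Zloc: "locally_divides f h z" if "z \<in> Z" for z
      using n[OF that MF_D(2)[OF h(1)]] h(2) that by (auto simp: I_def)
    have "locally_divides f h z" if z: "z \<in> \<H>" for z
    proof (cases "f z = 0")
      case True
      then obtain A where A: "A \<in> G" "moebius A z \<in> Z" using Z(4)[OF z] by blast
      show ?thesis by (rule locally_divides_moebius[OF f(1) h(1) A(1) z Zloc[OF A(2)]])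
    next
      case False
      then show ?thesis by (rule locally_divides_nonzero[OF MF_D(2)[OF f(1)] MF_D(2)[OF h(1)] z])
    qed
    then show "\<exists>q\<in>MF (k - m). h = f * q" by (rule MF_quotient[OF f h(1)]) (assumption, rule bexI)
  qed
qed

end

section \<open>Forms without common zeros\<close>

lemma sum_fun_apply: "(\<Sum>i\<in>I. F i) z = (\<Sum>i\<in>I. F i z)" for F :: "'i \<Rightarrow> complex \<Rightarrow> complex"
  by (induction I rule: infinite_finite_induct) auto

lemma D_pow_eq_deriv_pow: "z \<in> \<H> \<Longrightarrow> (D ^^ n) f z = (deriv ^^ n) f z"
proof (induction n arbitrary: z)
  case (Suc n)
  have "\<forall>\<^sub>F w in nhds z. (D ^^ n) f w = (deriv ^^ n) f w"
    by (rule eventually_mono[OF eventually_nhds_in_open[OF open_H Suc.prems] Suc.IH])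
  from deriv_cong_ev[OF this refl] show ?case using Suc.prems by (simp add: D_in_H)
qed simp

context cocompact_fuchsian
begin

lemma lower_sum:
  assumes "finite I" "\<And>i. i \<in> I \<Longrightarrow> F i \<in> QF k"
  shows "lower k (\<Sum>i\<in>I. F i) = (\<Sum>i\<in>I. lower k (F i))"
  using assms
proof (induction I rule: finite_induct)
  case (insert i I)
  have "(\<Sum>i\<in>I. F i) \<in> QF k" by (rule form.subspace_sum[OF subspace_QF]) (use insert.prems in blast)
  then have "lower k (F i + (\<Sum>i\<in>I. F i)) = lower k (F i) + lower k (\<Sum>i\<in>I. F i)"
    using insert.prems by (intro lower_add) auto
  also have "lower k (\<Sum>i\<in>I. F i) = (\<Sum>i\<in>I. lower k (F i))"
    using insert.prems by (intro insert.IH) blast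
  finally show ?case unfolding sum.insert[OF insert.hyps] .
next
  case empty
  show ?case by (simp only: sum.empty lower_0)
qed

text \<open>
  Let \<open>n\<close> be the order of \<open>f\<close> at \<open>z\<close> and consider the Rankin-Cohen bracket, the combination of the products
  \<open>D^r f * D^(2 n - r) f\<close> that is annihilated by lowering. At \<open>z\<close> all products vanish except the middle one, which is the square of
  \<open>D^n f z\<close> and has a nonzero coefficient.
\<close>

lemma MF_nonvanishing_at:
  assumes f: "f \<in> MF k" "f \<noteq> 0" and k: "k > 0" and z: "z \<in> \<H>"
  shows "\<exists>m>0. \<exists>h\<in>MF m. h z \<noteq> 0"
proof -
  have "\<exists>n. (D ^^ n) f z \<noteq> 0"
  proof (rule ccontr)
    assume "\<not> (\<exists>n. (D ^^ n) f z \<noteq> 0)"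
    then have "(deriv ^^ n) f z = 0" for n using D_pow_eq_deriv_pow[OF z] by simp
    then have "f w = 0" if "w \<in> \<H>" for w
      using holomorphic_fun_eq_0_on_connected[OF MF_D(2)[OF f(1)] open_H convex_connected[OF convex_H] _ z that] by blast
    then show False using MF_nonzero[OF f] by blast
  qed
  define n where "n = (LEAST n. (D ^^ n) f z \<noteq> 0)"
  have n: "(D ^^ n) f z \<noteq> 0" unfolding n_def by (rule LeastI_ex) fact
  have below: "(D ^^ r) f z = 0" if "r < n" for r using that not_less_Least unfolding n_def by blast
  define N where "N = 2 * n"
  \<comment> \<open>the recursion makes the lowered terms cancel in pairs\<close>
  define c where "c = rec_nat (1::complex) (\<lambda>r x. - x * (of_nat (N - r) * of_int (k + int (N - r) - 1)) / (of_nat (Suc r) * of_int (k + int r)))"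
  have c_0: "c 0 = 1" by (simp add: c_def)
  have c_rec: "c (Suc r) = - c r * (of_nat (N - r) * of_int (k + int (N - r) - 1)) / (of_nat (Suc r) * of_int (k + int r))" for r
    unfolding c_def by (simp only: nat.rec)
  have kr: "of_int (k + int r) \<noteq> (0::complex)" for r unfolding of_int_eq_0_iff using k by linarith
  have kr': "of_int (k + int r - 1) \<noteq> (0::complex)" if "r > 0" for r unfolding of_int_eq_0_iff using k that by linarith
  have c_Suc: "c (Suc r) * (of_nat (Suc r) * of_int (k + int (Suc r) - 1)) = - (c r * (of_nat (N - r) * of_int (k + int (N - r) - 1)))" for r
  proof -
    have nz: "of_nat (Suc r) * of_int (k + int r) \<noteq> (0::complex)" using kr[of r] by (simp del: of_nat_Suc of_int_add)
    have g: "v \<noteq> 0 \<Longrightarrow> u / v * v = u" for u v :: complex by simp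
    have w: "k + int (Suc r) - 1 = k + int r" by simp
    show ?thesis unfolding c_rec w g[OF nz] by (simp only: mult_minus_left)
  qed
  have c_nz: "c r \<noteq> 0" if "r \<le> N" for r
    using that
  proof (induction r)
    case (Suc r)
    then have "c r * (of_nat (N - r) * of_int (k + int (N - r) - 1)) \<noteq> 0"
      using kr'[of "N - r"] by simp
    then show ?case using c_Suc[of r] by (metis mult_zero_left neg_0_equal_iff_equal)
  qed (simp add: c_0)
  define F where "F r = (\<lambda>w. c r * ((D ^^ r) f w * (D ^^ (N - r)) f w))" for r
  define l where "l = 2 * k + 2 * int N"
  define h where "h = (\<Sum>r\<le>N. F r)"
  have w: "(k + 2 * int r) + (k + 2 * int (N - r)) = l" if "r \<le> N" for r using that by (simp add: l_def)
  have q: "(D ^^ r) f \<in> QF (k + 2 * int r)" for r by (rule D_pow_QF[OF MF_QF[OF f(1)]])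
  have prodQ: "(D ^^ r) f * (D ^^ (N - r)) f \<in> QF l" if "r \<le> N" for r
    using QF_mult[OF q q, of r "N - r"] unfolding w[OF that] .
  have F_eq: "F r = (\<lambda>w. c r * ((D ^^ r) f * (D ^^ (N - r)) f) w)" for r by (simp add: F_def)
  have FQ: "F r \<in> QF l" if "r \<le> N" for r unfolding F_eq by (rule QF_scale[OF prodQ[OF that]])
  have hQ: "h \<in> QF l" unfolding h_def by (rule form.subspace_sum[OF subspace_QF]) (use FQ in auto)
  define a where "a r w = c r * (of_nat r * of_int (k + int r - 1)) * ((D ^^ (r - 1)) f w * (D ^^ (N - r)) f w)" for r w
  define b where "b r w = c r * (of_nat (N - r) * of_int (k + int (N - r) - 1)) * ((D ^^ r) f w * (D ^^ (N - r - 1)) f w)" for r w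
  have lF: "lower l (F r) w = a r w + b r w" if "r \<le> N" for r w
  proof -
    have "lower l (F r) = (\<lambda>w. c r * lower l ((D ^^ r) f * (D ^^ (N - r)) f) w)"
      unfolding F_eq by (rule lower_scale[OF prodQ[OF that]])
    also have "lower l ((D ^^ r) f * (D ^^ (N - r)) f) =
        lower (k + 2 * int r) ((D ^^ r) f) * (D ^^ (N - r)) f + (D ^^ r) f * lower (k + 2 * int (N - r)) ((D ^^ (N - r)) f)"
      unfolding w[OF that, symmetric] by (rule lower_mult[OF q q])
    finally have "lower l (F r) w = c r * ((of_nat r * of_int (k + int r - 1)) * (D ^^ (r - 1)) f w * (D ^^ (N - r)) f w
        + (D ^^ r) f w * ((of_nat (N - r) * of_int (k + int (N - r) - 1)) * (D ^^ (N - r - 1)) f w))"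
      unfolding lower_D_pow[OF f(1)] by (simp only: plus_fun_apply times_fun_apply)
    then show ?thesis unfolding a_def b_def by (simp only: distrib_left mult_ac)
  qed
  have ab: "a (Suc r) w = - b r w" for r w
    unfolding a_def b_def c_Suc by simp
  have "lower l h w = 0" for w
  proof -
    have "lower l h w = (\<Sum>r\<le>N. lower l (F r) w)"
      unfolding h_def by (subst lower_sum) (use FQ in \<open>auto simp: sum_fun_apply\<close>)
    also have "\<dots> = (\<Sum>r\<le>N. a r w) + (\<Sum>r\<le>N. b r w)"
      unfolding sum.distrib[symmetric] by (intro sum.cong refl lF) simp
    also have "(\<Sum>r\<le>N. a r w) = a 0 w + (\<Sum>r<N. a (Suc r) w)" by (rule sum.atMost_shift)
    also have "(\<Sum>r<N. a (Suc r) w) = - (\<Sum>r<N. b r w)" by (simp add: ab sum_negf)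
    also have "(\<Sum>r\<le>N. b r w) = (\<Sum>r<N. b r w) + b N w" by (simp add: lessThan_Suc_atMost[symmetric])
    also have "a 0 w + - (\<Sum>r<N. b r w) + ((\<Sum>r<N. b r w) + b N w) = 0"
      by (simp add: a_def b_def)
    finally show ?thesis .
  qed
  then have "lower l h = 0" by (simp add: fun_eq_iff)
  then have hM: "h \<in> MF l" by (rule MF_if_lower_0[OF hQ])
  have "h z = (\<Sum>r\<le>N. c r * ((D ^^ r) f z * (D ^^ (N - r)) f z))"
    by (simp add: h_def sum_fun_apply F_def)
  also have "\<dots> = (\<Sum>r\<in>{n}. c r * ((D ^^ r) f z * (D ^^ (N - r)) f z))"
  proof (rule sum.mono_neutral_right)
    show "\<forall>r\<in>{..N} - {n}. c r * ((D ^^ r) f z * (D ^^ (N - r)) f z) = 0"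
    proof
      fix r assume "r \<in> {..N} - {n}"
      then have "r < n \<or> N - r < n" by (auto simp: N_def)
      then show "c r * ((D ^^ r) f z * (D ^^ (N - r)) f z) = 0" using below by auto
    qed
  qed (auto simp: N_def)
  also have "\<dots> = c n * ((D ^^ n) f z * (D ^^ n) f z)" by (simp add: N_def)
  finally have "h z \<noteq> 0" using n c_nz[of n] by (simp add: N_def)
  moreover have "l > 0" using k by (simp add: l_def)
  ultimately show ?thesis using hM by blast
qed

lemma MF_power: "f \<in> MF k \<Longrightarrow> n > 0 \<Longrightarrow> (\<lambda>z. f z ^ n) \<in> MF (int n * k)"
proof (induction n)
  case (Suc n)
  show ?case
  proof (cases "n = 0")
    case False
    have "f * (\<lambda>z. f z ^ n) \<in> MF (k + int n * k)" using Suc False by (intro MF_mult) auto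
    moreover have "f * (\<lambda>z. f z ^ n) = (\<lambda>z. f z ^ Suc n)" by (simp add: fun_eq_iff)
    moreover have "k + int n * k = int (Suc n) * k" by (simp add: algebra_simps)
    ultimately show ?thesis by simp
  qed (use Suc in simp)
qed simp

lemma MF_add: "f \<in> MF k \<Longrightarrow> g \<in> MF k \<Longrightarrow> f + g \<in> MF k"
  and MF_scale: "f \<in> MF k \<Longrightarrow> (\<lambda>z. c * f z) \<in> MF k"
  using form.subspace_add[OF subspace_MF] form.subspace_scale[OF subspace_MF] by auto

text \<open>
  Forms that do not vanish at single points are raised to powers of a common weight; a linear combination then avoids
  the finitely many zeros at once.
\<close>

lemma MF_nonvanishing_on_finite:
  assumes f: "f \<in> MF k" "f \<noteq> 0" and k: "k > 0" and Z: "finite Z" "Z \<subseteq> \<H>"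
  shows "\<exists>b>0. \<exists>g\<in>MF b. \<forall>z\<in>Z. g z \<noteq> 0"
  using Z
proof (induction Z rule: finite_induct)
  case empty
  then show ?case using f k by blast
next
  case (insert z0 Z)
  then obtain b g where b: "b > 0" "g \<in> MF b" "\<And>z. z \<in> Z \<Longrightarrow> g z \<noteq> 0" by auto
  obtain a h where a: "a > 0" "h \<in> MF a" "h z0 \<noteq> 0"
    using MF_nonvanishing_at[OF f k, of z0] insert.prems by blast
  define p where "p z = g z ^ nat a" for z
  define q where "q z = h z ^ nat b" for z
  have p: "p \<in> MF (a * b)" unfolding p_def[abs_def] using MF_power[OF b(2), of "nat a"] a(1) by simp
  have q: "q \<in> MF (a * b)" unfolding q_def[abs_def] using MF_power[OF a(2), of "nat b"] b(1) by (simp add: mult.commute)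
  have "finite ((\<lambda>z. - p z / q z) ` insert z0 Z)" using insert.hyps by simp
  then obtain t where t: "t \<notin> (\<lambda>z. - p z / q z) ` insert z0 Z"
    using ex_new_if_finite[OF infinite_UNIV_char_0] by blast
  have "p z + t * q z \<noteq> 0" if z: "z \<in> insert z0 Z" for z
  proof
    assume eq: "p z + t * q z = 0"
    show False
    proof (cases "q z = 0")
      case True
      then have "z \<noteq> z0" using a(3) by (auto simp: q_def)
      then have "p z \<noteq> 0" using z b(3) by (auto simp: p_def)
      then show False using eq True by simp
    next
      case False
      have "t * q z = - p z" using eq by (simp add: eq_neg_iff_add_eq_0 add.commute)
      then have "t = - p z / q z" unfolding nonzero_eq_divide_eq[OF False] .
      then show False using t z by blast
    qed
  qed
  moreover have "p + (\<lambda>z. t * q z) \<in> MF (a * b)" by (intro MF_add MF_scale p q)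
  moreover have "a * b > 0" using a b by simp
  ultimately show ?case by (intro exI[of _ "a * b"] conjI bexI[of _ "p + (\<lambda>z. t * q z)"]) auto
qed

text \<open>
  Choose a form that does not vanish on representatives of the zeros of the first one, then raise both to powers
  of equal weight.
\<close>

lemma MF_pair_without_common_zeros:
  assumes f: "f \<in> MF k" "f \<noteq> 0" and k: "k > 0"
  obtains m F g where "m > 0" "F \<in> MF m" "g \<in> MF m" "F \<noteq> 0" "\<And>z. z \<in> \<H> \<Longrightarrow> F z \<noteq> 0 \<or> g z \<noteq> 0"
proof -
  obtain Z where Z: "finite Z" "Z \<subseteq> \<H>" "\<And>z. z \<in> Z \<Longrightarrow> f z = 0"
      "\<And>z. z \<in> \<H> \<Longrightarrow> f z = 0 \<Longrightarrow> \<exists>A\<in>G. moebius A z \<in> Z"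
    by (rule finite_zeros_mod_G[OF f]) (rule that)
  obtain b g where b: "b > 0" "g \<in> MF b" "\<And>z. z \<in> Z \<Longrightarrow> g z \<noteq> 0"
    using MF_nonvanishing_on_finite[OF f k Z(1,2)] by blast
  have F: "(\<lambda>z. f z ^ nat b) \<in> MF (k * b)" using MF_power[OF f(1), of "nat b"] b(1) by (simp add: mult.commute)
  have g: "(\<lambda>z. g z ^ nat k) \<in> MF (k * b)" using MF_power[OF b(2), of "nat k"] k by simp
  have nocz: "f z ^ nat b \<noteq> 0 \<or> g z ^ nat k \<noteq> 0" if z: "z \<in> \<H>" for z
  proof (cases "f z = 0")
    case True
    then obtain A where A: "A \<in> G" "moebius A z \<in> Z" using Z(4)[OF z] by blast
    have "g z \<noteq> 0" using b(3)[OF A(2)] MF_transform[OF b(2) A(1) z] by auto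
    then show ?thesis by simp
  qed simp
  have nz: "(\<lambda>z. f z ^ nat b) \<noteq> 0"
  proof
    assume "(\<lambda>z. f z ^ nat b) = 0"
    then have "f z ^ nat b = 0" for z by (simp add: fun_eq_iff)
    then show False using MF_nonzero[OF f] by (auto simp: power_eq_0_iff)
  qed
  show ?thesis by (rule that[OF _ F g nz nocz]) (use k b(1) in simp)
qed

lemma MF_sum: "(\<And>j. j \<in> J \<Longrightarrow> h j \<in> MF k) \<Longrightarrow> (\<lambda>z. \<Sum>j\<in>J. c j * h j z) \<in> MF k"
proof -
  assume "\<And>j. j \<in> J \<Longrightarrow> h j \<in> MF k"
  then have "(\<Sum>j\<in>J. (\<lambda>z. c j * h j z)) \<in> MF k"
    by (intro form.subspace_sum[OF subspace_MF] MF_scale)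
  also have "(\<Sum>j\<in>J. (\<lambda>z. c j * h j z)) = (\<lambda>z. \<Sum>j\<in>J. c j * h j z)" by (simp add: fun_eq_iff sum_fun_apply)
  finally show ?thesis .
qed

lemma MF_combination_divisible:
  assumes f: "f \<in> MF m" "f \<noteq> 0"
  obtains N where "\<And>J k h. finite J \<Longrightarrow> card J > N \<Longrightarrow> (\<And>j. j \<in> J \<Longrightarrow> h j \<in> MF k) \<Longrightarrow>
     \<exists>c. (\<exists>j\<in>J. c j \<noteq> 0) \<and> (\<exists>q\<in>MF (k - m). (\<lambda>z. \<Sum>j\<in>J. c j * h j z) = f * q)"
proof -
  show ?thesis
  proof (rule MF_divisibility_conditions[OF f])
    fix I :: "(complex \<times> nat) set"
    assume I: "finite I" "\<And>z i. (z, i) \<in> I \<Longrightarrow> z \<in> \<H>"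
    "\<And>k h. h \<in> MF k \<Longrightarrow> (\<And>z i. (z, i) \<in> I \<Longrightarrow> (diff_quot z ^^ i) h z = 0) \<Longrightarrow> \<exists>q\<in>MF (k - m). h = f * q"
  show ?thesis
  proof (rule that[of "card I"])
    fix J :: "'j set" and k and h :: "'j \<Rightarrow> complex \<Rightarrow> complex"
    assume J: "finite J" "card J > card I" and h: "\<And>j. j \<in> J \<Longrightarrow> h j \<in> MF k"
    from homogeneous_system[OF I(1) J, of "\<lambda>(z, i) j. (diff_quot z ^^ i) (h j) z"]
    obtain c where c: "\<exists>j\<in>J. c j \<noteq> 0" "\<And>z i. (z, i) \<in> I \<Longrightarrow> (\<Sum>j\<in>J. c j * (diff_quot z ^^ i) (h j) z) = 0"
      by fastforce
    have "\<exists>q\<in>MF (k - m). (\<lambda>z. \<Sum>j\<in>J. c j * h j z) = f * q"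
    proof (rule I(3)[OF MF_sum[OF h]])
      fix z i assume zi: "(z, i) \<in> I"
      have "(diff_quot z ^^ i) (\<lambda>w. \<Sum>j\<in>J. c j * h j w) = (\<lambda>w. \<Sum>j\<in>J. c j * (diff_quot z ^^ i) (h j) w)"
        by (rule diff_quot_pow_linear[OF J(1) _ I(2)[OF zi]]) (use h MF_D(2) in blast)
      then show "(diff_quot z ^^ i) (\<lambda>w. \<Sum>j\<in>J. c j * h j w) z = 0" using c(2)[OF zi] by simp
    qed
    then show "\<exists>c. (\<exists>j\<in>J. c j \<noteq> 0) \<and> (\<exists>q\<in>MF (k - m). (\<lambda>z. \<Sum>j\<in>J. c j * h j z) = f * q)" using c(1) by blast
  qed
  qed
qed

end

section \<open>Bounds for families independent modulo two forms\<close>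

context cocompact_fuchsian
begin

lemma locally_divides_cancel:
  assumes z: "z \<in> \<H>" and g: "g holomorphic_on \<H>" "g z \<noteq> 0" and q: "q holomorphic_on \<H>"
    and eq: "\<And>w. w \<in> \<H> \<Longrightarrow> g w * s w = f w * q w"
  shows "locally_divides f s z"
proof -
  have "locally_divides g (\<lambda>w. q w) z"
    by (rule locally_divides_nonzero[OF g(1) q z g(2)])
  then obtain r p where r: "r > 0" "ball z r \<subseteq> \<H>" "p holomorphic_on ball z r" "\<And>w. w \<in> ball z r \<Longrightarrow> q w = g w * p w"
    unfolding locally_divides_def by blast
  have "open (\<H> \<inter> g -` (- {0}))"
    by (rule continuous_open_preimage[OF holomorphic_on_imp_continuous_on[OF g(1)] open_H]) auto
  moreover have "z \<in> \<H> \<inter> g -` (- {0})" using z g(2) by simp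
  ultimately obtain r' where r': "r' > 0" "ball z r' \<subseteq> \<H> \<inter> g -` (- {0})" by (meson openE)
  have sub: "w \<in> ball z r" "w \<in> ball z r'" if "w \<in> ball z (min r r')" for w using that by auto
  show ?thesis unfolding locally_divides_def
  proof (intro exI[of _ "min r r'"] exI[of _ p] conjI ballI)
    show "p holomorphic_on ball z (min r r')" by (rule holomorphic_on_subset[OF r(3)]) (use sub in blast)
    show "ball z (min r r') \<subseteq> \<H>" using r(2) sub(1) by blast
    fix w assume w: "w \<in> ball z (min r r')"
    have wH: "w \<in> \<H>" and gw: "g w \<noteq> 0" using r'(2) sub(2)[OF w] by auto
    have "g w * s w = g w * (f w * p w)" using eq[OF wH] r(4)[OF sub(1)[OF w]] by (simp add: mult_ac)
    then show "s w = f w * p w" using gw by simp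
  qed (use r r' in simp)
qed

text \<open>
  Multiplication by powers of \<open>g\<close> brings all forms of the family to one weight. If the family is larger than the number of
  conditions for divisibility by \<open>F\<close>, some combination is divisible by \<open>F\<close>. Among the forms that occur in it, those of highest weight
  carry the lowest power of \<open>g\<close>, which can be cancelled because \<open>g\<close> does not vanish at the zeros of \<open>F\<close>. What remains expresses their
  combination as an element of \<open>F M + g M\<close>. Weights are grouped by residue class modulo the weight of \<open>g\<close>, so that
  the powers of \<open>g\<close> are integral.
\<close>

lemma card_independent_mod_pair:
  assumes m: "m > 0" and F: "F \<in> MF m" "F \<noteq> 0" and g: "g \<in> MF m"
    and nocz: "\<And>z. z \<in> \<H> \<Longrightarrow> F z \<noteq> 0 \<or> g z \<noteq> 0"
  obtains N where "\<And>J (h :: 'j \<Rightarrow> complex \<Rightarrow> complex) \<kappa> a. finite J \<Longrightarrow> (\<And>j. j \<in> J \<Longrightarrow> h j \<in> MF (\<kappa> j)) \<Longrightarrow>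
      (\<And>j. j \<in> J \<Longrightarrow> \<kappa> j mod m = a) \<Longrightarrow>
      (\<And>c l P Q. l \<in> \<kappa> ` J \<Longrightarrow> P \<in> MF (l - m) \<Longrightarrow> Q \<in> MF (l - m) \<Longrightarrow>
         (\<And>z. (\<Sum>j\<in>{j\<in>J. \<kappa> j = l}. c j * h j z) = F z * P z + g z * Q z) \<Longrightarrow> \<forall>j\<in>{j\<in>J. \<kappa> j = l}. c j = 0) \<Longrightarrow>
      card J \<le> N"
proof (rule MF_combination_divisible[OF F])
  fix N
  assume N: "\<And>(J :: 'j set) k h. finite J \<Longrightarrow> card J > N \<Longrightarrow> (\<And>j. j \<in> J \<Longrightarrow> h j \<in> MF k) \<Longrightarrow>
     \<exists>c. (\<exists>j\<in>J. c j \<noteq> 0) \<and> (\<exists>q\<in>MF (k - m). (\<lambda>z. \<Sum>j\<in>J. c j * h j z) = F * q)"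
  show ?thesis
  proof (rule that[of N])
    fix J and h :: "'j \<Rightarrow> complex \<Rightarrow> complex" and \<kappa> a
    assume J: "finite J" and h: "\<And>j. j \<in> J \<Longrightarrow> h j \<in> MF (\<kappa> j)" and a: "\<And>j. j \<in> J \<Longrightarrow> \<kappa> j mod m = a"
      and ind: "\<And>c l P Q. l \<in> \<kappa> ` J \<Longrightarrow> P \<in> MF (l - m) \<Longrightarrow> Q \<in> MF (l - m) \<Longrightarrow>
         (\<And>z. (\<Sum>j\<in>{j\<in>J. \<kappa> j = l}. c j * h j z) = F z * P z + g z * Q z) \<Longrightarrow> \<forall>j\<in>{j\<in>J. \<kappa> j = l}. c j = 0"
    show "card J \<le> N"
    proof (rule ccontr)
      assume "\<not> card J \<le> N"
      then have cJ: "card J > N" by simp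
      then have "J \<noteq> {}" by auto
      define K where "K = Max (\<kappa> ` J)"
      have K: "\<kappa> j \<le> K" if "j \<in> J" for j unfolding K_def using J that by simp
      have "K \<in> \<kappa> ` J" unfolding K_def using J \<open>J \<noteq> {}\<close> by (intro Max_in) auto
      then have Ka: "K mod m = a" using a by auto
      define e where "e j = nat ((K - \<kappa> j) div m)" for j
      have e: "\<kappa> j + int (e j) * m = K" if j: "j \<in> J" for j
      proof -
        have "(K - \<kappa> j) mod m = 0" using Ka a[OF j] by (simp add: mod_eq_dvd_iff[symmetric] mod_0_imp_dvd dvd_imp_mod_0)
        moreover have "(K - \<kappa> j) div m \<ge> 0" using K[OF j] m by (simp add: pos_imp_zdiv_nonneg_iff)
        ultimately have "int (e j) * m = K - \<kappa> j"
          unfolding e_def using div_mult_mod_eq[of "K - \<kappa> j" m] by simp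
        then show ?thesis by simp
      qed
      have pw: "(\<lambda>z. g z ^ n * f z) \<in> MF (l + int n * m)" if "f \<in> MF l" for n f l
      proof (cases "n = 0")
        case False
        then have "(\<lambda>z. g z ^ n) * f \<in> MF (int n * m + l)" using that by (intro MF_mult MF_power g) auto
        moreover have "(\<lambda>z. g z ^ n) * f = (\<lambda>z. g z ^ n * f z)" by (simp add: fun_eq_iff)
        ultimately show ?thesis by (simp add: add.commute)
      qed (use that in simp)
      have x: "(\<lambda>z. g z ^ e j * h j z) \<in> MF K" if "j \<in> J" for j
        using pw[OF h[OF that], of "e j"] e[OF that] by simp
      have "\<exists>c. (\<exists>j\<in>J. c j \<noteq> 0) \<and> (\<exists>q\<in>MF (K - m). (\<lambda>z. \<Sum>j\<in>J. c j * (g z ^ e j * h j z)) = F * q)"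
        by (rule N[OF J cJ x])
      then obtain c where cc: "(\<exists>j\<in>J. c j \<noteq> 0) \<and> (\<exists>q\<in>MF (K - m). (\<lambda>z. \<Sum>j\<in>J. c j * (g z ^ e j * h j z)) = F * q)"
        by (rule exE)
      note c = conjunct1[OF cc]
      from conjunct2[OF cc] obtain q where q: "q \<in> MF (K - m)"
        and eq: "(\<lambda>z. \<Sum>j\<in>J. c j * (g z ^ e j * h j z)) = F * q" by (rule bexE)
      define J1 where "J1 = {j\<in>J. c j \<noteq> 0}"
      have J1: "finite J1" "J1 \<noteq> {}" using J c by (auto simp: J1_def)
      define l where "l = Max (\<kappa> ` J1)"
      have "l \<in> \<kappa> ` J1" unfolding l_def using J1 by (intro Max_in) auto
      then obtain j0 where j0: "j0 \<in> J" "c j0 \<noteq> 0" "\<kappa> j0 = l" by (auto simp: J1_def)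
      have lmax: "\<kappa> j \<le> l" if "j \<in> J" "c j \<noteq> 0" for j unfolding l_def using J1 that by (auto simp: J1_def)
      define d where "d = e j0"
      have d: "l + int d * m = K" using e[OF j0(1)] j0(3) by (simp add: d_def)
      have ed: "e j = d" if "j \<in> J" "\<kappa> j = l" for j using that j0(3) by (simp add: e_def d_def)
      have ed': "e j > d \<and> l - m = \<kappa> j + int (e j - Suc d) * m" if "j \<in> J" "\<kappa> j \<noteq> l" "c j \<noteq> 0" for j
      proof -
        have "\<kappa> j < l" using lmax[OF that(1,3)] that(2) by simp
        then have "int d * m < int (e j) * m" using e[OF that(1)] d by linarith
        then have gt: "e j > d" using m by (simp add: mult_less_cancel_right)
        then have "int (e j) = int (e j - Suc d) + int d + 1" by simp
        then have "int (e j) * m = int (e j - Suc d) * m + int d * m + m" by (metis distrib_right mult_1)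
        then show ?thesis using gt e[OF that(1)] d by simp
      qed
      define R where "R z = (\<Sum>j\<in>{j\<in>J. \<kappa> j \<noteq> l \<and> c j \<noteq> 0}. c j * (g z ^ (e j - Suc d) * h j z))" for z
      have R: "R \<in> MF (l - m)"
        unfolding R_def[abs_def]
      proof (rule MF_sum)
        fix j assume j: "j \<in> {j\<in>J. \<kappa> j \<noteq> l \<and> c j \<noteq> 0}"
        then show "(\<lambda>z. g z ^ (e j - Suc d) * h j z) \<in> MF (l - m)"
          using pw[OF h, of j "e j - Suc d"] ed'[of j] by simp
      qed
      define T where "T z = (\<Sum>j\<in>{j\<in>J. \<kappa> j = l}. c j * h j z)" for z
      have T: "T \<in> MF l" unfolding T_def[abs_def] by (rule MF_sum) (use h in auto)
      define s where "s = T + g * R"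
      have s: "s \<in> MF l" unfolding s_def using MF_add[OF T MF_mult[OF g R, simplified]] by simp
      have split: "F z * q z = g z ^ d * s z" for z
      proof -
        have "F z * q z = (\<Sum>j\<in>J. c j * (g z ^ e j * h j z))" using fun_cong[OF eq, of z] by simp
        also have "\<dots> = (\<Sum>j\<in>{j\<in>J. \<kappa> j = l}. c j * (g z ^ e j * h j z)) + (\<Sum>j\<in>{j\<in>J. \<kappa> j \<noteq> l}. c j * (g z ^ e j * h j z))"
          by (subst sum.union_disjoint[symmetric]) (use J in \<open>auto intro!: sum.cong\<close>)
        also have "(\<Sum>j\<in>{j\<in>J. \<kappa> j = l}. c j * (g z ^ e j * h j z)) = g z ^ d * T z"
          unfolding T_def sum_distrib_left by (rule sum.cong) (auto simp: ed mult_ac)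
        also have "(\<Sum>j\<in>{j\<in>J. \<kappa> j \<noteq> l}. c j * (g z ^ e j * h j z)) = (\<Sum>j\<in>{j\<in>J. \<kappa> j \<noteq> l \<and> c j \<noteq> 0}. c j * (g z ^ e j * h j z))"
          by (rule sum.mono_neutral_right) (use J in auto)
        also have "\<dots> = g z ^ d * (g z * R z)"
          unfolding R_def sum_distrib_left
        proof (rule sum.cong[OF refl])
          fix j assume "j \<in> {j\<in>J. \<kappa> j \<noteq> l \<and> c j \<noteq> 0}"
          then have "e j = d + Suc (e j - Suc d)" using ed'[of j] by auto
          then have "g z ^ e j = g z ^ d * (g z * g z ^ (e j - Suc d))" by (metis power_add power_Suc)
          then show "c j * (g z ^ e j * h j z) = g z ^ d * (g z * (c j * (g z ^ (e j - Suc d) * h j z)))"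
            by (simp add: mult_ac)
        qed
        finally show ?thesis by (simp add: s_def distrib_left)
      qed
      have gd_hol: "(\<lambda>z. g z ^ d) holomorphic_on \<H>" using MF_D(2)[OF g] by (intro holomorphic_intros)
      have loc: "locally_divides F s z" if z: "z \<in> \<H>" for z
      proof (cases "F z = 0")
        case False
        then show ?thesis by (rule locally_divides_nonzero[OF MF_D(2)[OF F(1)] MF_D(2)[OF s] z])
      next
        case True
        then have "g z ^ d \<noteq> 0" using nocz[OF z] by simp
        then show ?thesis
          by (rule locally_divides_cancel[OF z gd_hol _ MF_D(2)[OF q]]) (simp add: split)
      qed
      obtain q' where q': "q' \<in> MF (l - m)" "s = F * q'"
        by (rule MF_quotient[OF F s loc]) (assumption, rule that)
      have "T z = F z * q' z + g z * (- 1 * R z)" for z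
        using fun_cong[OF q'(2), of z] by (simp add: s_def algebra_simps)
      then have "\<forall>j\<in>{j\<in>J. \<kappa> j = l}. c j = 0"
        unfolding T_def using j0 by (intro ind[OF _ q'(1) MF_scale[OF R, of "- 1"]]) auto
      then show False using j0 by auto
    qed
  qed
qed

text \<open>
  In weights below that of \<open>F\<close> a form divisible by \<open>F\<close> is zero, since the quotient would have negative weight.
\<close>

lemma card_independent_low_weight:
  assumes F: "F \<in> MF m" "F \<noteq> 0"
  obtains N where "\<And>J (h :: 'j \<Rightarrow> complex \<Rightarrow> complex) k. finite J \<Longrightarrow> k < m \<Longrightarrow> (\<And>j. j \<in> J \<Longrightarrow> h j \<in> MF k) \<Longrightarrow>
      (\<And>c. (\<And>z. (\<Sum>j\<in>J. c j * h j z) = 0) \<Longrightarrow> \<forall>j\<in>J. c j = 0) \<Longrightarrow> card J \<le> N"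
proof (rule MF_combination_divisible[OF F])
  fix N
  assume N: "\<And>(J :: 'j set) k h. finite J \<Longrightarrow> card J > N \<Longrightarrow> (\<And>j. j \<in> J \<Longrightarrow> h j \<in> MF k) \<Longrightarrow>
     \<exists>c. (\<exists>j\<in>J. c j \<noteq> 0) \<and> (\<exists>q\<in>MF (k - m). (\<lambda>z. \<Sum>j\<in>J. c j * h j z) = F * q)"
  show ?thesis
  proof (rule that[of N], rule ccontr)
    fix J and h :: "'j \<Rightarrow> complex \<Rightarrow> complex" and k
    assume J: "finite J" and k: "k < m" and h: "\<And>j. j \<in> J \<Longrightarrow> h j \<in> MF k"
      and ind: "\<And>c. (\<And>z. (\<Sum>j\<in>J. c j * h j z) = 0) \<Longrightarrow> \<forall>j\<in>J. c j = 0" and "\<not> card J \<le> N"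
    then have cJ: "card J > N" by simp
    have "\<exists>c. (\<exists>j\<in>J. c j \<noteq> 0) \<and> (\<exists>q\<in>MF (k - m). (\<lambda>z. \<Sum>j\<in>J. c j * h j z) = F * q)"
      by (rule N[OF J cJ h])
    then obtain c where cc: "(\<exists>j\<in>J. c j \<noteq> 0) \<and> (\<exists>q\<in>MF (k - m). (\<lambda>z. \<Sum>j\<in>J. c j * h j z) = F * q)"
      by (rule exE)
    note c = conjunct1[OF cc]
    from conjunct2[OF cc] obtain q where q: "q \<in> MF (k - m)"
      and eq: "(\<lambda>z. \<Sum>j\<in>J. c j * h j z) = F * q" by (rule bexE)
    have "q = 0" using MF_negative[OF q] k by simp
    then have "(\<Sum>j\<in>J. c j * h j z) = 0" for z using fun_cong[OF eq, of z] by simp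
    then show False using ind c by blast
  qed
qed

end

section \<open>Linear algebra modulo a subspace\<close>

context vector_space_quotient
begin

lemma independent_modD:
  "independent_mod W J v \<Longrightarrow> finite F \<Longrightarrow> F \<subseteq> J \<Longrightarrow> (\<Sum>i\<in>F. scale (c i) (v i)) \<in> W \<Longrightarrow> i \<in> F \<Longrightarrow> c i = 0"
  unfolding independent_mod_def by simp

lemma independent_mod_image:
  assumes W: "subspace W" and ind: "independent_mod W J v"
  shows "inj_on v J" and "independent_mod W (v ` J) (\<lambda>x. x)"
proof -
  show inj: "inj_on v J"
  proof (rule inj_onI, rule ccontr)
    fix i j assume ij: "i \<in> J" "j \<in> J" "v i = v j" "i \<noteq> j"
    have "(\<Sum>k\<in>{i, j}. scale (if k = i then 1 else - 1) (v k)) = 0" using ij by simp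
    then have "(\<Sum>k\<in>{i, j}. scale (if k = i then 1 else - 1) (v k)) \<in> W" using subspace_0[OF W] by simp
    from independent_modD[OF ind _ _ this, of i] ij(1,2) show False by simp
  qed
  show "independent_mod W (v ` J) (\<lambda>x. x)"
    unfolding independent_mod_def
  proof (intro allI impI)
    fix F c assume F: "finite F" "F \<subseteq> v ` J" "(\<Sum>x\<in>F. scale (c x) x) \<in> W"
    obtain K where K: "K \<subseteq> J" "F = v ` K" using F(2) by (meson subset_image_iff)
    have injK: "inj_on v K" using inj K(1) by (rule inj_on_subset)
    have "finite K" using F(1) K(2) injK by (simp add: finite_image_iff)
    moreover have "(\<Sum>k\<in>K. scale (c (v k)) (v k)) \<in> W" using F(3) unfolding K(2) sum.reindex[OF injK] by simp
    ultimately have "\<forall>k\<in>K. c (v k) = 0"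
      using independent_modD[OF ind _ K(1), of "\<lambda>k. c (v k)"] by blast
    then show "\<forall>x\<in>F. c x = 0" using K(2) by blast
  qed
qed

lemma card_independent_mod_le:
  assumes W: "subspace W" and S: "finite S" "\<And>x. x \<in> V \<Longrightarrow> \<exists>y\<in>span S. x - y \<in> W"
    and B: "B \<subseteq> V" "independent_mod W B (\<lambda>x. x)"
  shows "finite B \<and> card B \<le> card S"
proof -
  have fin: "card B0 \<le> card S" if B0: "finite B0" "B0 \<subseteq> B" for B0
  proof (rule ccontr)
    assume "\<not> card B0 \<le> card S"
    then have lt: "card S < card B0" by simp
    have "\<forall>b\<in>B0. \<exists>u. b - (\<Sum>s\<in>S. scale (u s) s) \<in> W"
    proof
      fix b assume "b \<in> B0"
      then obtain y where y: "y \<in> span S" "b - y \<in> W" using S(2) B0(2) B(1) by blast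
      then obtain u where "y = (\<Sum>s\<in>S. scale (u s) s)" using S(1) by (auto simp: span_finite)
      then show "\<exists>u. b - (\<Sum>s\<in>S. scale (u s) s) \<in> W" using y(2) by blast
    qed
    from bchoice[OF this] obtain u where u': "\<forall>b\<in>B0. b - (\<Sum>s\<in>S. scale (u b s) s) \<in> W" by (rule exE)
    have u: "b - (\<Sum>s\<in>S. scale (u b s) s) \<in> W" if "b \<in> B0" for b by (rule bspec[OF u' that])
    from homogeneous_system[OF S(1) B0(1) lt, of "\<lambda>s b. u b s"]
    obtain c where c': "(\<exists>b\<in>B0. c b \<noteq> 0) \<and> (\<forall>s\<in>S. (\<Sum>b\<in>B0. c b * u b s) = 0)" by (rule exE)
    note c = conjunct1[OF c'] bspec[OF conjunct2[OF c']]
    have "(\<Sum>b\<in>B0. scale (c b) (b - (\<Sum>s\<in>S. scale (u b s) s))) \<in> W"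
      by (intro subspace_sum[OF W] subspace_scale[OF W] u)
    also have "(\<Sum>b\<in>B0. scale (c b) (b - (\<Sum>s\<in>S. scale (u b s) s))) =
        (\<Sum>b\<in>B0. scale (c b) b) - (\<Sum>b\<in>B0. \<Sum>s\<in>S. scale (c b * u b s) s)"
      by (simp add: scale_right_diff_distrib scale_sum_right sum_subtractf)
    also have "(\<Sum>b\<in>B0. \<Sum>s\<in>S. scale (c b * u b s) s) = (\<Sum>s\<in>S. scale (\<Sum>b\<in>B0. c b * u b s) s)"
      by (subst sum.swap) (simp add: scale_sum_left)
    also have "\<dots> = 0" using c(2) by simp
    finally have "(\<Sum>b\<in>B0. scale (c b) b) \<in> W" by simp
    from independent_modD[OF B(2) B0 this] have "\<forall>b\<in>B0. c b = 0" by blast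
    then show False using c(1) by blast
  qed
  have "finite B"
  proof (rule ccontr)
    assume "infinite B"
    from infinite_arbitrarily_large[OF this, of "Suc (card S)"]
    obtain B0 where "B0 \<subseteq> B" "finite B0" "card B0 = Suc (card S)" by blast
    then show False using fin[of B0] by simp
  qed
  then show ?thesis using fin by blast
qed

lemma independent_mod_insert:
  assumes W: "subspace W" and B: "independent_mod W B (\<lambda>x. x)" and x: "\<And>y. y \<in> span B \<Longrightarrow> x - y \<notin> W"
  shows "independent_mod W (insert x B) (\<lambda>x. x)"
  unfolding independent_mod_def
proof (intro allI impI)
  fix F c assume F: "finite F" "F \<subseteq> insert x B" "(\<Sum>i\<in>F. scale (c i) i) \<in> W"
  show "\<forall>i\<in>F. c i = 0"
  proof (cases "x \<in> F")
    case False
    then have "F \<subseteq> B" using F(2) by blast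
    from independent_modD[OF B F(1) this F(3)] show ?thesis by blast
  next
    case True
    let ?s = "\<Sum>i\<in>F - {x}. scale (c i) i"
    have sB: "?s \<in> span B" using F(2) by (intro span_sum span_scale span_base) auto
    have eq: "scale (c x) x + ?s \<in> W" using F(1,3) True by (simp add: sum.remove)
    have cx: "c x = 0"
    proof (rule ccontr)
      assume c: "c x \<noteq> 0"
      have "scale (1 / c x) (scale (c x) x + ?s) \<in> W" by (rule subspace_scale[OF W eq])
      then have "x - scale (- 1 / c x) ?s \<in> W" using c by (simp add: scale_right_distrib)
      then show False using x[OF span_scale[OF sB]] by blast
    qed
    then have "?s \<in> W" using eq by simp
    moreover have "finite (F - {x})" "F - {x} \<subseteq> B" using F(1,2) by auto
    ultimately have "\<forall>i\<in>F - {x}. c i = 0" using independent_modD[OF B] by blast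
    then show ?thesis using cx by blast
  qed
qed

lemma basis_mod_card_unique:
  assumes "subspace W" "basis_mod V W B (\<lambda>x. x)" "basis_mod V W C (\<lambda>x. x)" "finite B"
  shows "finite C \<and> card C = card B"
proof -
  have 1: "finite C \<and> card C \<le> card B"
    by (rule card_independent_mod_le[where V = V, OF assms(1,4)]) (use assms(2,3) in \<open>auto simp: basis_mod_def\<close>)
  then have "finite C" by blast
  have "finite B \<and> card B \<le> card C"
    by (rule card_independent_mod_le[where V = V, OF assms(1) \<open>finite C\<close>]) (use assms(2,3) in \<open>auto simp: basis_mod_def\<close>)
  then show ?thesis using 1 by simp
qed

text \<open>
  Dimension count: another vector could be added to an independent family of full size that fails to span.
\<close>

lemma independent_mod_spans:
  assumes W: "subspace W" and B: "basis_mod V W B (\<lambda>x. x)" "finite B"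
    and J: "finite J" "card J = card B" "v ` J \<subseteq> V" "independent_mod W J v" and x: "x \<in> V"
  shows "\<exists>y\<in>span (v ` J). x - y \<in> W"
proof (rule ccontr)
  assume neg: "\<not> ?thesis"
  have ind: "independent_mod W (insert x (v ` J)) (\<lambda>x. x)"
    by (rule independent_mod_insert[OF W independent_mod_image(2)[OF W J(4)]]) (use neg in blast)
  have "x \<notin> v ` J"
  proof
    assume "x \<in> v ` J"
    then have "x \<in> span (v ` J)" by (rule span_base)
    moreover have "x - x \<in> W" using subspace_0[OF W] by simp
    ultimately show False using neg by blast
  qed
  moreover have "card (v ` J) = card B" using card_image[OF independent_mod_image(1)[OF W J(4)]] J(2) by simp
  ultimately have "card (insert x (v ` J)) = Suc (card B)" using J(1) by simp
  moreover have "card (insert x (v ` J)) \<le> card B"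
    using card_independent_mod_le[OF W B(2) _ _ ind, of V] B(1) J(3) x by (auto simp: basis_mod_def)
  ultimately show False by simp
qed

text \<open>
  An independent subset of the generating set \<open>X\<close> of maximal size is a basis.
\<close>

lemma finite_basis_mod_exists:
  assumes W: "subspace W" and X: "X \<subseteq> V" "V \<subseteq> span X"
    and N: "\<And>B. finite B \<Longrightarrow> B \<subseteq> X \<Longrightarrow> independent_mod W B (\<lambda>x. x) \<Longrightarrow> card B \<le> N"
  obtains B where "finite B" "basis_mod V W B (\<lambda>x. x)"
proof -
  let ?P = "\<lambda>n. \<exists>B. finite B \<and> B \<subseteq> X \<and> independent_mod W B (\<lambda>x. x) \<and> card B = n"
  have P0: "?P 0" by (rule exI[of _ "{}"]) (auto simp: independent_mod_def)
  have bound: "n \<le> N" if "?P n" for n using that N by blast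
  define n where "n = Greatest ?P"
  have n: "?P n" unfolding n_def by (rule GreatestI_nat[where P = ?P and k = 0 and b = N]) (rule P0, rule bound)
  have n_max: "k \<le> n" if "?P k" for k unfolding n_def by (rule Greatest_le_nat[where P = ?P and b = N]) (rule that, rule bound)
  from n obtain B where B: "finite B" "B \<subseteq> X" "independent_mod W B (\<lambda>x. x)" "card B = n" by blast
  have Xs: "\<exists>y\<in>span B. x - y \<in> W" if x: "x \<in> X" for x
  proof (rule ccontr)
    assume neg: "\<not> ?thesis"
    have ind: "independent_mod W (insert x B) (\<lambda>x. x)"
      by (rule independent_mod_insert[OF W B(3)]) (use neg in blast)
    have "x \<notin> B" using neg span_base[of x B] subspace_0[OF W] by force
    then have "card (insert x B) = Suc n" using B by simp
    then have "?P (Suc n)" using B x ind by (intro exI[of _ "insert x B"]) auto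
    then show False using n_max[of "Suc n"] by simp
  qed
  have "subspace {x. \<exists>y\<in>span B. x - y \<in> W}"
  proof (rule subspaceI)
    show "0 \<in> {x. \<exists>y\<in>span B. x - y \<in> W}" using subspace_0[OF W] span_zero by force
  next
    fix a b assume "a \<in> {x. \<exists>y\<in>span B. x - y \<in> W}" "b \<in> {x. \<exists>y\<in>span B. x - y \<in> W}"
    then obtain y z where yz: "y \<in> span B" "a - y \<in> W" "z \<in> span B" "b - z \<in> W" by blast
    have "(a + b) - (y + z) \<in> W" using subspace_add[OF W yz(2,4)] by (simp add: algebra_simps)
    then show "a + b \<in> {x. \<exists>y\<in>span B. x - y \<in> W}" using span_add[OF yz(1,3)] by blast
  next
    fix c a assume "a \<in> {x. \<exists>y\<in>span B. x - y \<in> W}"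
    then obtain y where y: "y \<in> span B" "a - y \<in> W" by blast
    have "scale c a - scale c y \<in> W" using subspace_scale[OF W y(2), of c] by (simp add: scale_right_diff_distrib)
    then show "scale c a \<in> {x. \<exists>y\<in>span B. x - y \<in> W}" using span_scale[OF y(1)] by blast
  qed
  then have "span X \<subseteq> {x. \<exists>y\<in>span B. x - y \<in> W}" by (rule span_minimal[rotated]) (use Xs in blast)
  then have "basis_mod V W B (\<lambda>x. x)" unfolding basis_mod_def using B X by auto
  then show ?thesis using that B(1) by blast
qed

lemma quot_dim_eq_card:
  assumes "subspace W" "basis_mod V W B (\<lambda>x. x)" "finite B"
  shows "quot_dim V W = card B"
proof -
  have "basis_mod V W (SOME B. basis_mod V W B (\<lambda>x. x)) (\<lambda>x. x)" using assms(2) by (rule someI)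
  then have c: "card (SOME B. basis_mod V W B (\<lambda>x. x)) = card B"
    using basis_mod_card_unique[OF assms(1,2) _ assms(3)] by blast
  have ex: "\<exists>B. basis_mod V W B (\<lambda>x. x)" using assms(2) by (rule exI)
  show ?thesis unfolding quot_dim_def if_P[OF ex] by (rule c)
qed

end

lemma graded_sum_apply: "(\<Sum>i\<in>I. F i) k z = (\<Sum>i\<in>I. F i k z)" for F :: "'i \<Rightarrow> nat \<Rightarrow> complex \<Rightarrow> complex"
  by (induction I rule: infinite_finite_induct) auto

lemma homogeneous_apply: "homogeneous l f k z = (if k = l then f z else 0)"
  by (simp add: homogeneous_def)

lemma subspace_graded_sum:
  assumes "\<And>k. form.subspace (V k)"
  shows "graded.subspace (graded_sum V)"
proof (rule graded.subspaceI)
  show "0 \<in> graded_sum V" using form.subspace_0[OF assms] by (simp add: graded_sum_def zero_fun_def)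
next
  fix x y assume xy: "x \<in> graded_sum V" "y \<in> graded_sum V"
  then have "finite ({k. x k \<noteq> 0} \<union> {k. y k \<noteq> 0})" by (simp add: graded_sum_def)
  moreover have "{k. (x + y) k \<noteq> 0} \<subseteq> {k. x k \<noteq> 0} \<union> {k. y k \<noteq> 0}" by (auto simp: fun_eq_iff)
  ultimately have "finite {k. (x + y) k \<noteq> 0}" by (rule finite_subset[rotated])
  then show "x + y \<in> graded_sum V" using xy form.subspace_add[OF assms] by (simp add: graded_sum_def)
next
  fix c x assume x: "x \<in> graded_sum V"
  have "finite {k. (\<lambda>z. c * x k z) \<noteq> 0}"
    by (rule finite_subset[of _ "{k. x k \<noteq> 0}"]) (use x in \<open>auto simp: graded_sum_def fun_eq_iff\<close>)
  then show "(\<lambda>k z. c * x k z) \<in> graded_sum V" using x form.subspace_scale[OF assms] by (simp add: graded_sum_def)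
qed

lemma homogeneous_in_graded_sum:
  assumes "\<And>k. form.subspace (V k)" "f \<in> V l"
  shows "homogeneous l f \<in> graded_sum V"
proof -
  have "finite {k. homogeneous l f k \<noteq> 0}"
    by (rule finite_subset[of _ "{l}"]) (auto simp: homogeneous_def)
  then show ?thesis using assms form.subspace_0[OF assms(1)] by (auto simp: graded_sum_def homogeneous_def)
qed

lemma graded_sum_component: "homogeneous l f \<in> graded_sum V \<Longrightarrow> f \<in> V l"
  by (auto simp: graded_sum_def homogeneous_def dest: spec[of _ l])

lemma sum_homogeneous:
  assumes "\<And>i. i \<in> F \<Longrightarrow> w i = l"
  shows "(\<Sum>i\<in>F. (\<lambda>k z. c i * homogeneous (w i) (A i) k z)) = homogeneous l (\<lambda>z. \<Sum>i\<in>F. c i * A i z)"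
proof (intro ext)
  fix k z
  have "(\<Sum>i\<in>F. (\<lambda>k z. c i * homogeneous (w i) (A i) k z)) k z = (\<Sum>i\<in>F. if k = l then c i * A i z else 0)"
    unfolding graded_sum_apply by (rule sum.cong[OF refl]) (simp add: homogeneous_apply assms)
  then show "(\<Sum>i\<in>F. (\<lambda>k z. c i * homogeneous (w i) (A i) k z)) k z = homogeneous l (\<lambda>z. \<Sum>i\<in>F. c i * A i z) k z"
    by (simp add: homogeneous_apply)
qed

text \<open>
  From here on the group is given by its classes in \<open>PSL(2,\<real>)\<close>, and the spaces of forms are those that carry a growth
  condition.
\<close>

locale fuchsian_quotient = cocompact_fuchsian "\<Union>\<Gamma>" for \<Gamma> :: "(real^2^2) set set"
begin

lemma modular_forms_eq:
  assumes k: "k \<ge> 0"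
  shows "modular_forms \<Gamma> k = MF k"
proof (intro equalityI subsetI)
  fix f assume "f \<in> modular_forms \<Gamma> k"
  then show "f \<in> MF k" unfolding modular_forms_def MF_def mem_Collect_eq by (elim conjE) (intro conjI)
next
  fix f assume f: "f \<in> MF k"
  have "moderate_growth f" by (rule MF_moderate_growth[OF f k])
  then show "f \<in> modular_forms \<Gamma> k"
    using f unfolding modular_forms_def MF_def mem_Collect_eq by (elim conjE) (intro conjI)
qed

lemma quasimodular_forms_eq: "quasimodular_forms \<Gamma> k = QF k"
proof (intro equalityI subsetI)
  fix f assume "f \<in> quasimodular_forms \<Gamma> k"
  then obtain p \<phi> where f: "\<forall>z. z \<notin> \<H> \<longrightarrow> f z = 0" "f holomorphic_on \<H>"
    and \<phi>: "\<And>A z. A \<in> \<Union>\<Gamma> \<Longrightarrow> z \<in> \<H> \<Longrightarrow> automorphy A z powi (- k) * f (moebius A z) =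
        (\<Sum>j\<le>p. \<phi> j z * (of_real (A$2$1) / automorphy A z) ^ j)"
    unfolding quasimodular_forms_def quasimodular_forms_depth_def by blast
  have "quasi k f (\<lambda>z. \<Sum>j\<le>p. monom (\<phi> j z) j)"
    unfolding quasi_def
  proof (intro conjI exI[of _ p] ballI)
    show "degree (\<Sum>j\<le>p. monom (\<phi> j z) j) \<le> p" for z
      by (intro degree_sum_le) (auto intro: order_trans[OF degree_monom_le])
    fix A z assume "A \<in> \<Union>\<Gamma>" "z \<in> \<H>"
    from \<phi>[OF this] show "automorphy A z powi (- k) * f (moebius A z) = poly (\<Sum>j\<le>p. monom (\<phi> j z) j) (cocycle A z)"
      by (simp add: poly_sum poly_monom cocycle_def)
  qed
  then show "f \<in> QF k" using f by (auto simp: QF_def)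
next
  fix f assume f: "f \<in> QF k"
  obtain Q where Q: "quasi k f Q" using f by (rule QF_quasi)
  obtain p where p: "\<And>z. z \<in> \<H> \<Longrightarrow> degree (Q z) \<le> p" using Q unfolding quasi_def by blast
  have eq: "automorphy A z powi (- k) * f (moebius A z) = (\<Sum>j\<le>p. coeff (Q z) j * (of_real (A$2$1) / automorphy A z) ^ j)"
    if "A \<in> \<Union>\<Gamma>" "z \<in> \<H>" for A z
  proof -
    have "poly (\<Sum>j\<le>p. monom (coeff (Q z) j) j) (cocycle A z) = (\<Sum>j\<le>p. coeff (Q z) j * (of_real (A$2$1) / automorphy A z) ^ j)"
      by (simp add: poly_sum poly_monom cocycle_def)
    then show ?thesis unfolding quasi_eq[OF Q that] poly_as_sum_of_monoms'[OF p[OF that(2)]] .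
  qed
  have "f \<in> quasimodular_forms_depth \<Gamma> k p"
    unfolding quasimodular_forms_depth_def
    by (intro CollectI conjI exI[of _ "\<lambda>j z. coeff (Q z) j"] ballI eq QF_moderate_growth[OF f])
       (use QF_D[OF f] in auto)
  then show "f \<in> quasimodular_forms \<Gamma> k" unfolding quasimodular_forms_def by blast
qed

abbreviation Isq :: "nat \<Rightarrow> (complex \<Rightarrow> complex) set" where
  "Isq \<equiv> I_tilde_sq_part \<Gamma>"

lemma subspace_Isq: "form.subspace (Isq k)"
  unfolding I_tilde_sq_part_def by (rule form.subspace_span)

lemma Isq_mult: "f \<in> QF (int j) \<Longrightarrow> g \<in> QF (int l) \<Longrightarrow> j > 0 \<Longrightarrow> l > 0 \<Longrightarrow> f * g \<in> Isq (j + l)"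
  unfolding I_tilde_sq_part_def quasimodular_forms_eq
  by (rule form.span_base, rule CollectI, rule exI[of _ f], rule exI[of _ g], rule exI[of _ j]) simp

lemma Isq_induct:
  assumes "\<And>f g j l. f \<in> QF (int j) \<Longrightarrow> g \<in> QF (int l) \<Longrightarrow> j > 0 \<Longrightarrow> l > 0 \<Longrightarrow> j + l = k \<Longrightarrow> f * g \<in> S"
    and "form.subspace S"
  shows "Isq k \<subseteq> S"
  unfolding I_tilde_sq_part_def quasimodular_forms_eq
proof (rule form.span_minimal[OF _ assms(2)], safe)
  fix f g j assume "0 < j" "j < k" "f \<in> QF (int j)" "g \<in> QF (int (k - j))"
  then show "f * g \<in> S" using assms(1)[of f j g "k - j"] by simp
qed

lemma Isq_QF: "Isq k \<subseteq> QF (int k)"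
proof (rule Isq_induct[OF _ subspace_QF])
  fix f g j l assume fg: "f \<in> QF (int j)" "g \<in> QF (int l)" "j + l = k"
  have "int j + int l = int k" using fg(3) by simp
  then show "f * g \<in> QF (int k)" using QF_mult[OF fg(1,2)] by simp
qed

lemma D_Isq: "x \<in> Isq k \<Longrightarrow> D x \<in> Isq (k + 2)"
proof -
  let ?S = "{x\<in>QF (int k). D x \<in> Isq (k + 2)}"
  have DQ: "D f \<in> QF (int (j + 2))" if "f \<in> QF (int j)" for f j
  proof -
    have "int (j + 2) = int j + 2" by simp
    then show ?thesis using D_QF[OF that] by metis
  qed
  have "Isq k \<subseteq> ?S"
  proof (rule Isq_induct)
    fix f g j l assume fg: "f \<in> QF (int j)" "g \<in> QF (int l)" "j > 0" "l > 0" "j + l = k"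
    have "D f * g \<in> Isq ((j + 2) + l)" by (rule Isq_mult[OF DQ[OF fg(1)] fg(2)]) (use fg in simp_all)
    moreover have "f * D g \<in> Isq (j + (l + 2))" by (rule Isq_mult[OF fg(1) DQ[OF fg(2)]]) (use fg in simp_all)
    ultimately have "D f * g + f * D g \<in> Isq (k + 2)" using fg(5) by (intro form.subspace_add[OF subspace_Isq]) (simp_all add: add_ac)
    then have "D (f * g) \<in> Isq (k + 2)" using D_mult[OF QF_D(2)[OF fg(1)] QF_D(2)[OF fg(2)]] by simp
    then show "f * g \<in> ?S" using QF_mult[OF fg(1,2)] fg(5) by auto
  next
    show "form.subspace ?S"
    proof (rule form.subspaceI)
      show "0 \<in> ?S" using QF_zero form.subspace_0[OF subspace_Isq] by simp
      show "x + y \<in> ?S" if "x \<in> ?S" "y \<in> ?S" for x y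
        using that QF_add form.subspace_add[OF subspace_Isq] D_add[of x y] QF_D(2) by auto
      show "(\<lambda>z. c * x z) \<in> ?S" if "x \<in> ?S" for c x
        using that QF_scale form.subspace_scale[OF subspace_Isq] D_scale[of x c] QF_D(2) by auto
    qed
  qed
  then show "x \<in> Isq k \<Longrightarrow> D x \<in> Isq (k + 2)" by blast
qed

lemma D_pow_Isq: "x \<in> Isq k \<Longrightarrow> (D ^^ n) x \<in> Isq (k + 2 * n)"
proof (induction n)
  case (Suc n)
  have "D ((D ^^ n) x) \<in> Isq ((k + 2 * n) + 2)" by (rule D_Isq[OF Suc.IH[OF Suc.prems]])
  then show ?case by simp
qed simp

text \<open>
  By the Leibniz rule, lowering a product lowers one factor. The result is again a product of factors of positive weight, unless
  the lowered factor had weight at most two; but then it is modular and lowering annihilates it.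
\<close>

lemma lower_Isq: "x \<in> Isq k \<Longrightarrow> lower (int k) x \<in> Isq (k - 2)"
proof -
  let ?S = "{x\<in>QF (int k). lower (int k) x \<in> Isq (k - 2)}"
  have z: "0 \<in> Isq i" for i by (rule form.subspace_0[OF subspace_Isq])
  have half: "lower (int j) f * g \<in> Isq (j + l - 2)"
    if fg: "f \<in> QF (int j)" "g \<in> QF (int l)" "j > 0" "l > 0" for f g j l
  proof (cases "j \<le> 2")
    case True
    then have "f \<in> MF (int j)" using fg(1) QF_low_weight[of "int j"] by simp
    then have "lower (int j) f * g = 0" using lower_MF by (simp add: fun_eq_iff)
    then show ?thesis using z by simp
  next
    case False
    have "int j - 2 = int (j - 2)" using False by simp
    then have "lower (int j) f \<in> QF (int (j - 2))" using lower_QF[OF fg(1)] by metis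
    then have "lower (int j) f * g \<in> Isq ((j - 2) + l)" using fg False by (intro Isq_mult) auto
    then show ?thesis using False by simp
  qed
  have "Isq k \<subseteq> ?S"
  proof (rule Isq_induct)
    fix f g j l assume fg: "f \<in> QF (int j)" "g \<in> QF (int l)" "j > 0" "l > 0" "j + l = k"
    have "lower (int j) f * g \<in> Isq (k - 2)" using half[OF fg(1-4)] fg(5) by simp
    moreover have "f * lower (int l) g \<in> Isq (k - 2)"
      using half[OF fg(2,1,4,3)] fg(5) by (simp add: mult.commute add.commute)
    ultimately have "lower (int j + int l) (f * g) \<in> Isq (k - 2)"
      unfolding lower_mult[OF fg(1,2)] by (rule form.subspace_add[OF subspace_Isq])
    then show "f * g \<in> ?S" using QF_mult[OF fg(1,2)] fg(5) by auto
  next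
    show "form.subspace ?S"
    proof (rule form.subspaceI)
      show "0 \<in> ?S" using QF_zero z by simp
      show "x + y \<in> ?S" if "x \<in> ?S" "y \<in> ?S" for x y
        using that QF_add form.subspace_add[OF subspace_Isq] lower_add by auto
      show "(\<lambda>z. c * x z) \<in> ?S" if "x \<in> ?S" for c x
        using that QF_scale form.subspace_scale[OF subspace_Isq] lower_scale by auto
    qed
  qed
  then show "x \<in> Isq k \<Longrightarrow> lower (int k) x \<in> Isq (k - 2)" by blast
qed

lemma lowern_Isq: "x \<in> Isq k \<Longrightarrow> 2 * n \<le> k \<Longrightarrow> lowern n (int k) x \<in> Isq (k - 2 * n)"
proof (induction n)
  case (Suc n)
  have w: "int k - 2 * int n = int (k - 2 * n)" using Suc.prems by simp
  have "lowern n (int k) x \<in> Isq (k - 2 * n)" using Suc by simp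
  then have lw: "lower (int (k - 2 * n)) (lowern n (int k) x) \<in> Isq (k - 2 * n - 2)" by (rule lower_Isq)
  have e: "k - 2 * n - 2 = k - 2 * Suc n" by simp
  show ?case unfolding lowern.simps(2) w using lw unfolding e .
qed simp

lemma D_pow_add: "f holomorphic_on \<H> \<Longrightarrow> g holomorphic_on \<H> \<Longrightarrow> (D ^^ n) (f + g) = (D ^^ n) f + (D ^^ n) g"
  by (induction n) (simp_all add: D_add D_pow_holomorphic)

lemma D_pow_scale: "f holomorphic_on \<H> \<Longrightarrow> (D ^^ n) (\<lambda>z. c * f z) = (\<lambda>z. c * (D ^^ n) f z)"
  by (induction n) (simp_all add: D_scale D_pow_holomorphic)

lemma D_pow_sum:
  assumes "finite F" "\<And>i. i \<in> F \<Longrightarrow> f i holomorphic_on \<H>"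
  shows "(D ^^ n) (\<lambda>z. \<Sum>i\<in>F. c i * f i z) = (\<lambda>z. \<Sum>i\<in>F. c i * (D ^^ n) (f i) z)"
  using assms
proof (induction F rule: finite_induct)
  case empty
  have "(D ^^ n) 0 = 0" by (induction n) (simp_all only: funpow.simps id_apply o_apply D_zero)
  then show ?case by (simp add: zero_fun_def)
next
  case (insert i F)
  have h: "(\<lambda>z. c i * f i z) holomorphic_on \<H>" "(\<lambda>z. \<Sum>i\<in>F. c i * f i z) holomorphic_on \<H>"
    using insert.prems by (auto intro!: holomorphic_intros)
  have "(\<lambda>z. \<Sum>i\<in>insert i F. c i * f i z) = (\<lambda>z. c i * f i z) + (\<lambda>z. \<Sum>i\<in>F. c i * f i z)"
    using insert.hyps by (simp add: fun_eq_iff)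
  then have "(D ^^ n) (\<lambda>z. \<Sum>i\<in>insert i F. c i * f i z) = (\<lambda>z. c i * (D ^^ n) (f i) z) + (\<lambda>z. \<Sum>i\<in>F. c i * (D ^^ n) (f i) z)"
    using D_pow_add[OF h] D_pow_scale insert by simp
  then show ?case using insert.hyps by (simp add: fun_eq_iff)
qed

text \<open>
  Lowering as often as the largest \<open>j\<close> that occurs annihilates all other terms and leaves a nonzero multiple of that \<open>B j\<close>. Its
  derivative is decomposable as well and can be subtracted.
\<close>

lemma Isq_components:
  assumes "finite J" "\<And>j. j \<in> J \<Longrightarrow> 2 * j < k" "\<And>j. j \<in> J \<Longrightarrow> B j \<in> MF (int (k - 2 * j))"
    and "(\<Sum>j\<in>J. (D ^^ j) (B j)) \<in> Isq k"
  shows "\<forall>j\<in>J. B j \<in> Isq (k - 2 * j)"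
  using assms
proof (induction J rule: finite_linorder_max_induct)
  case (insert p J)
  have w: "int (k - 2 * j) + 2 * int j = int k" if "j \<in> insert p J" for j
  proof -
    have "2 * j < k" using insert.prems(1) that by blast
    then show ?thesis by simp
  qed
  have Q: "(D ^^ j) (B j) \<in> QF (int k)" if "j \<in> insert p J" for j
    using D_pow_QF[OF MF_QF[OF insert.prems(2)[OF that]], of j] unfolding w[OF that] .
  let ?R = "\<Sum>j\<in>J. (D ^^ j) (B j)"
  have RQ: "?R \<in> QF (int k)" by (rule form.subspace_sum[OF subspace_QF]) (use Q in blast)
  have "p \<notin> J" using insert.hyps by blast
  have tot: "(D ^^ p) (B p) + ?R \<in> Isq k" using insert.prems(3) unfolding sum.insert[OF insert.hyps(1) \<open>p \<notin> J\<close>] .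
  have "lowern p (int k) ?R = (\<Sum>j\<in>J. lowern p (int k) ((D ^^ j) (B j)))"
    using insert.hyps(1) Q
  proof (induction J rule: finite_induct)
    case (insert x J)
    have "lowern p (int k) ((D ^^ x) (B x) + (\<Sum>j\<in>J. (D ^^ j) (B j))) = lowern p (int k) ((D ^^ x) (B x)) + lowern p (int k) (\<Sum>j\<in>J. (D ^^ j) (B j))"
      by (rule lowern_add) (use insert.prems in \<open>auto intro!: form.subspace_sum[OF subspace_QF]\<close>)
    also have "lowern p (int k) (\<Sum>j\<in>J. (D ^^ j) (B j)) = (\<Sum>j\<in>J. lowern p (int k) ((D ^^ j) (B j)))"
      by (rule insert.IH) (use insert.prems in blast)
    finally show ?case unfolding sum.insert[OF insert.hyps] .
  next
    case empty
    show ?case by (simp only: sum.empty lowern_0)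
  qed
  also have "\<dots> = 0"
  proof (rule sum.neutral, rule ballI)
    fix j assume j: "j \<in> J"
    then have jp: "j < p" using insert.hyps by blast
    have j': "j \<in> insert p J" using j by blast
    show "lowern p (int k) ((D ^^ j) (B j)) = 0"
      using lowern_above[OF insert.prems(2)[OF j'] jp] unfolding w[OF j'] .
  qed
  finally have R0: "lowern p (int k) ?R = 0" .
  have kp: "2 * p < k" using insert.prems(1) by blast
  obtain c where c: "c \<noteq> 0" "lowern p (int k) ((D ^^ p) (B p)) = (\<lambda>z. c * B p z)"
  proof (rule lowern_top[OF insert.prems(2)[of p], of p])
    show "0 < int (k - 2 * p)" using kp by simp
    fix c assume "c \<noteq> 0" "lowern p (int (k - 2 * p) + 2 * int p) ((D ^^ p) (B p)) = (\<lambda>z. c * B p z)"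
    then show thesis using that[of c] w[of p] by simp
  qed simp
  have "lowern p (int k) ((D ^^ p) (B p) + ?R) \<in> Isq (k - 2 * p)"
    by (rule lowern_Isq[OF tot]) (use kp in simp)
  then have "(\<lambda>z. c * B p z) + 0 \<in> Isq (k - 2 * p)"
    unfolding lowern_add[OF Q[OF insertI1] RQ] c(2) R0 .
  then have "(\<lambda>z. (1 / c) * (c * B p z)) \<in> Isq (k - 2 * p)"
    using form.subspace_scale[OF subspace_Isq, of "\<lambda>z. c * B p z" "k - 2 * p" "1 / c"] by simp
  moreover have "(\<lambda>z. (1 / c) * (c * B p z)) = B p" using c(1) by (simp add: fun_eq_iff)
  ultimately have Bp: "B p \<in> Isq (k - 2 * p)" by simp
  have "(D ^^ p) (B p) \<in> Isq ((k - 2 * p) + 2 * p)" by (rule D_pow_Isq[OF Bp])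
  then have "(D ^^ p) (B p) \<in> Isq k" using kp by simp
  then have "((D ^^ p) (B p) + ?R) - (D ^^ p) (B p) \<in> Isq k" by (rule form.subspace_diff[OF subspace_Isq tot])
  then have "?R \<in> Isq k" by simp
  then have "\<forall>j\<in>J. B j \<in> Isq (k - 2 * j)" using insert.prems by (intro insert.IH) auto
  then show ?case using Bp by blast
qed simp

end

section \<open>Finiteness of the space of generators\<close>

context fuchsian_quotient
begin

definition quot_relations :: "(nat \<Rightarrow> complex \<Rightarrow> complex) set" where
  "quot_relations = I_ideal \<Gamma> \<inter> I_tilde_sq \<Gamma>"

lemma I_part_eq: "I_part \<Gamma> l = (if l > 0 then MF (int l) else {0})"
  by (simp add: I_part_def modular_forms_eq)

lemma subspace_I_part: "form.subspace (I_part \<Gamma> l)"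
  unfolding I_part_eq using subspace_MF by (auto intro!: form.subspaceI)

lemma subspace_I_ideal: "graded.subspace (I_ideal \<Gamma>)"
  unfolding I_ideal_def by (rule subspace_graded_sum[OF subspace_I_part])

lemma subspace_I_tilde_sq: "graded.subspace (I_tilde_sq \<Gamma>)"
  unfolding I_tilde_sq_def by (rule subspace_graded_sum[OF subspace_Isq])

lemma subspace_quot_relations: "graded.subspace quot_relations"
  unfolding quot_relations_def by (rule graded.subspace_inter[OF subspace_I_ideal subspace_I_tilde_sq])

lemma homogeneous_in_quot_relations:
  assumes "l > 0" "f \<in> MF (int l)" "f \<in> Isq l"
  shows "homogeneous l f \<in> quot_relations"
  unfolding quot_relations_def I_ideal_def I_tilde_sq_def
  using homogeneous_in_graded_sum[of "I_part \<Gamma>", OF subspace_I_part, of f l]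
    homogeneous_in_graded_sum[of "I_tilde_sq_part \<Gamma>", OF subspace_Isq, of f l] assms
  by (simp add: I_part_eq)

definition homogeneous_forms :: "(nat \<Rightarrow> complex \<Rightarrow> complex) set" where
  "homogeneous_forms = {homogeneous l h | l h. l > 0 \<and> h \<in> MF (int l)}"

lemma homogeneous_forms_subset: "homogeneous_forms \<subseteq> I_ideal \<Gamma>"
  unfolding homogeneous_forms_def I_ideal_def
  using homogeneous_in_graded_sum[of "I_part \<Gamma>", OF subspace_I_part] by (auto simp: I_part_eq)

lemma I_ideal_subset_span: "I_ideal \<Gamma> \<subseteq> graded.span homogeneous_forms"
proof
  fix F assume F: "F \<in> I_ideal \<Gamma>"
  let ?K = "{k. F k \<noteq> 0}"
  have fin: "finite ?K" and Fk: "\<And>k. F k \<in> I_part \<Gamma> k" using F by (auto simp: I_ideal_def graded_sum_def)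
  have "F = (\<Sum>k\<in>?K. homogeneous k (F k))"
  proof (intro ext)
    fix k z
    have "(\<Sum>j\<in>?K. homogeneous j (F j)) k z = (\<Sum>j\<in>?K. if j = k then F j z else 0)"
      unfolding graded_sum_apply by (intro sum.cong refl) (auto simp: homogeneous_apply)
    also have "\<dots> = F k z" using fin by (auto simp: fun_eq_iff)
    finally show "F k z = (\<Sum>j\<in>?K. homogeneous j (F j)) k z" ..
  qed
  moreover have "(\<Sum>k\<in>?K. homogeneous k (F k)) \<in> graded.span homogeneous_forms"
  proof (rule graded.span_sum, rule graded.span_base)
    fix k assume k: "k \<in> ?K"
    then have "k > 0" "F k \<in> MF (int k)" using Fk[of k] by (auto simp: I_part_eq split: if_splits)
    then show "homogeneous k (F k) \<in> homogeneous_forms" unfolding homogeneous_forms_def by blast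
  qed
  ultimately show "F \<in> graded.span homogeneous_forms" by simp
qed

text \<open>
  In weights larger than that of \<open>F\<close>, the multiples of \<open>F\<close> and of \<open>g\<close> are products of two forms of positive
  weight, so \<open>card_independent_mod_pair\<close> applies in each residue class of weights. The finitely many remaining weights are covered by
  \<open>card_independent_low_weight\<close>.
\<close>

lemma card_independent_bound:
  "\<exists>N. \<forall>B. finite B \<longrightarrow> B \<subseteq> homogeneous_forms \<longrightarrow> graded.independent_mod quot_relations B (\<lambda>x. x) \<longrightarrow> card B \<le> N"
proof (cases "\<exists>k f. k > 0 \<and> f \<in> MF k \<and> f \<noteq> 0")
  case False
  have "B = {}" if B: "B \<subseteq> homogeneous_forms" "graded.independent_mod quot_relations B (\<lambda>x. x)" for B
  proof (rule ccontr)
    assume "B \<noteq> {}"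
    then obtain b where b: "b \<in> B" by blast
    then obtain l h where lh: "b = homogeneous l h" "l > 0" "h \<in> MF (int l)" using B(1) unfolding homogeneous_forms_def by blast
    have "int l > 0" using lh(2) by simp
    then have "h = 0" using False lh(3) by blast
    then have "(\<Sum>x\<in>{b}. (\<lambda>k z. 1 * x k z)) = 0" unfolding lh(1) by (auto simp: fun_eq_iff homogeneous_apply)
    then have "(\<Sum>x\<in>{b}. (\<lambda>k z. (1::complex) * x k z)) \<in> quot_relations"
      using graded.subspace_0[OF subspace_quot_relations] by (simp only:)
    from graded.independent_modD[OF B(2) _ _ this, of b] b show False by simp
  qed
  then show ?thesis by (intro exI[of _ 0]) auto
next
  case True
  then obtain k f where f: "k > 0" "f \<in> MF k" "f \<noteq> 0" by blast
  show ?thesis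
  proof (rule MF_pair_without_common_zeros[OF f(2,3,1)])
    fix m F g assume m: "m > 0" and F: "F \<in> MF m" "F \<noteq> 0" and g: "g \<in> MF m"
      and nocz: "\<And>z. z \<in> \<H> \<Longrightarrow> F z \<noteq> 0 \<or> g z \<noteq> 0"
    have F2: "F * F \<in> MF (m + m)" "F * F \<noteq> 0"
    proof -
      show "F * F \<in> MF (m + m)" by (rule MF_mult[OF F(1) F(1)])
      obtain z where "F z \<noteq> 0" using MF_nonzero[OF F] by blast
      then have "(F * F) z \<noteq> 0" by simp
      then show "F * F \<noteq> 0" by (metis zero_fun_apply)
    qed
    show ?thesis
    proof (rule card_independent_mod_pair[where 'j = "nat \<Rightarrow> complex \<Rightarrow> complex", OF m F g])
      show "F z \<noteq> 0 \<or> g z \<noteq> 0" if "z \<in> \<H>" for z by (rule nocz[OF that])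
    next
      fix N1
      assume N1: "\<And>J (h :: (nat \<Rightarrow> complex \<Rightarrow> complex) \<Rightarrow> complex \<Rightarrow> complex) \<kappa> a. finite J \<Longrightarrow> (\<And>j. j \<in> J \<Longrightarrow> h j \<in> MF (\<kappa> j)) \<Longrightarrow>
        (\<And>j. j \<in> J \<Longrightarrow> \<kappa> j mod m = a) \<Longrightarrow>
        (\<And>c l P Q. l \<in> \<kappa> ` J \<Longrightarrow> P \<in> MF (l - m) \<Longrightarrow> Q \<in> MF (l - m) \<Longrightarrow>
           (\<And>z. (\<Sum>j\<in>{j\<in>J. \<kappa> j = l}. c j * h j z) = F z * P z + g z * Q z) \<Longrightarrow> \<forall>j\<in>{j\<in>J. \<kappa> j = l}. c j = 0) \<Longrightarrow>
        card J \<le> N1"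
      show ?thesis
      proof (rule card_independent_low_weight[where 'j = "nat \<Rightarrow> complex \<Rightarrow> complex", OF F2])
        fix N2
        assume N2: "\<And>J (h :: (nat \<Rightarrow> complex \<Rightarrow> complex) \<Rightarrow> complex \<Rightarrow> complex) k. finite J \<Longrightarrow> k < m + m \<Longrightarrow> (\<And>j. j \<in> J \<Longrightarrow> h j \<in> MF k) \<Longrightarrow>
          (\<And>c. (\<And>z. (\<Sum>j\<in>J. c j * h j z) = 0) \<Longrightarrow> \<forall>j\<in>J. c j = 0) \<Longrightarrow> card J \<le> N2"
        show ?thesis
        proof (intro exI[of _ "nat m * N2 + nat m * N1"] allI impI)
          fix B
          assume B: "finite B" "B \<subseteq> homogeneous_forms" and ind: "graded.independent_mod quot_relations B (\<lambda>x. x)"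
          have "\<forall>b\<in>B. \<exists>l. l > 0 \<and> b l \<in> MF (int l) \<and> b = homogeneous l (b l)"
          proof
            fix b assume "b \<in> B"
            then obtain l h where lh: "b = homogeneous l h" "l > 0" "h \<in> MF (int l)" using B(2) unfolding homogeneous_forms_def by blast
            have "b l = h" unfolding lh(1) by (simp add: homogeneous_def)
            then show "\<exists>l. l > 0 \<and> b l \<in> MF (int l) \<and> b = homogeneous l (b l)" using lh by blast
          qed
          from bchoice[OF this] obtain w where w': "\<forall>b\<in>B. w b > 0 \<and> b (w b) \<in> MF (int (w b)) \<and> b = homogeneous (w b) (b (w b))" by (rule exE)
          define h where "h b = b (w b)" for b
          have w: "w b > 0" "h b \<in> MF (int (w b))" "b = homogeneous (w b) (h b)" if "b \<in> B" for b
            using bspec[OF w' that] by (simp_all only: h_def)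
          have rel: "\<forall>b\<in>K. c b = 0"
            if K: "K \<subseteq> B" "\<And>b. b \<in> K \<Longrightarrow> w b = l" and l: "l > 0" and s: "(\<lambda>z. \<Sum>b\<in>K. c b * h b z) \<in> Isq l" for K l c
          proof
            fix b assume b: "b \<in> K"
            have fK: "finite K" using K(1) B(1) finite_subset by blast
            have M: "(\<lambda>z. \<Sum>b\<in>K. c b * h b z) \<in> MF (int l)" by (rule MF_sum) (use w(2) K in force)
            have "(\<Sum>b\<in>K. (\<lambda>k z. c b * b k z)) = (\<Sum>b\<in>K. (\<lambda>k z. c b * homogeneous (w b) (h b) k z))"
            proof (rule sum.cong[OF refl])
              fix x assume "x \<in> K"
              then have "x = homogeneous (w x) (h x)" using w(3) K(1) by blast
              then show "(\<lambda>k z. c x * x k z) = (\<lambda>k z. c x * homogeneous (w x) (h x) k z)"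
                by (rule arg_cong[where f = "\<lambda>y k z. c x * y k z"])
            qed
            also have "\<dots> = homogeneous l (\<lambda>z. \<Sum>b\<in>K. c b * h b z)" by (rule sum_homogeneous) (rule K(2))
            also have "\<dots> \<in> quot_relations" by (rule homogeneous_in_quot_relations[OF l M s])
            finally show "c b = 0" using graded.independent_modD[OF ind fK K(1) _ b] by simp
          qed
          define Lo where "Lo l = {b\<in>B. w b = l}" for l
          define Hi where "Hi a = {b\<in>B. int (w b) > m \<and> int (w b) mod m = a}" for a
          have "card (Lo l) \<le> N2" if l: "l \<in> {1..nat m}" for l
          proof (rule N2[where h = h and k = "int l"])
            show "finite (Lo l)" using B(1) by (simp add: Lo_def)
            show "int l < m + m" using l m by auto
            show "h b \<in> MF (int l)" if "b \<in> Lo l" for b using that w(2) by (auto simp: Lo_def)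
            fix c assume c: "\<And>z. (\<Sum>b\<in>Lo l. c b * h b z) = 0"
            show "\<forall>b\<in>Lo l. c b = 0"
            proof (rule rel[of _ l])
              have "(\<lambda>z. \<Sum>b\<in>Lo l. c b * h b z) = 0" using c by (simp add: fun_eq_iff)
              then show "(\<lambda>z. \<Sum>b\<in>Lo l. c b * h b z) \<in> Isq l" using form.subspace_0[OF subspace_Isq] by (simp only:)
            qed (use l in \<open>auto simp: Lo_def\<close>)
          qed
          from sum_bounded_above[of "{1..nat m}" "\<lambda>l. card (Lo l)" N2, OF this]
          have lo: "(\<Sum>l\<in>{1..nat m}. card (Lo l)) \<le> nat m * N2" by simp
          have "card (Hi a) \<le> N1" for a
          proof (rule N1[where h = h and \<kappa> = "\<lambda>b. int (w b)" and a = a])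
            show "finite (Hi a)" using B(1) by (simp add: Hi_def)
            show "h b \<in> MF (int (w b))" if "b \<in> Hi a" for b using that w(2) by (auto simp: Hi_def)
            show "int (w b) mod m = a" if "b \<in> Hi a" for b using that by (simp add: Hi_def)
            fix c l P Q
            assume l: "l \<in> (\<lambda>b. int (w b)) ` Hi a" and P: "P \<in> MF (l - m)" and Q: "Q \<in> MF (l - m)"
              and eq: "\<And>z. (\<Sum>b\<in>{b\<in>Hi a. int (w b) = l}. c b * h b z) = F z * P z + g z * Q z"
            obtain l' where l': "l = int l'" "l > m" using l by (auto simp: Hi_def)
            have nm: "int (nat m) = m" "int (l' - nat m) = l - m" "nat m + (l' - nat m) = l'" using m l' by auto
            show "\<forall>b\<in>{b\<in>Hi a. int (w b) = l}. c b = 0"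
            proof (rule rel[of _ l'])
              have "F * P \<in> Isq (nat m + (l' - nat m))"
                by (rule Isq_mult) (use MF_QF[OF F(1)] MF_QF[OF P] nm m l' in auto)
              moreover have "g * Q \<in> Isq (nat m + (l' - nat m))"
                by (rule Isq_mult) (use MF_QF[OF g] MF_QF[OF Q] nm m l' in auto)
              ultimately have "F * P + g * Q \<in> Isq l'" unfolding nm(3) by (rule form.subspace_add[OF subspace_Isq])
              moreover have "F * P + g * Q = (\<lambda>z. \<Sum>b\<in>{b\<in>Hi a. int (w b) = l}. c b * h b z)" using eq by (simp add: fun_eq_iff)
              ultimately show "(\<lambda>z. \<Sum>b\<in>{b\<in>Hi a. int (w b) = l}. c b * h b z) \<in> Isq l'" by simp
            qed (use l' m in \<open>auto simp: Hi_def\<close>)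
          qed
          from sum_bounded_above[of "{0..<m}" "\<lambda>a. card (Hi a)" N1, OF this]
          have hi: "(\<Sum>a\<in>{0..<m}. card (Hi a)) \<le> nat m * N1" by simp
          have "B \<subseteq> (\<Union>l\<in>{1..nat m}. Lo l) \<union> (\<Union>a\<in>{0..<m}. Hi a)"
          proof
            fix b assume b: "b \<in> B"
            show "b \<in> (\<Union>l\<in>{1..nat m}. Lo l) \<union> (\<Union>a\<in>{0..<m}. Hi a)"
            proof (cases "int (w b) > m")
              case True
              then have "b \<in> Hi (int (w b) mod m)" using b by (simp add: Hi_def)
              moreover have "int (w b) mod m \<in> {0..<m}" using m by simp
              ultimately show ?thesis by blast
            next
              case False
              then have "w b \<in> {1..nat m}" using w(1)[OF b] m by auto
              moreover have "b \<in> Lo (w b)" using b by (simp add: Lo_def)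
              ultimately show ?thesis by blast
            qed
          qed
          then have "card B \<le> card ((\<Union>l\<in>{1..nat m}. Lo l) \<union> (\<Union>a\<in>{0..<m}. Hi a))"
            by (rule card_mono[rotated]) (use B(1) in \<open>auto simp: Lo_def Hi_def\<close>)
          also have "\<dots> \<le> card (\<Union>l\<in>{1..nat m}. Lo l) + card (\<Union>a\<in>{0..<m}. Hi a)" by (rule card_Un_le)
          also have "\<dots> \<le> (\<Sum>l\<in>{1..nat m}. card (Lo l)) + (\<Sum>a\<in>{0..<m}. card (Hi a))"
            by (intro add_mono card_UN_le) auto
          also have "\<dots> \<le> nat m * N2 + nat m * N1" using lo hi by (rule add_mono)
          finally show "card B \<le> nat m * N2 + nat m * N1" .
        qed
      qed
    qed
  qed
qed

lemma finite_quotient_basis: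
  obtains B where "finite B" "graded.basis_mod (I_ideal \<Gamma>) quot_relations B (\<lambda>x. x)"
proof -
  from card_independent_bound obtain N where
    N: "\<forall>B. finite B \<longrightarrow> B \<subseteq> homogeneous_forms \<longrightarrow> graded.independent_mod quot_relations B (\<lambda>x. x) \<longrightarrow> card B \<le> N" by (rule exE)
  show ?thesis
    by (rule graded.finite_basis_mod_exists[OF subspace_quot_relations homogeneous_forms_subset I_ideal_subset_span, of N])
       (use N that in blast)+
qed

end

section \<open>Bases modulo decomposable forms\<close>

lemma (in vector_space_quotient) independent_mod_antimono:
  "independent_mod W J v \<Longrightarrow> W' \<subseteq> W \<Longrightarrow> independent_mod W' J v"
  unfolding independent_mod_def by (meson subsetD)

theorem theorem5:
  fixes \<Gamma> :: "(real^2^2) set set"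
    and \<epsilon> :: nat
    and w :: "nat \<Rightarrow> nat"
    and A :: "nat \<Rightarrow> complex \<Rightarrow> complex"
    and k :: nat
  assumes "discrete_subgroup \<Gamma>" and "cocompact_subgroup \<Gamma>"
    and "\<epsilon> = graded.quot_dim (I_ideal \<Gamma>) (I_ideal \<Gamma> \<inter> I_tilde_sq \<Gamma>)"
    and "\<And>i. i \<in> {1..\<epsilon>} \<Longrightarrow> even (w i)"
    and "\<And>i. i \<in> {1..\<epsilon>} \<Longrightarrow> homogeneous (w i) (A i) \<in> I_ideal \<Gamma>"
    and "graded.independent_mod (I_tilde_sq \<Gamma>) {1..\<epsilon>} (\<lambda>i. homogeneous (w i) (A i))"
    and "even k"
  shows "form.basis_mod (I_tilde_part \<Gamma> k) (I_tilde_sq_part \<Gamma> k)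
           {i \<in> {1..\<epsilon>}. w i \<le> k} (\<lambda>i. (D ^^ ((k - w i) div 2)) (A i))"
proof -
  interpret fuchsian_quotient \<Gamma>
    by (rule fuchsian_quotient.intro[OF cocompact_fuchsian_Union[OF assms(1,2)]])
  let ?v = "\<lambda>i. homogeneous (w i) (A i)"
  let ?u = "\<lambda>i. (D ^^ ((k - w i) div 2)) (A i)"
  let ?J = "{i \<in> {1..\<epsilon>}. w i \<le> k}"
  have indW: "graded.independent_mod quot_relations {1..\<epsilon>} ?v"
    by (rule graded.independent_mod_antimono[OF assms(6)]) (simp add: quot_relations_def)
  have wpos: "w i > 0" and AMF: "A i \<in> MF (int (w i))" if i: "i \<in> {1..\<epsilon>}" for i
  proof -
    have Ai: "A i \<in> I_part \<Gamma> (w i)" using graded_sum_component[of "w i" "A i" "I_part \<Gamma>"] assms(5)[OF i] by (simp add: I_ideal_def)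
    show pos: "w i > 0"
    proof (rule ccontr)
      assume "\<not> w i > 0"
      then have "A i = 0" using Ai by (simp add: I_part_eq)
      then have "(\<Sum>j\<in>{i}. (\<lambda>k z. (1::complex) * ?v j k z)) = 0" by (auto simp: fun_eq_iff homogeneous_apply)
      then have "(\<Sum>j\<in>{i}. (\<lambda>k z. (1::complex) * ?v j k z)) \<in> quot_relations"
        using graded.subspace_0[OF subspace_quot_relations] by (simp only:)
      from graded.independent_modD[OF indW _ _ this, of i] i show False by simp
    qed
    show "A i \<in> MF (int (w i))" using Ai pos by (simp add: I_part_eq)
  qed
  have half: "2 * ((k - w i) div 2) = k - w i" if "i \<in> {1..\<epsilon>}" for i
    using assms(4)[OF that] assms(7) by simp
  \<comment> \<open>the \<open>A i\<close> are as many as a finite basis, so they span the modular forms modulo decomposables\<close>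
  have rep: "\<exists>c. h - (\<lambda>z. \<Sum>i\<in>{i\<in>{1..\<epsilon>}. w i = l}. c i * A i z) \<in> Isq l"
    if l: "l > 0" and h: "h \<in> MF (int l)" for h l
  proof (rule finite_quotient_basis)
    fix B assume B: "finite B" "graded.basis_mod (I_ideal \<Gamma>) quot_relations B (\<lambda>x. x)"
    have "card {1..\<epsilon>} = card B"
      using graded.quot_dim_eq_card[OF subspace_quot_relations B(2,1)] assms(3) by (simp add: quot_relations_def)
    moreover have "?v ` {1..\<epsilon>} \<subseteq> I_ideal \<Gamma>" using assms(5) by blast
    moreover have "homogeneous l h \<in> I_ideal \<Gamma>"
      unfolding I_ideal_def by (rule homogeneous_in_graded_sum[OF subspace_I_part]) (use l h in \<open>simp add: I_part_eq\<close>)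
    ultimately have "\<exists>y\<in>graded.span (?v ` {1..\<epsilon>}). homogeneous l h - y \<in> quot_relations"
      by (intro graded.independent_mod_spans[OF subspace_quot_relations B(2,1) _ _ _ indW]) simp_all
    then obtain y where y: "y \<in> graded.span (?v ` {1..\<epsilon>})" "homogeneous l h - y \<in> quot_relations" by (rule bexE)
    have "finite (?v ` {1..\<epsilon>})" by simp
    from graded.span_finite[OF this] y(1) obtain u where "y = (\<Sum>x\<in>?v ` {1..\<epsilon>}. (\<lambda>k z. u x * x k z))" by auto
    then have y': "y = (\<Sum>i\<in>{1..\<epsilon>}. (\<lambda>k z. u (?v i) * ?v i k z))"
      using sum.reindex[OF graded.independent_mod_image(1)[OF subspace_quot_relations indW], of "\<lambda>x k z. u x * x k z"]
      by (simp add: o_def)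
    have yl: "y l = (\<lambda>z. \<Sum>i\<in>{i\<in>{1..\<epsilon>}. w i = l}. u (?v i) * A i z)"
    proof
      fix z
      have "y l z = (\<Sum>i\<in>{1..\<epsilon>}. if w i = l then u (?v i) * A i z else 0)"
        unfolding y' graded_sum_apply by (intro sum.cong refl) (auto simp: homogeneous_apply)
      also have "\<dots> = (\<Sum>i\<in>{i\<in>{1..\<epsilon>}. w i = l}. u (?v i) * A i z)"
        by (rule sum.inter_filter[symmetric]) simp
      finally show "y l z = (\<Sum>i\<in>{i\<in>{1..\<epsilon>}. w i = l}. u (?v i) * A i z)" .
    qed
    have "(homogeneous l h - y) l \<in> Isq l"
      using y(2) by (simp add: quot_relations_def I_tilde_sq_def graded_sum_def)
    moreover have "(homogeneous l h - y) l = h - y l" by (simp add: homogeneous_def)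
    ultimately have "h - (\<lambda>z. \<Sum>i\<in>{i\<in>{1..\<epsilon>}. w i = l}. u (?v i) * A i z) \<in> Isq l" unfolding yl by (simp only:)
    note rest = this
    show ?thesis by (rule exI[where x = "\<lambda>i. u (?v i)"]) (rule rest)
  qed
  have tilde: "I_tilde_part \<Gamma> k = (if k > 0 then QF (int k) else {0})"
    by (simp add: I_tilde_part_def quasimodular_forms_eq)
  have uQF: "?u i \<in> QF (int k)" if i: "i \<in> ?J" for i
  proof -
    have "int (w i) + 2 * int ((k - w i) div 2) = int k" using half[of i] i by auto
    then show ?thesis using D_pow_QF[OF MF_QF[OF AMF[of i]], of "(k - w i) div 2"] i by simp
  qed
  have 1: "?u ` ?J \<subseteq> I_tilde_part \<Gamma> k"
  proof
    fix x assume "x \<in> ?u ` ?J"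
    then obtain i where i: "i \<in> ?J" "x = ?u i" by blast
    then have "k > 0" using wpos[of i] by auto
    then show "x \<in> I_tilde_part \<Gamma> k" using uQF[OF i(1)] i(2) by (simp add: tilde)
  qed
  have 2: "form.independent_mod (I_tilde_sq_part \<Gamma> k) ?J ?u"
    unfolding form.independent_mod_def
  proof (intro allI impI)
    fix F c assume F: "finite F" "F \<subseteq> ?J" and s: "(\<Sum>i\<in>F. (\<lambda>z. c i * ?u i z)) \<in> Isq k"
    \<comment> \<open>group the terms by the number of derivatives\<close>
    define dp where "dp i = (k - w i) div 2" for i
    define Fj where "Fj j = {i\<in>F. dp i = j}" for j
    define B where "B j = (\<lambda>z. \<Sum>i\<in>Fj j. c i * A i z)" for j
    have Fj: "finite (Fj j)" for j using F(1) by (simp add: Fj_def)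
    have iF: "i \<in> {1..\<epsilon>}" "w i \<le> k" "w i = k - 2 * dp i" "2 * dp i < k" if "i \<in> F" for i
    proof -
      show i: "i \<in> {1..\<epsilon>}" "w i \<le> k" using F(2) that by auto
      show "w i = k - 2 * dp i" "2 * dp i < k" using half[OF i(1)] i(2) wpos[OF i(1)] by (simp_all add: dp_def)
    qed
    have wj: "w i = k - 2 * j" if "i \<in> Fj j" for i j using iF(3)[of i] that by (simp add: Fj_def)
    have "\<forall>j\<in>dp ` F. B j \<in> Isq (k - 2 * j)"
    proof (rule Isq_components)
      show "finite (dp ` F)" using F(1) by simp
      show "2 * j < k" if "j \<in> dp ` F" for j using that iF(4) by blast
      show "B j \<in> MF (int (k - 2 * j))" if "j \<in> dp ` F" for j
        unfolding B_def
      proof (rule MF_sum)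
        fix i assume i: "i \<in> Fj j"
        then have "i \<in> {1..\<epsilon>}" using iF(1) by (simp add: Fj_def)
        then show "A i \<in> MF (int (k - 2 * j))" using AMF[of i] wj[OF i] by simp
      qed
      have "(\<Sum>j\<in>dp ` F. (D ^^ j) (B j)) = (\<Sum>i\<in>F. (\<lambda>z. c i * ?u i z))"
      proof
        fix z
        have Dj: "(D ^^ j) (B j) z = (\<Sum>i\<in>Fj j. c i * (D ^^ j) (A i) z)" for j
        proof -
          have "(D ^^ j) (B j) = (\<lambda>z. \<Sum>i\<in>Fj j. c i * (D ^^ j) (A i) z)"
            unfolding B_def by (rule D_pow_sum[OF Fj]) (use AMF MF_D(2) iF(1) in \<open>auto simp: Fj_def\<close>)
          then show ?thesis by simp
        qed
        have "(\<Sum>j\<in>dp ` F. (D ^^ j) (B j)) z = (\<Sum>j\<in>dp ` F. \<Sum>i\<in>Fj j. c i * (D ^^ j) (A i) z)"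
          unfolding sum_fun_apply Dj ..
        also have "\<dots> = (\<Sum>j\<in>dp ` F. \<Sum>i\<in>{i\<in>F. dp i = j}. c i * ?u i z)"
          by (intro sum.cong) (auto simp: Fj_def dp_def)
        also have "\<dots> = (\<Sum>i\<in>F. c i * ?u i z)" by (rule sum.group) (use F(1) in auto)
        finally show "(\<Sum>j\<in>dp ` F. (D ^^ j) (B j)) z = (\<Sum>i\<in>F. (\<lambda>z. c i * ?u i z)) z" by (simp add: sum_fun_apply)
      qed
      then show "(\<Sum>j\<in>dp ` F. (D ^^ j) (B j)) \<in> Isq k" using s by simp
    qed
    then have Bj: "B (dp i) \<in> Isq (k - 2 * dp i)" if "i \<in> F" for i using that by blast
    show "\<forall>i\<in>F. c i = 0"
    proof
      fix i assume i: "i \<in> F"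
      have "(\<Sum>i\<in>Fj (dp i). (\<lambda>k z. c i * ?v i k z)) = homogeneous (k - 2 * dp i) (B (dp i))"
        unfolding B_def by (rule sum_homogeneous) (rule wj)
      also have "\<dots> \<in> I_tilde_sq \<Gamma>"
        unfolding I_tilde_sq_def by (rule homogeneous_in_graded_sum[of "I_tilde_sq_part \<Gamma>", OF subspace_Isq Bj[OF i]])
      finally have "(\<Sum>i\<in>Fj (dp i). (\<lambda>k z. c i * ?v i k z)) \<in> I_tilde_sq \<Gamma>" .
      note rel = this
      have sub: "Fj (dp i) \<subseteq> {1..\<epsilon>}" using iF(1) by (auto simp: Fj_def)
      have mem: "i \<in> Fj (dp i)" using i by (simp add: Fj_def)
      show "c i = 0" by (rule graded.independent_modD[OF assms(6) Fj sub rel mem])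
    qed
  qed
  have 3: "\<exists>y\<in>form.span (?u ` ?J). x - y \<in> Isq k" if x: "x \<in> I_tilde_part \<Gamma> k" for x
  proof (cases "k > 0")
    case False
    then have "x = 0" using x unfolding tilde by simp
    then have "x - 0 \<in> Isq k" using form.subspace_0[OF subspace_Isq] by simp
    then show ?thesis using form.span_zero by blast
  next
    case True
    let ?U = "{x. \<exists>y\<in>form.span (?u ` ?J). x - y \<in> Isq k}"
    have "form.subspace ?U"
    proof (rule form.subspaceI)
      have "0 - 0 \<in> Isq k" using form.subspace_0[OF subspace_Isq] by simp
      then show "0 \<in> ?U" using form.span_zero by blast
    next
      fix a b assume "a \<in> ?U" "b \<in> ?U"
      then obtain y z where yz: "y \<in> form.span (?u ` ?J)" "a - y \<in> Isq k" "z \<in> form.span (?u ` ?J)" "b - z \<in> Isq k" by blast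
      have "(a - y) + (b - z) \<in> Isq k" by (rule form.subspace_add[OF subspace_Isq yz(2,4)])
      moreover have "(a - y) + (b - z) = (a + b) - (y + z)" by (simp add: fun_eq_iff)
      ultimately show "a + b \<in> ?U" using form.span_add[OF yz(1,3)] by auto
    next
      fix c a assume "a \<in> ?U"
      then obtain y where y: "y \<in> form.span (?u ` ?J)" "a - y \<in> Isq k" by blast
      have "(\<lambda>z. c * (a - y) z) \<in> Isq k" by (rule form.subspace_scale[OF subspace_Isq y(2)])
      moreover have "(\<lambda>z. c * (a - y) z) = (\<lambda>z. c * a z) - (\<lambda>z. c * y z)" by (simp add: fun_eq_iff right_diff_distrib)
      ultimately show "(\<lambda>z. c * a z) \<in> ?U" using form.span_scale[OF y(1)] by auto
    qed
    moreover have "DM (int k) \<subseteq> ?U"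
    proof
      fix x assume "x \<in> DM (int k)"
      then obtain j h where x: "x = (D ^^ j) h" and h: "h \<in> MF (int k - 2 * int j)" and j: "j = 0 \<or> 2 * int j < int k"
        unfolding DM_def by blast
      define l where "l = k - 2 * j"
      have l: "l > 0" "int l = int k - 2 * int j" "l + 2 * j = k" using j True by (auto simp: l_def)
      have hl: "h \<in> MF (int l)" using h unfolding l(2) .
      from rep[OF l(1) hl] obtain c where c: "h - (\<lambda>z. \<Sum>i\<in>{i\<in>{1..\<epsilon>}. w i = l}. c i * A i z) \<in> Isq l" by (rule exE)
      let ?s = "\<lambda>z. \<Sum>i\<in>{i\<in>{1..\<epsilon>}. w i = l}. c i * A i z"
      let ?y = "\<lambda>z. \<Sum>i\<in>{i\<in>{1..\<epsilon>}. w i = l}. c i * (D ^^ j) (A i) z"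
      have sM: "?s \<in> MF (int l)" by (rule MF_sum) (use AMF in auto)
      have hs: "(h - ?s) holomorphic_on \<H>" by (rule QF_D(2)[OF subsetD[OF Isq_QF c]])
      have "(D ^^ j) h = (D ^^ j) ((h - ?s) + ?s)" by simp
      also have "\<dots> = (D ^^ j) (h - ?s) + ?y"
        unfolding D_pow_add[OF hs MF_D(2)[OF sM]] by (subst D_pow_sum) (use AMF MF_D(2) in auto)
      finally have "x - ?y = (D ^^ j) (h - ?s)" unfolding x by simp
      then have "x - ?y \<in> Isq k" using D_pow_Isq[OF c, of j] unfolding l(3) by simp
      moreover have "?y \<in> form.span (?u ` ?J)"
      proof -
        have "(\<Sum>i\<in>{i\<in>{1..\<epsilon>}. w i = l}. (\<lambda>z. c i * (D ^^ j) (A i) z)) \<in> form.span (?u ` ?J)"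
        proof (rule form.span_sum, rule form.span_scale, rule form.span_base)
          fix i assume i: "i \<in> {i\<in>{1..\<epsilon>}. w i = l}"
          then have "i \<in> ?J" "(k - w i) div 2 = j" using l(3) by auto
          then show "(D ^^ j) (A i) \<in> ?u ` ?J" by blast
        qed
        moreover have "(\<Sum>i\<in>{i\<in>{1..\<epsilon>}. w i = l}. (\<lambda>z. c i * (D ^^ j) (A i) z)) = ?y"
          by (rule ext) (rule sum_fun_apply)
        ultimately show ?thesis by (simp only:)
      qed
      ultimately show "x \<in> ?U" by blast
    qed
    ultimately have "form.span (DM (int k)) \<subseteq> ?U" by (intro form.span_minimal)
    moreover have "x \<in> form.span (DM (int k))" using QF_subset_span_DM x True by (simp add: tilde)
    ultimately show ?thesis by blast
  qed
  show ?thesis unfolding form.basis_mod_def using 1 2 3 by blast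
qed

end
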